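(* Let $(\xi,\eta)=(\xi_t,\eta_t)_{t\geq0}$ be a bivariate Lévy process, with neither $\xi$ nor $\eta$ identically zero, such that $\xi_t\to\infty$ almost surely as $t\to\infty$, and let $I_t:=\int_0^t e^{-\xi_{s-}}\,d\eta_s$. Denote the characteristic triplet of $(\xi,\eta)$ by $(\gamma,\Sigma,\Pi_{\xi,\eta})$, where $\gamma=(\gamma_1,\gamma_2)$, denote the upper diagonal element of $\Sigma$ by $\sigma_\xi^2$, and let $\Pi_\xi$ be the Lévy measure of $\xi$. Then the following are equivalent: (i) $I_t$ converges almost surely as $t\to\infty$ to a finite random variable $I$ whose distribution has an atom; (ii) $I_t$ converges almost surely as $t\to\infty$ to a constant random variable; (iii) there exists $k\in\mathbb{R}\setminus\{0\}$ such that $P\big(\int_0^t e^{-\xi_{s-}}\,d\eta_s=k(1-e^{-\xi_t}) \text{ for all } t>0\big)=1$; (iv) there exists $k\in\mathbb{R}\setminus\{0\}$ such that $e^{-\xi}=\mathcal{E}(-\eta/k)$, i.e. $e^{-\xi}$ is the stochastic exponential of $-\eta/k$; (v) there exists $k\in\mathbb{R}\setminus\{0\}$ such that \[ \Sigma=\begin{pmatrix}1 & k\\ k & k^2\end{pmatrix}\sigma_\xi^2, \] the Lévy measure $\Pi_{\xi,\eta}$ is concentrated on $\{(x,k(1-e^{-x})): x\in\mathbb{R}\}$, and \[ \gamma_1-k^{-1}\gamma_2=\frac{\sigma_\xi^2}{2}+\int_{x^2+k^2(1-e^{-x})^2\leq 1}(e^{-x}-1+x)\,\Pi_\xi(dx).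 \]
   Context: The characteristic triplet $(\gamma,\Sigma,\Pi)$ of a Lévy process $X$ in $\mathbb{R}^d$ is defined by $(1/t)\log E\exp(i\langle\theta,X_t\rangle)=i\langle\gamma,\theta\rangle-\frac12\langle\theta,\Sigma\theta\rangle+\int_{\mathbb{R}^d}(e^{i\langle z,\theta\rangle}-1-i\langle z,\theta\rangle\mathbf{1}_{|z|\leq1})\,\Pi(dz)$. Stochastic integrals are understood as in Protter with respect to the completed natural filtration; $\xi_{s-}$ is the left limit. The stochastic exponential $Z=\mathcal{E}(X)$ of a semimartingale $X$ is the unique solution of $Z_t=1+\int_0^t Z_{s-}\,dX_s$. *)

theory Defs
  imports "HOL-Probability.Probability"
begin

definition cadlag :: "(real \<Rightarrow> 'b::metric_space) \<Rightarrow> bool" where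
  "cadlag f \<longleftrightarrow> (\<forall>t\<ge>0. (f \<longlongrightarrow> f t) (at_right t) \<and> (0 < t \<longrightarrow> (\<exists>l. (f \<longlongrightarrow> l) (at_left t))))"

text \<open>Left limit f(s-), with the convention f(0-) = 0 (as in Protter).\<close>
definition left_lim :: "(real \<Rightarrow> real) \<Rightarrow> real \<Rightarrow> real" where
  "left_lim f s = (if 0 < s then Lim (at_left s) f else 0)"

definition levy_process :: "'a measure \<Rightarrow> (real \<Rightarrow> 'a \<Rightarrow> 'b::euclidean_space) \<Rightarrow> bool" where
  "levy_process M X \<longleftrightarrow>
     prob_space M \<and>
     (\<forall>t\<ge>0. X t \<in> borel_measurable M) \<and>
     (AE \<omega> in M. X 0 \<omega> = 0) \<and>
     (\<forall>(ts::nat \<Rightarrow> real) n. 0 \<le> ts 0 \<and> (\<forall>i<n. ts i \<le> ts (Suc i)) \<longrightarrow>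
        prob_space.indep_vars M (\<lambda>_. borel) (\<lambda>i \<omega>. X (ts (Suc i)) \<omega> - X (ts i) \<omega>) {..<n}) \<and>
     (\<forall>s t. 0 \<le> s \<and> 0 \<le> t \<longrightarrow>
        distr M borel (\<lambda>\<omega>. X (t + s) \<omega> - X s \<omega>) = distr M borel (X t)) \<and>
     (AE \<omega> in M. cadlag (\<lambda>t. X t \<omega>))"

definition levy_exponent :: "real^2 \<Rightarrow> real^2^2 \<Rightarrow> (real^2) measure \<Rightarrow> real^2 \<Rightarrow> complex" where
  "levy_exponent g S L \<theta> =
     \<i> * complex_of_real (g \<bullet> \<theta>) - complex_of_real (\<theta> \<bullet> (S *v \<theta>)) / 2
     + (\<integral>z. cis (z \<bullet> \<theta>) - 1 - \<i> * complex_of_real (z \<bullet> \<theta>) * (if norm z \<le> 1 then 1 else 0) \<partial>L)"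

definition levy_triplet :: "'a measure \<Rightarrow> (real \<Rightarrow> 'a \<Rightarrow> real^2) \<Rightarrow> real^2 \<Rightarrow> real^2^2 \<Rightarrow> (real^2) measure \<Rightarrow> bool" where
  "levy_triplet M X g S L \<longleftrightarrow>
     sets L = sets borel \<and> emeasure L {0} = 0 \<and>
     (\<integral>\<^sup>+z. ennreal (min 1 ((norm z)\<^sup>2)) \<partial>L) < \<infinity> \<and>
     transpose S = S \<and> (\<forall>\<theta>. 0 \<le> \<theta> \<bullet> (S *v \<theta>)) \<and>
     (\<forall>t>0. \<forall>\<theta>. (\<integral>\<omega>. cis (\<theta> \<bullet> X t \<omega>) \<partial>M) = exp (complex_of_real t * levy_exponent g S L \<theta>))"

definition first_levy_measure :: "(real^2) measure \<Rightarrow> real measure" where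
  "first_levy_measure L = distr (restrict_space L {z. z $ 1 \<noteq> 0}) borel (\<lambda>z. z $ 1)"

definition conv_in_prob :: "'a measure \<Rightarrow> (nat \<Rightarrow> 'a \<Rightarrow> real) \<Rightarrow> ('a \<Rightarrow> real) \<Rightarrow> bool" where
  "conv_in_prob M Y Z \<longleftrightarrow>
     (\<forall>\<epsilon>>0. \<forall>\<delta>>0. \<forall>\<^sub>F n in sequentially. \<exists>A\<in>sets M. measure M A < \<delta> \<and>
        {\<omega>\<in>space M. \<epsilon> < \<bar>Y n \<omega> - Z \<omega>\<bar>} \<subseteq> A)"

definition riemann_sum :: "(real \<Rightarrow> 'a \<Rightarrow> real) \<Rightarrow> (real \<Rightarrow> 'a \<Rightarrow> real) \<Rightarrow> nat \<Rightarrow> real \<Rightarrow> 'a \<Rightarrow> real" where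
  "riemann_sum H X n t \<omega> =
     (\<Sum>i<nat \<lceil>t * 2 ^ n\<rceil>. H (real i / 2 ^ n) \<omega> *
        (X (min (real (Suc i) / 2 ^ n) t) \<omega> - X (min (real i / 2 ^ n) t) \<omega>))"

text \<open>J is (a cadlag version of) the stochastic integral  J_t = int_0^t H_s dX_s  of the
  caglad adapted integrand H against the semimartingale X (Protter, Thm II.21:
  it is the limit in probability of the Riemann sums along partitions with mesh -> 0).\<close>
definition stoch_integral :: "'a measure \<Rightarrow> (real \<Rightarrow> 'a \<Rightarrow> real) \<Rightarrow> (real \<Rightarrow> 'a \<Rightarrow> real) \<Rightarrow> (real \<Rightarrow> 'a \<Rightarrow> real) \<Rightarrow> bool" where
  "stoch_integral M H X J \<longleftrightarrow>
     (\<forall>t\<ge>0. J t \<in> borel_measurable M) \<and>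
     (AE \<omega> in M. cadlag (\<lambda>t. J t \<omega>)) \<and>
     (\<forall>t\<ge>0. conv_in_prob M (\<lambda>n. riemann_sum H X n t) (J t))"

text \<open>Z (up to indistinguishability) equals the stochastic exponential of X:
  Z_t = 1 + int_0^t Z_{s-} dX_s (whose solution is unique).\<close>
definition is_stoch_exp :: "'a measure \<Rightarrow> (real \<Rightarrow> 'a \<Rightarrow> real) \<Rightarrow> (real \<Rightarrow> 'a \<Rightarrow> real) \<Rightarrow> bool" where
  "is_stoch_exp M Z X \<longleftrightarrow>
     (\<exists>J. stoch_integral M (\<lambda>s \<omega>. left_lim (\<lambda>u. Z u \<omega>) s) X J \<and>
          (AE \<omega> in M. \<forall>t\<ge>0. Z t \<omega> = 1 + J t \<omega>))"

end

theory Submission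
  imports Defs
begin

text \<open>The law of \<open>I\<close> satisfies \<open>I = J\<^sub>T + exp (-\<xi>\<^sub>T) I'\<close> with an independent copy \<open>I'\<close>. If \<open>a\<close> is an atom of
  maximal mass, then \<open>(a - J\<^sub>T) exp \<xi>\<^sub>T\<close> takes its values in the finite set of such atoms; since \<open>\<xi>\<^sub>T\<close> tends
  to infinity, there is only one of them, whence \<open>J\<^sub>T = a (1 - exp (-\<xi>\<^sub>T))\<close>.

  For the equivalence with the condition on the triplet, Ito's formula is avoided. Put
  \<open>\<phi> (x, y) = y - k (1 - exp (-x))\<close>. The Riemann sums of the integral minus \<open>k (1 - exp (-\<xi>\<^sub>t))\<close> are
  \<open>\<Sum>\<^sub>i exp (-\<xi>\<^sub>i) \<phi> (\<Delta>X\<^sub>i)\<close>, and the characteristic function of such a sum is compared with \<open>1\<close> by peeling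
  off one increment at a time. Hence everything depends on whether the characteristic function of
  \<open>\<phi> (X\<^sub>h)\<close> is \<open>1 + o(h)\<close>, that is, on the generator of \<open>X\<close> at \<open>0\<close> applied to functions of \<open>\<phi>\<close>. The
  generator is read off the characteristic exponent by approximation with trigonometric polynomials.\<close>

subsection \<open>Characteristic functions and tails\<close>

text \<open>The integral \<open>J\<close> is known only as a limit in probability of Riemann sums at
  fixed times, and its integrand exp (-\<xi>) is unbounded. Expectations of \<open>cis\<close> meet
  both obstacles: they are bounded, pass to the limit even with random coefficients, factorize over
  independent blocks of increments, and determine laws. Unboundedness costs a localization: the walk
  leaves a large interval before time t with probability at most a constant times t \<tau>, where
  \<tau> is arbitrary. The generator cannot be found from the measures P(X_h \<in> dz) / h alone,
  since their mass blows up near 0. Multiplied by a bounded weight that vanishes to second order at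
  0, they converge to a finite measure in which the Gaussian part is an atom at 0. Trigonometric
  polynomials test this convergence, because the exponent gives their expectations. The way back
  from the identity for \<open>J\<close> to the triplet uses \<eta>_h - J_h, which under the
  identity is \<phi> (X_h). Its characteristic function is 1 + o(h) because the integrand 1 - exp
  (-\<xi>) of \<eta> - J starts at 0.\<close>

lemma norm_cis_minus_1_le: "norm (cis x - 1) \<le> \<bar>x\<bar>"
  using iexp_approx1[of x 0] by (simp add: cis_conv_exp)

lemma norm_cis_minus_1_le_2: "norm (cis x - 1) \<le> 2"
  using norm_triangle_ineq4[of "cis x" 1] by simp

lemma norm_cis_approx2: "norm (cis x - 1 - \<i> * complex_of_real x) \<le> x\<^sup>2 / 2"
  using iexp_approx1[of x 1]
  by (simp add: cis_conv_exp power2_eq_square algebra_simps)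

lemma abs_sin_minus_le: "\<bar>sin x - x\<bar> \<le> x\<^sup>2 / 2" for x :: real
  using order_trans[OF abs_Im_le_cmod norm_cis_approx2, of x] by simp

text \<open>Countably many frequencies detect zero, so the null sets of a statement that holds
  almost surely for each single frequency can be united.\<close>

lemma eq_0_if_cos_eq_1:
  fixes x :: real
  assumes "\<And>m::nat. cos (x / real (Suc m)) = 1"
  shows "x = 0"
proof (rule ccontr)
  assume "x \<noteq> 0"
  \<comment> \<open>With \<open>m\<close> above \<bar>x\<bar> the scaled point lies strictly between
    0 and 1 in absolute value, where cos is strictly below 1 since it decreases on [0, pi].\<close>
  obtain m :: nat where m: "\<bar>x\<bar> < real m" using reals_Archimedean2 by blast
  define y where "y = \<bar>x\<bar> / real (Suc m)"
  have y: "0 < y" "y < 1" using \<open>x \<noteq> 0\<close> m by (auto simp: y_def divide_simps)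
  have "cos y = 1"
    using assms[of m] by (cases "x \<ge> 0") (auto simp: y_def)
  moreover have "cos y < cos 0"
    using y pi_gt3 by (intro cos_monotone_0_pi) auto
  ultimately show False by simp
qed

context prob_space
begin

lemma integrable_cis:
  assumes [measurable]: "Y \<in> borel_measurable M"
  shows "integrable M (\<lambda>x. cis (Y x))"
  by (rule integrable_const_bound[of _ 1]) (auto simp: cis_conv_exp)

lemma norm_expectation_cis_le_1:
  assumes [measurable]: "Y \<in> borel_measurable M"
  shows "norm (\<integral>x. cis (Y x) \<partial>M) \<le> 1"
  using integral_norm_bound[of M "\<lambda>x. cis (Y x)"] by (simp add: prob_space)

lemma Re_expectation_cis:
  assumes [measurable]: "Y \<in> borel_measurable M"
  shows "Re (\<integral>x. cis (Y x) \<partial>M) = (\<integral>x. cos (Y x) \<partial>M)"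
    and "Im (\<integral>x. cis (Y x) \<partial>M) = (\<integral>x. sin (Y x) \<partial>M)"
  using integral_Re[OF integrable_cis[OF assms]] integral_Im[OF integrable_cis[OF assms]] by simp_all

text \<open>Only the real part is used: 1 - cos (u Y) is nonnegative with expectation 0, hence
  vanishes almost surely for each u. The frequencies 1 / (m + 1) then force Y = 0.\<close>

lemma AE_eq_0_if_expectation_cis:
  fixes Y :: "'a \<Rightarrow> real"
  assumes [measurable]: "Y \<in> borel_measurable M"
    and 1: "\<And>u. (\<integral>x. cis (u * Y x) \<partial>M) = 1"
  shows "AE x in M. Y x = 0"
proof -
  have *: "AE x in M. cos (u * Y x) = 1" for u
  proof -
    have int: "integrable M (\<lambda>x. cos (u * Y x))"
      by (rule integrable_const_bound[of _ 1]) auto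
    have "(\<integral>x. 1 - cos (u * Y x) \<partial>M) = 0"
      using Re_expectation_cis(1)[of "\<lambda>x. u * Y x"] 1[of u] int by (simp add: prob_space)
    then have "AE x in M. 1 - cos (u * Y x) = 0"
      using int by (subst (asm) integral_nonneg_eq_0_iff_AE) auto
    then show ?thesis by eventually_elim simp
  qed
  have "AE x in M. \<forall>m::nat. cos (1 / real (Suc m) * Y x) = 1"
    unfolding AE_all_countable using * by blast
  then show ?thesis by eventually_elim (auto intro: eq_0_if_cos_eq_1)
qed

text \<open>The average of cos (a y) over a in [0, 1] is sin y / y, which is at most 1/2 in absolute
  value once \<bar>y\<bar> \<ge> 2.\<close>

lemma sinc_average_ge_half:
  fixes y :: real assumes "2 \<le> \<bar>y\<bar>"
  shows "(\<integral>a. (1 - cos (a * y)) * indicator {0..1} a \<partial>lborel) \<ge> 1 / 2"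
proof -
  have "y \<noteq> 0" using assms by auto
  have "(\<integral>a. (1 - cos (a * y)) * indicator {0..1} a \<partial>lborel) = (1 - sin (1 * y) / y) - (0 - sin (0 * y) / y)"
    by (rule integral_FTC_Icc_real)
       (use \<open>y \<noteq> 0\<close> in \<open>auto intro!: derivative_eq_intros continuous_intros\<close>)
  also have "\<dots> \<ge> 1 / 2"
  proof -
    have "\<bar>sin y / y\<bar> \<le> 1 / 2"
      using assms abs_sin_le_one[of y] \<open>y \<noteq> 0\<close> unfolding abs_divide
      by (subst pos_divide_le_eq) linarith+
    from abs_le_D1[OF this] show ?thesis by simp
  qed
  finally show ?thesis .
qed

text \<open>The classical truncation inequality: averaging 1 - cos (a Y) over the frequencies a in
  [0, 2 / r] gives at least 1/2 on the event \<bar>Y\<bar> \<ge> r, and Fubini turns this average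
  into one of 1 minus the real part of the characteristic function. Low frequencies thus control
  tails without any moment.\<close>

lemma tail_le_char:
  fixes Y :: "'a \<Rightarrow> real"
  assumes [measurable]: "Y \<in> borel_measurable M" and r: "0 < r"
    and le: "\<And>a. \<bar>a\<bar> \<le> 2 / r \<Longrightarrow> norm ((\<integral>x. cis (a * Y x) \<partial>M) - 1) \<le> e"
  shows "prob {x \<in> space M. r \<le> \<bar>Y x\<bar>} \<le> 2 * e"
proof -
  interpret P: pair_sigma_finite M lborel ..
  \<comment> \<open>The scaling turns \<bar>Y\<bar> \<ge> r into \<bar>c Y\<bar> \<ge> 2, the
    threshold of \<open>sinc_average_ge_half\<close>.\<close>
  define c where "c = 2 / r"
  define f where "f = (\<lambda>(x, a::real). (1 - cos (a * (c * Y x))) * indicator {0..1} a)"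
  have [measurable]: "f \<in> borel_measurable (M \<Otimes>\<^sub>M lborel)" unfolding f_def by measurable
  have int: "integrable (M \<Otimes>\<^sub>M lborel) f"
  proof (rule Bochner_Integration.integrable_bound)
    have "integrable (M \<Otimes>\<^sub>M lborel) (indicator (space M \<times> {0..1::real}) :: _ \<Rightarrow> real)"
      by (rule integrable_real_indicator) (auto simp: lborel.emeasure_pair_measure_Times emeasure_space_1)
    then show "integrable (M \<Otimes>\<^sub>M lborel) (\<lambda>x. 2 * indicator (space M \<times> {0..1::real}) x :: real)"
      by simp
    show "AE x in M \<Otimes>\<^sub>M lborel. norm (f x) \<le> norm (2 * indicator (space M \<times> {0..1::real}) x :: real)"
      using order_trans[OF cos_le_one, of 3] unfolding f_def
      by (intro AE_I2) (auto simp: space_pair_measure indicator_def split: if_splits)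
  qed simp
  have "prob {x \<in> space M. r \<le> \<bar>Y x\<bar>} = (\<integral>x. indicator {x \<in> space M. r \<le> \<bar>Y x\<bar>} x \<partial>M)"
    by simp
  also have "\<dots> \<le> (\<integral>x. 2 * (\<integral>a. f (x, a) \<partial>lborel) \<partial>M)"
  proof (rule integral_mono)
    show "integrable M (\<lambda>x. 2 * (\<integral>a. f (x, a) \<partial>lborel))"
      using P.integrable_fst'[OF int] by simp
    show "indicator {x \<in> space M. r \<le> \<bar>Y x\<bar>} x \<le> 2 * (\<integral>a. f (x, a) \<partial>lborel)" for x
    proof (cases "r \<le> \<bar>Y x\<bar>")
      case True
      then have "2 \<le> \<bar>c * Y x\<bar>" using r by (simp add: c_def abs_mult divide_simps)
      from sinc_average_ge_half[OF this] True show ?thesis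
        by (auto simp: f_def split: split_indicator)
    next
      case False
      have "0 \<le> (\<integral>a. f (x, a) \<partial>lborel)"
        by (rule integral_nonneg_AE) (auto simp: f_def split: split_indicator)
      with False show ?thesis by simp
    qed
  qed (auto simp: less_top[symmetric] intro!: integrable_real_indicator)
  also have "\<dots> = 2 * (\<integral>a. (\<integral>x. f (x, a) \<partial>M) \<partial>lborel)"
    using P.Fubini_integral[of "\<lambda>x a. f (x, a)"] int by simp
  also have "(\<integral>a. (\<integral>x. f (x, a) \<partial>M) \<partial>lborel) \<le> (\<integral>a. e * indicator {0..1::real} a \<partial>lborel)"
  proof (rule integral_mono)
    show "integrable lborel (\<lambda>a. \<integral>x. f (x, a) \<partial>M)"
      using P.integrable_snd[of "\<lambda>x a. f (x, a)"] int by simp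
    show "integrable lborel (\<lambda>a. e * indicator {0..1::real} a)"
      by (auto intro!: integrable_mult_right integrable_real_indicator)
    show "(\<integral>x. f (x, a) \<partial>M) \<le> e * indicator {0..1} a" for a
    proof (cases "a \<in> {0..1}")
      case True
      have int: "integrable M (\<lambda>x. cos (a * c * Y x))"
        by (rule integrable_const_bound[of _ 1]) auto
      have "(\<integral>x. f (x, a) \<partial>M) = - Re ((\<integral>x. cis (a * c * Y x) \<partial>M) - 1)"
        using True int by (simp add: f_def Re_expectation_cis(1) prob_space mult.assoc)
      also have "\<dots> \<le> norm ((\<integral>x. cis (a * c * Y x) \<partial>M) - 1)"
        using abs_Re_le_cmod[of "(\<integral>x. cis (a * c * Y x) \<partial>M) - 1"] by linarith
      also have "\<dots> \<le> e"
        using True r by (intro le) (auto simp: c_def divide_simps)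
      finally show ?thesis using True by simp
    qed (simp add: f_def)
  qed
  also have "(\<integral>a. e * indicator {0..1::real} a \<partial>lborel) = e" by simp
  finally show ?thesis by simp
qed

text \<open>Freezing: given \<open>Y\<close>, the coefficient c (Y) is a constant while
  \<open>Y'\<close> keeps its law, so the inner expectation is taken with \<open>Y\<close> fixed.
  This is Fubini for the product law of the pair and does the work of conditional
  expectations.\<close>

lemma expectation_cis_indep:
  fixes V :: "'b \<Rightarrow> real" and f :: "'b \<Rightarrow> complex" and c :: "'b \<Rightarrow> real"
  assumes ind: "indep_var N Y N' Y'"
    and [measurable]: "f \<in> borel_measurable N" "c \<in> borel_measurable N" "V \<in> borel_measurable N'"
    and f: "\<And>y. norm (f y) \<le> 1"
  shows "(\<integral>x. f (Y x) * cis (c (Y x) * V (Y' x)) \<partial>M) =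
         (\<integral>x. f (Y x) * (\<integral>x'. cis (c (Y x) * V (Y' x')) \<partial>M) \<partial>M)"
proof -
  have [measurable]: "Y \<in> measurable M N" "Y' \<in> measurable M N'"
    using ind unfolding indep_var_distribution_eq by auto
  interpret Y: prob_space "distr M N Y" by (rule prob_space_distr) simp
  interpret V: prob_space "distr M N' Y'" by (rule prob_space_distr) simp
  interpret YV: pair_prob_space "distr M N Y" "distr M N' Y'" ..
  have eq: "distr M N Y \<Otimes>\<^sub>M distr M N' Y' = distr M (N \<Otimes>\<^sub>M N') (\<lambda>x. (Y x, Y' x))"
    using ind by (simp add: indep_var_distribution_eq)
  let ?g = "\<lambda>z. f (fst z) * cis (c (fst z) * V (snd z))"
  have m: "?g \<in> borel_measurable (N \<Otimes>\<^sub>M N')" by (simp add: cis_conv_exp)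
  have m': "?g \<in> borel_measurable (distr M N Y \<Otimes>\<^sub>M distr M N' Y')" unfolding eq using m by simp
  have int: "integrable (distr M N Y \<Otimes>\<^sub>M distr M N' Y') ?g"
    by (rule YV.integrable_const_bound[of _ 1]) (use m' in \<open>auto simp: norm_mult f\<close>)
  have V: "(\<integral>v. cis (c y * V v) \<partial>distr M N' Y') = (\<integral>x'. cis (c y * V (Y' x')) \<partial>M)" for y
    by (subst integral_distr) (auto simp: cis_conv_exp)
  have "(\<lambda>y. \<integral>v. cis (c y * V v) \<partial>distr M N' Y') \<in> borel_measurable N"
    by (intro V.borel_measurable_lebesgue_integral) (simp add: cis_conv_exp)
  then have [measurable]: "(\<lambda>y. \<integral>x'. cis (c y * V (Y' x')) \<partial>M) \<in> borel_measurable N"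
    unfolding V .
  have "(\<integral>x. f (Y x) * cis (c (Y x) * V (Y' x)) \<partial>M) = (\<integral>z. ?g z \<partial>distr M (N \<Otimes>\<^sub>M N') (\<lambda>x. (Y x, Y' x)))"
    using m by (subst integral_distr) simp_all
  also have "\<dots> = (\<integral>y. (\<integral>v. ?g (y, v) \<partial>distr M N' Y') \<partial>distr M N Y)"
    unfolding eq[symmetric] using YV.integral_fst'[OF int] by simp
  also have "\<dots> = (\<integral>y. f y * (\<integral>x'. cis (c y * V (Y' x')) \<partial>M) \<partial>distr M N Y)"
    using V by simp
  also have "\<dots> = (\<integral>x. f (Y x) * (\<integral>x'. cis (c (Y x) * V (Y' x')) \<partial>M) \<partial>M)"
    by (subst integral_distr) simp_all
  finally show ?thesis .
qed

end

subsection \<open>Sums of independent variables and convergence in probability\<close>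

lemma conv_in_probD:
  assumes "conv_in_prob M Y Z" "0 < e" "0 < d"
  shows "\<forall>\<^sub>F n in sequentially. \<exists>A\<in>sets M. measure M A < d \<and> {x \<in> space M. e < \<bar>Y n x - Z x\<bar>} \<subseteq> A"
  using assms by (simp add: conv_in_prob_def)

context prob_space
begin

lemma norm_expectation_cis_sum_minus_1_le:
  fixes D :: "nat \<Rightarrow> 'a \<Rightarrow> 'b::euclidean_space" and H w :: "'b \<Rightarrow> real"
  assumes ind: "indep_vars (\<lambda>_. borel) D {..<N}"
    and [measurable]: "H \<in> borel_measurable borel" "w \<in> borel_measurable borel"
    and "n \<le> N"
  shows "norm ((\<integral>x. cis (\<Sum>i<n. H (\<Sum>j<i. D j x) * w (D i x)) \<partial>M) - 1)
    \<le> (\<Sum>i<n. \<integral>x. norm ((\<integral>x'. cis (H (\<Sum>j<i. D j x) * w (D i x')) \<partial>M) - 1) \<partial>M)"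
  using \<open>n \<le> N\<close>
proof (induction n)
  case 0
  then show ?case by (simp add: prob_space)
next
  case (Suc n)
  have [measurable]: "D i \<in> borel_measurable M" if "i < N" for i
    using ind that by (auto simp: indep_vars_def)
  have [measurable]: "D i \<in> borel_measurable M" if "i < Suc n" for i
    using Suc.prems that by simp
  have [measurable]: "D i \<in> borel_measurable M" if "i \<in> {..<n}" for i
    using Suc.prems that by simp
  let ?chi = "\<lambda>v. \<integral>x'. cis (v * w (D n x')) \<partial>M"
  let ?S = "\<lambda>x. \<Sum>i<n. H (\<Sum>j<i. D j x) * w (D i x)"
  let ?H = "\<lambda>x. H (\<Sum>j<n. D j x)"
  let ?Y = "\<lambda>x. restrict (\<lambda>i. D i x) {..<n}" and ?Y' = "\<lambda>x. restrict (\<lambda>i. D i x) {n}"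
  have Dm: "D n \<in> borel_measurable M" by simp
  have chi[measurable]: "?chi \<in> borel_measurable borel"
    by (intro borel_measurable_lebesgue_integral) (use Dm in \<open>simp add: cis_conv_exp\<close>)
  have Sm[measurable]: "?S \<in> borel_measurable M"
  proof (intro borel_measurable_sum)
    fix i assume "i \<in> {..<n}"
    then have "\<And>j. j \<in> {..<i} \<Longrightarrow> D j \<in> borel_measurable M" "D i \<in> borel_measurable M"
      using Suc.prems by auto
    then show "(\<lambda>x. H (\<Sum>j<i. D j x) * w (D i x)) \<in> borel_measurable M" by measurable
  qed
  have Hm[measurable]: "?H \<in> borel_measurable M" by measurable
  have "indep_var (PiM {..<n} (\<lambda>_. borel)) ?Y (PiM {n} (\<lambda>_. borel)) ?Y'"
    by (rule indep_var_restrict[OF ind]) (use Suc.prems in auto)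
  note * = expectation_cis_indep[OF this, of "\<lambda>y. cis (\<Sum>i<n. H (\<Sum>j<i. y j) * w (y i))" "\<lambda>y. H (\<Sum>j<n. y j)" "\<lambda>y. w (y n)"]
  have "(\<integral>x. cis (?S x) * cis (?H x * w (D n x)) \<partial>M) = (\<integral>x. cis (?S x) * ?chi (?H x) \<partial>M)"
  proof -
    have 1: "(\<lambda>y. \<Sum>i<n. H (\<Sum>j<i. y j) * w (y i)) \<in> borel_measurable (PiM {..<n} (\<lambda>_. borel))"
    proof (intro borel_measurable_sum)
      fix i assume "i \<in> {..<n}"
      then have "\<And>j. j \<in> {..<i} \<Longrightarrow> (\<lambda>y. y j) \<in> borel_measurable (PiM {..<n} (\<lambda>_. borel :: 'b measure))"
         "(\<lambda>y. y i) \<in> borel_measurable (PiM {..<n} (\<lambda>_. borel :: 'b measure))"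
        by (auto intro!: measurable_component_singleton)
      then show "(\<lambda>y. H (\<Sum>j<i. y j) * w (y i)) \<in> borel_measurable (PiM {..<n} (\<lambda>_. borel))" by measurable
    qed
    have S: "(\<Sum>j<i. restrict (\<lambda>i. D i x) {..<n} j) = (\<Sum>j<i. D j x)" if "i \<le> n" for i x
      using that by (intro sum.cong) auto
    have "(\<Sum>i<n. H (\<Sum>j<i. restrict (\<lambda>i. D i x) {..<n} j) * w (restrict (\<lambda>i. D i x) {..<n} i)) = ?S x" for x
      by (intro sum.cong) (auto simp: S)
    with * show ?thesis using 1 by (simp add: S cis_conv_exp)
  qed
  then have eq: "(\<integral>x. cis (\<Sum>i<Suc n. H (\<Sum>j<i. D j x) * w (D i x)) \<partial>M) = (\<integral>x. cis (?S x) * ?chi (?H x) \<partial>M)"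
    by (simp add: cis_mult)
  have chi1: "norm (?chi v) \<le> 1" for v
    using norm_expectation_cis_le_1[of "\<lambda>x. v * w (D n x)"] by simp
  have i1: "integrable M (\<lambda>x. cis (?S x) * ?chi (?H x))"
    by (rule integrable_const_bound[of _ 1]) (use chi1 in \<open>auto simp: norm_mult cis_conv_exp\<close>)
  have i2: "integrable M (\<lambda>x. cis (?S x))" by (rule integrable_cis) simp
  have "norm ((\<integral>x. cis (?S x) * ?chi (?H x) \<partial>M) - (\<integral>x. cis (?S x) \<partial>M))
      = norm (\<integral>x. cis (?S x) * (?chi (?H x) - 1) \<partial>M)"
    using i1 i2 by (simp add: algebra_simps)
  also have "\<dots> \<le> (\<integral>x. norm (cis (?S x) * (?chi (?H x) - 1)) \<partial>M)" by (rule integral_norm_bound)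
  also have "\<dots> = (\<integral>x. norm (?chi (?H x) - 1) \<partial>M)" by (simp add: norm_mult)
  finally have "norm ((\<integral>x. cis (\<Sum>i<Suc n. H (\<Sum>j<i. D j x) * w (D i x)) \<partial>M) - (\<integral>x. cis (?S x) \<partial>M))
     \<le> (\<integral>x. norm (?chi (?H x) - 1) \<partial>M)" unfolding eq .
  moreover have "norm ((\<integral>x. cis (?S x) \<partial>M) - 1)
     \<le> (\<Sum>i<n. \<integral>x. norm ((\<integral>x'. cis (H (\<Sum>j<i. D j x) * w (D i x')) \<partial>M) - 1) \<partial>M)"
    using Suc by simp
  ultimately show ?case
    using norm_triangle_ineq[of "(\<integral>x. cis (\<Sum>i<Suc n. H (\<Sum>j<i. D j x) * w (D i x)) \<partial>M) - (\<integral>x. cis (?S x) \<partial>M)" "(\<integral>x. cis (?S x) \<partial>M) - 1"]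
    by simp
qed

text \<open>Decompose by the first index at which the partial sum reaches \<open>2 * r\<close>. This
  event is independent of the later increments, whose sum stays below \<open>r\<close> with
  probability at least 1/2, and both together force the full sum to be at least
  \<open>r\<close>.\<close>

lemma Ottaviani:
  fixes D :: "nat \<Rightarrow> 'a \<Rightarrow> real"
  assumes ind: "indep_vars (\<lambda>_. borel) D {..<N}"
    and half: "\<And>n. n \<le> N \<Longrightarrow> prob {x \<in> space M. r \<le> \<bar>\<Sum>j\<in>{n..<N}. D j x\<bar>} \<le> 1 / 2"
  shows "prob {x \<in> space M. \<exists>n\<le>N. 2 * r \<le> \<bar>\<Sum>j<n. D j x\<bar>} \<le> 2 * prob {x \<in> space M. r \<le> \<bar>\<Sum>j<N. D j x\<bar>}"
proof -
  have Dm: "D i \<in> borel_measurable M" if "i < N" for i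
    using ind that by (auto simp: indep_vars_def)
  define S where "S = (\<lambda>n x. \<Sum>j<n. D j x)"
  have Sm[measurable]: "S n \<in> borel_measurable M" if "n \<le> N" for n
    unfolding S_def using that by (intro borel_measurable_sum Dm) auto
  define T where "T = (\<lambda>n x. \<Sum>j\<in>{n..<N}. D j x)"
  have Tm[measurable]: "T n \<in> borel_measurable M" for n
    unfolding T_def by (intro borel_measurable_sum Dm) auto
  have ST: "S N x = S n x + T n x" if "n \<le> N" for n x
    unfolding S_def T_def using that by (simp add: sum.atLeastLessThan_concat lessThan_atLeast0)
  define A where "A = (\<lambda>n. {x \<in> space M. 2 * r \<le> \<bar>S n x\<bar> \<and> (\<forall>i<n. \<bar>S i x\<bar> < 2 * r)})"
  define B where "B = (\<lambda>n. {x \<in> space M. \<bar>T n x\<bar> < r})"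
  have Am: "A n \<in> events" if "n \<le> N" for n
  proof -
    have "S i \<in> borel_measurable M" if "i \<in> {..n}" for i using that \<open>n \<le> N\<close> by auto
    then have "{x \<in> space M. 2 * r \<le> \<bar>S n x\<bar>} \<inter> {x \<in> space M. \<forall>i\<in>{..<n}. \<bar>S i x\<bar> < 2 * r} \<in> events"
      by (intro sets.Int sets.sets_Collect_finite_All) auto
    moreover have "A n = {x \<in> space M. 2 * r \<le> \<bar>S n x\<bar>} \<inter> {x \<in> space M. \<forall>i\<in>{..<n}. \<bar>S i x\<bar> < 2 * r}"
      by (auto simp: A_def)
    ultimately show ?thesis by simp
  qed
  have Bm: "B n \<in> events" for n unfolding B_def by measurable
  have AB: "prob (A n \<inter> B n) = prob (A n) * prob (B n)" if n: "n \<le> N" for n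
  proof -
    let ?Y = "\<lambda>x. restrict (\<lambda>i. D i x) {..<n}" and ?Y' = "\<lambda>x. restrict (\<lambda>i. D i x) {n..<N}"
    let ?P = "PiM {..<n} (\<lambda>_. borel :: real measure)" and ?P' = "PiM {n..<N} (\<lambda>_. borel :: real measure)"
    have iv: "indep_var ?P ?Y ?P' ?Y'"
      by (rule indep_var_restrict[OF ind]) (use n in auto)
    let ?A = "{y \<in> space ?P. 2 * r \<le> \<bar>\<Sum>j<n. y j\<bar> \<and> (\<forall>i\<in>{..<n}. \<bar>\<Sum>j<i. y j\<bar> < 2 * r)}"
    let ?B = "{y \<in> space ?P'. \<bar>\<Sum>j\<in>{n..<N}. y j\<bar> < r}"
    have m: "(\<lambda>y. \<Sum>j<i. y j) \<in> borel_measurable ?P" if "i \<le> n" for i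
      using that by (intro borel_measurable_sum measurable_component_singleton) auto
    have "{y \<in> space ?P. 2 * r \<le> \<bar>\<Sum>j<n. y j\<bar>} \<inter> {y \<in> space ?P. \<forall>i\<in>{..<n}. \<bar>\<Sum>j<i. y j\<bar> < 2 * r} \<in> sets ?P"
      using m by (intro sets.Int sets.sets_Collect_finite_All) auto
    moreover have "?A = {y \<in> space ?P. 2 * r \<le> \<bar>\<Sum>j<n. y j\<bar>} \<inter> {y \<in> space ?P. \<forall>i\<in>{..<n}. \<bar>\<Sum>j<i. y j\<bar> < 2 * r}"
      by auto
    ultimately have A: "?A \<in> sets ?P" by simp
    have "(\<lambda>y. \<Sum>j\<in>{n..<N}. y j) \<in> borel_measurable ?P'"
      by (intro borel_measurable_sum measurable_component_singleton) auto
    then have B: "?B \<in> sets ?P'" by measurable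
    have S: "(\<Sum>j<i. restrict (\<lambda>i. D i x) {..<n} j) = (\<Sum>j<i. D j x)" if "i \<le> n" for i x
      using that by (intro sum.cong) auto
    have eA: "?Y -` ?A \<inter> space M = A n"
      by (auto simp: A_def space_PiM PiE_def S_def S)
    have eB: "?Y' -` ?B \<inter> space M = B n"
      by (auto simp: B_def space_PiM PiE_def T_def)
    have "prob ((\<lambda>x. (?Y x, ?Y' x)) -` (?A \<times> ?B) \<inter> space M) = prob (A n) * prob (B n)"
      using indep_varD[OF iv A B] unfolding eA eB .
    moreover have "(\<lambda>x. (?Y x, ?Y' x)) -` (?A \<times> ?B) \<inter> space M = A n \<inter> B n"
      unfolding eA[symmetric] eB[symmetric] by blast
    ultimately show ?thesis by simp
  qed
  have Bhalf: "1 / 2 \<le> prob (B n)" if "n \<le> N" for n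
  proof -
    have "B n = space M - {x \<in> space M. r \<le> \<bar>T n x\<bar>}" by (auto simp: B_def)
    then have "prob (B n) = 1 - prob {x \<in> space M. r \<le> \<bar>T n x\<bar>}" by (simp add: prob_compl)
    then show ?thesis using half[OF that] by (simp add: T_def)
  qed
  have disj: "disjoint_family_on A {..N}"
    by (auto simp: disjoint_family_on_def A_def) (metis linorder_neqE_nat not_le)
  have "prob {x \<in> space M. \<exists>n\<le>N. 2 * r \<le> \<bar>\<Sum>j<n. D j x\<bar>} = prob (\<Union>n\<le>N. A n)"
  proof (intro arg_cong[of _ _ prob] Set.set_eqI iffI)
    fix x assume "x \<in> {x \<in> space M. \<exists>n\<le>N. 2 * r \<le> \<bar>\<Sum>j<n. D j x\<bar>}"
    then obtain n where n: "x \<in> space M" "n \<le> N" "2 * r \<le> \<bar>S n x\<bar>" by (auto simp: S_def)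
    define m where "m = (LEAST n. 2 * r \<le> \<bar>S n x\<bar>)"
    have "2 * r \<le> \<bar>S m x\<bar>" "m \<le> n"
      unfolding m_def using n by (auto intro: LeastI2 Least_le)
    moreover have "\<forall>i<m. \<bar>S i x\<bar> < 2 * r"
      unfolding m_def using not_less_Least by force
    ultimately show "x \<in> (\<Union>n\<le>N. A n)" using n by (auto simp: A_def)
  qed (auto simp: A_def S_def)
  also have "\<dots> = (\<Sum>n\<le>N. prob (A n))"
    by (rule finite_measure_finite_Union) (use Am disj in auto)
  also have "\<dots> \<le> (\<Sum>n\<le>N. 2 * prob (A n \<inter> B n))"
  proof (rule sum_mono)
    fix n assume "n \<in> {..N}"
    then show "prob (A n) \<le> 2 * prob (A n \<inter> B n)"
      using mult_left_mono[OF Bhalf[of n], of "prob (A n)"] AB[of n] by simp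
  qed
  also have "\<dots> = 2 * prob (\<Union>n\<le>N. A n \<inter> B n)"
    unfolding sum_distrib_left[symmetric]
  proof (subst finite_measure_finite_Union)
    show "disjoint_family_on (\<lambda>n. A n \<inter> B n) {..N}"
      using disj by (auto simp: disjoint_family_on_def)
  qed (use Am Bm in auto)
  also have "\<dots> \<le> 2 * prob {x \<in> space M. r \<le> \<bar>S N x\<bar>}"
  proof (intro mult_left_mono finite_measure_mono subsetI)
    fix x assume "x \<in> (\<Union>n\<le>N. A n \<inter> B n)"
    then obtain n where n: "n \<le> N" "x \<in> A n" "x \<in> B n" by auto
    then show "x \<in> {x \<in> space M. r \<le> \<bar>S N x\<bar>}"
      using ST[OF n(1), of x] by (auto simp: A_def B_def)
  qed auto
  finally show ?thesis by (simp add: S_def)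
qed

text \<open>The joint law of independent variables is the product of the marginals. This will show
  that a block of increments has the same joint law as the block of equal length that starts at time
  0.\<close>

lemma distr_restrict_eq:
  fixes D D' :: "nat \<Rightarrow> 'a \<Rightarrow> 'b"
  assumes "indep_vars (\<lambda>_. N) D {..<n}" "indep_vars (\<lambda>_. N) D' {..<n}"
    and eq: "\<And>i. i < n \<Longrightarrow> distr M N (D i) = distr M N (D' i)"
  shows "distr M (PiM {..<n} (\<lambda>_. N)) (\<lambda>x. \<lambda>i\<in>{..<n}. D i x) = distr M (PiM {..<n} (\<lambda>_. N)) (\<lambda>x. \<lambda>i\<in>{..<n}. D' i x)"
proof (cases "n = 0")
  case False
  then have ne: "{..<n} \<noteq> {}" by (auto simp: lessThan_empty_iff)
  have m: "D i \<in> measurable M N" "D' i \<in> measurable M N" if "i \<in> {..<n}" for i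
    using assms that by (auto simp: indep_vars_def)
  have "distr M (PiM {..<n} (\<lambda>_. N)) (\<lambda>x. \<lambda>i\<in>{..<n}. D i x) = PiM {..<n} (\<lambda>i. distr M N (D i))"
    using assms(1) indep_vars_iff_distr_eq_PiM'[where X=D and M'="\<lambda>_. N", OF ne m(1)] by simp
  also have "\<dots> = PiM {..<n} (\<lambda>i. distr M N (D' i))"
    by (intro PiM_cong refl eq) simp
  also have "\<dots> = distr M (PiM {..<n} (\<lambda>_. N)) (\<lambda>x. \<lambda>i\<in>{..<n}. D' i x)"
    using assms(2) indep_vars_iff_distr_eq_PiM'[where X=D' and M'="\<lambda>_. N", OF ne m(2)] by simp
  finally show ?thesis .
next
  case True
  have "(\<lambda>x. \<lambda>i\<in>{..<n}. D i x) = (\<lambda>x. \<lambda>i\<in>{..<n}. D' i x)"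
    unfolding True by (auto simp: fun_eq_iff restrict_def)
  then show ?thesis by simp
qed

section \<open>Convergence in probability\<close>

lemma prob_gt_nat_tendsto_0:
  fixes B :: "'a \<Rightarrow> real"
  assumes [measurable]: "B \<in> borel_measurable M"
  shows "(\<lambda>K::nat. prob {x \<in> space M. real K < \<bar>B x\<bar>}) \<longlonglongrightarrow> 0"
proof -
  have "(\<lambda>K::nat. prob {x \<in> space M. real K < \<bar>B x\<bar>}) \<longlonglongrightarrow> prob (\<Inter>K::nat. {x \<in> space M. real K < \<bar>B x\<bar>})"
    by (rule finite_Lim_measure_decseq) (auto simp: decseq_def)
  also have "(\<Inter>K::nat. {x \<in> space M. real K < \<bar>B x\<bar>}) = {}"
  proof safe
    fix x assume x: "x \<in> (\<Inter>K::nat. {x \<in> space M. real K < \<bar>B x\<bar>})"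
    obtain K :: nat where "\<bar>B x\<bar> < real K" using reals_Archimedean2 by blast
    moreover have "real K < \<bar>B x\<bar>" using x by blast
    ultimately show "x \<in> {}" by simp
  qed
  finally show ?thesis by simp
qed

text \<open>The coefficients are random and \<open>B\<close> is unbounded: in the splitting of the
  integral at a time T it is a multiple of exp (\<xi>_T). Truncating \<open>B\<close> at a level
  that is rarely exceeded makes the deviation of \<open>B * Y n\<close> small on the rest.\<close>

lemma conv_in_prob_cis:
  fixes Y :: "nat \<Rightarrow> 'a \<Rightarrow> real"
  assumes [measurable]: "\<And>n. Y n \<in> borel_measurable M" "Z \<in> borel_measurable M"
      "A \<in> borel_measurable M" "B \<in> borel_measurable M"
    and conv: "conv_in_prob M Y Z"
  shows "(\<lambda>n. \<integral>x. cis (A x + B x * Y n x) \<partial>M) \<longlonglongrightarrow> (\<integral>x. cis (A x + B x * Z x) \<partial>M)"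
proof (rule tendstoI)
  fix e :: real assume "0 < e"
  \<comment> \<open>The event \<open>E\<close> where \<open>B\<close> is large and the cover
    \<open>C\<close> of the deviations cost less than \<open>2 * d\<close> each, the rest costs
    \<open>d\<close>; the total is below 5 e / 6.\<close>
  define d where "d = e / 6"
  have d: "d > 0" using \<open>0 < e\<close> by (simp add: d_def)
  have "\<forall>\<^sub>F K in sequentially. prob {x \<in> space M. real K < \<bar>B x\<bar>} < d"
    using order_tendstoD(2)[OF prob_gt_nat_tendsto_0[of B]] d by simp
  then obtain K :: nat where K: "prob {x \<in> space M. real K < \<bar>B x\<bar>} < d"
    using eventually_happens'[OF sequentially_bot] by blast
  have pos: "d / (real K + 1) > 0" using d by simp
  have "\<forall>\<^sub>F n in sequentially. \<exists>C\<in>events. prob C < d \<and> {x \<in> space M. d / (real K + 1) < \<bar>Y n x - Z x\<bar>} \<subseteq> C"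
    using conv pos d by (intro conv_in_probD)
  then show "\<forall>\<^sub>F n in sequentially. dist (\<integral>x. cis (A x + B x * Y n x) \<partial>M) (\<integral>x. cis (A x + B x * Z x) \<partial>M) < e"
  proof eventually_elim
    case (elim n)
    then obtain C where C[measurable]: "C \<in> events" and pC: "prob C < d"
      and sub: "{x \<in> space M. d / (real K + 1) < \<bar>Y n x - Z x\<bar>} \<subseteq> C" by blast
    define E where "E = {x \<in> space M. real K < \<bar>B x\<bar>}"
    have E[measurable]: "E \<in> events" by (simp add: E_def)
    let ?g = "\<lambda>x. 2 * indicator E x + 2 * indicator C x + d :: real"
    have int: "integrable M (indicator E :: _ \<Rightarrow> real)" "integrable M (indicator C :: _ \<Rightarrow> real)"
      by (auto intro!: integrable_real_indicator simp: less_top[symmetric])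
    have bd: "norm (cis (A x + B x * Y n x) - cis (A x + B x * Z x)) \<le> ?g x" if x: "x \<in> space M" for x
    proof -
      have "cis (A x + B x * Y n x) - cis (A x + B x * Z x) = cis (A x + B x * Z x) * (cis (B x * (Y n x - Z x)) - 1)"
        by (simp add: algebra_simps cis_mult)
      then have eq: "norm (cis (A x + B x * Y n x) - cis (A x + B x * Z x)) = norm (cis (B x * (Y n x - Z x)) - 1)"
        by (simp add: norm_mult)
      show ?thesis
      proof (cases "x \<in> E \<or> x \<in> C")
        case True
        then show ?thesis unfolding eq using norm_cis_minus_1_le_2[of "B x * (Y n x - Z x)"] d
          by (auto split: split_indicator)
      next
        case False
        then have "\<bar>B x\<bar> \<le> real K" "\<bar>Y n x - Z x\<bar> \<le> d / (real K + 1)"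
          using x sub by (auto simp: E_def not_less)
        then have "\<bar>B x\<bar> * \<bar>Y n x - Z x\<bar> \<le> (real K + 1) * (d / (real K + 1))"
          by (intro mult_mono) auto
        also have "\<dots> = d" by (simp add: add_nonneg_eq_0_iff)
        finally show ?thesis unfolding eq using norm_cis_minus_1_le[of "B x * (Y n x - Z x)"]
          by (auto simp: abs_mult split: split_indicator)
      qed
    qed
    have i: "integrable M (\<lambda>x. cis (A x + B x * Y n x))" "integrable M (\<lambda>x. cis (A x + B x * Z x))"
      by (auto intro!: integrable_cis)
    have "dist (\<integral>x. cis (A x + B x * Y n x) \<partial>M) (\<integral>x. cis (A x + B x * Z x) \<partial>M)
       = norm (\<integral>x. cis (A x + B x * Y n x) - cis (A x + B x * Z x) \<partial>M)"
      using i by (simp add: dist_norm)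
    also have "\<dots> \<le> (\<integral>x. norm (cis (A x + B x * Y n x) - cis (A x + B x * Z x)) \<partial>M)"
      by (rule integral_norm_bound)
    also have "\<dots> \<le> (\<integral>x. ?g x \<partial>M)"
      using i int by (intro integral_mono) (auto intro!: bd)
    also have "\<dots> = 2 * prob E + 2 * prob C + d" using int by (simp add: prob_space)
    also have "\<dots> < e" using K pC \<open>0 < e\<close> unfolding E_def d_def by linarith
    finally show ?case .
  qed
qed

text \<open>\<open>conv_in_prob\<close> asks only that the deviation set be covered by a small
  event, so the null set on which \<open>Y n\<close> and \<open>Y' n\<close> differ can be added to
  the cover.\<close>

lemma conv_in_prob_AE_cong:
  assumes conv: "conv_in_prob M Y Z" and ae: "\<forall>\<^sub>F n in sequentially. AE x in M. Y n x = Y' n x"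
  shows "conv_in_prob M Y' Z"
  unfolding conv_in_prob_def
proof (intro allI impI)
  fix e d :: real assume "0 < e" "0 < d"
  from conv_in_probD[OF conv this]
  have "\<forall>\<^sub>F n in sequentially. \<exists>A\<in>events. prob A < d \<and> {x \<in> space M. e < \<bar>Y n x - Z x\<bar>} \<subseteq> A" .
  with ae show "\<forall>\<^sub>F n in sequentially. \<exists>A\<in>events. prob A < d \<and> {x \<in> space M. e < \<bar>Y' n x - Z x\<bar>} \<subseteq> A"
  proof eventually_elim
    case (elim n)
    then obtain A where A: "A \<in> events" "prob A < d" "{x \<in> space M. e < \<bar>Y n x - Z x\<bar>} \<subseteq> A" by blast
    from elim(1) obtain N where N: "N \<in> null_sets M" "{x \<in> space M. Y n x \<noteq> Y' n x} \<subseteq> N"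
      unfolding eventually_ae_filter by auto
    have "prob (A \<union> N) = prob A" using A N by (simp add: measure_Un_null_set)
    moreover have "{x \<in> space M. e < \<bar>Y' n x - Z x\<bar>} \<subseteq> A \<union> N"
    proof safe
        fix x assume x: "x \<in> space M" "e < \<bar>Y' n x - Z x\<bar>" "x \<notin> N"
        then have "Y n x = Y' n x" using N(2) by blast
        with x A(3) show "x \<in> A" by auto
      qed
    ultimately show ?case using A N by (intro bexI[of _ "A \<union> N"]) auto
  qed
qed

lemma conv_in_prob_unique:
  assumes [measurable]: "Z \<in> borel_measurable M" "Z' \<in> borel_measurable M"
    and conv: "conv_in_prob M Y Z" "conv_in_prob M Y Z'"
  shows "AE x in M. Z x = Z' x"
proof -
  have *: "AE x in M. \<bar>Z x - Z' x\<bar> \<le> e" if "e > 0" for e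
  proof (rule AE_I[of _ _ "{x \<in> space M. e < \<bar>Z x - Z' x\<bar>}"])
    have "prob {x \<in> space M. e < \<bar>Z x - Z' x\<bar>} \<le> 2 * d" if "d > 0" for d
    proof -
      have "\<forall>\<^sub>F n in sequentially. \<exists>A\<in>events. prob A < d \<and> {x \<in> space M. e / 2 < \<bar>Y n x - Z x\<bar>} \<subseteq> A"
        "\<forall>\<^sub>F n in sequentially. \<exists>A\<in>events. prob A < d \<and> {x \<in> space M. e / 2 < \<bar>Y n x - Z' x\<bar>} \<subseteq> A"
        by (intro conv_in_probD[OF conv(1)] conv_in_probD[OF conv(2)]; use \<open>d > 0\<close> \<open>e > 0\<close> in simp)+
      from eventually_happens'[OF sequentially_bot eventually_conj[OF this]] obtain n A B where AB:
        "A \<in> events" "prob A < d" "{x \<in> space M. e / 2 < \<bar>Y n x - Z x\<bar>} \<subseteq> A"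
        "B \<in> events" "prob B < d" "{x \<in> space M. e / 2 < \<bar>Y n x - Z' x\<bar>} \<subseteq> B"
        by blast
      have "{x \<in> space M. e < \<bar>Z x - Z' x\<bar>} \<subseteq> A \<union> B"
      proof safe
        fix x assume "x \<in> space M" "e < \<bar>Z x - Z' x\<bar>" "x \<notin> B"
        then have "\<not> e / 2 < \<bar>Y n x - Z' x\<bar>" using AB by blast
        then have "e / 2 < \<bar>Y n x - Z x\<bar>" using \<open>e < \<bar>Z x - Z' x\<bar>\<close> by linarith
        then show "x \<in> A" using AB \<open>x \<in> space M\<close> by blast
      qed
      then have "prob {x \<in> space M. e < \<bar>Z x - Z' x\<bar>} \<le> prob (A \<union> B)"
        using AB by (intro finite_measure_mono) auto
      also have "\<dots> \<le> prob A + prob B" using AB by (intro measure_Un_le) auto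
      finally show ?thesis using AB by linarith
    qed
    note le = this
    have "prob {x \<in> space M. e < \<bar>Z x - Z' x\<bar>} \<le> 0"
    proof (rule field_le_epsilon)
      fix d :: real assume "0 < d"
      then show "prob {x \<in> space M. e < \<bar>Z x - Z' x\<bar>} \<le> 0 + d" using le[of "d / 2"] by simp
    qed
    then show "emeasure M {x \<in> space M. e < \<bar>Z x - Z' x\<bar>} = 0"
      by (simp add: emeasure_eq_measure measure_le_0_iff)
  qed auto
  have "AE x in M. \<forall>n::nat. \<bar>Z x - Z' x\<bar> \<le> 1 / real (Suc n)"
    unfolding AE_all_countable by (auto intro!: *)
  then show ?thesis
  proof eventually_elim
    case (elim x)
    have "\<bar>Z x - Z' x\<bar> \<le> 0"
      by (rule LIMSEQ_le_const[OF LIMSEQ_inverse_real_of_nat])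
         (use elim in \<open>auto simp: inverse_eq_divide\<close>)
    then show ?case by simp
  qed
qed

lemma AE_tendsto_0_imp_conv_in_prob:
  fixes V :: "nat \<Rightarrow> 'a \<Rightarrow> real"
  assumes [measurable]: "\<And>n. V n \<in> borel_measurable M" and lim: "AE x in M. (\<lambda>n. V n x) \<longlonglongrightarrow> 0"
  shows "conv_in_prob M V (\<lambda>_. 0)"
  unfolding conv_in_prob_def
proof (intro allI impI)
  fix e d :: real assume "0 < e" "0 < d"
  let ?A = "\<lambda>n. {x \<in> space M. e < \<bar>V n x\<bar>}"
  have "(\<lambda>n. \<integral>x. indicator (?A n) x \<partial>M :: real) \<longlonglongrightarrow> (\<integral>x. 0 \<partial>M)"
  proof (rule integral_dominated_convergence[where w="\<lambda>_. 1"])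
    show "AE x in M. (\<lambda>n. indicator (?A n) x :: real) \<longlonglongrightarrow> 0"
      using lim
    proof eventually_elim
      case (elim x)
      have "\<forall>\<^sub>F n in sequentially. \<bar>V n x\<bar> < e"
        using tendstoD[OF elim \<open>0 < e\<close>] by (simp add: dist_norm)
      then have "\<forall>\<^sub>F n in sequentially. indicator (?A n) x = (0::real)"
        by eventually_elim auto
      then show ?case by (rule tendsto_eventually)
    qed
  qed (auto split: split_indicator)
  then have "(\<lambda>n. prob (?A n)) \<longlonglongrightarrow> 0" by simp
  then have "\<forall>\<^sub>F n in sequentially. prob (?A n) < d" using order_tendstoD(2) \<open>0 < d\<close> by blast
  then show "\<forall>\<^sub>F n in sequentially. \<exists>A\<in>events. prob A < d \<and> {x \<in> space M. e < \<bar>V n x - 0\<bar>} \<subseteq> A"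
    by eventually_elim (rule bexI[of _ "?A _"], auto)
qed

text \<open>Serves to rescale Riemann sums by -1 / k while dropping from them one term
  \<open>V n\<close> that tends to 0.\<close>

lemma conv_in_prob_lincomb:
  assumes Y: "conv_in_prob M Y Z" and V: "conv_in_prob M V (\<lambda>_. 0)"
  shows "conv_in_prob M (\<lambda>n x. c * (Y n x - V n x)) (\<lambda>x. c * Z x)"
  unfolding conv_in_prob_def
proof (intro allI impI)
  fix e d :: real assume "0 < e" "0 < d"
  define b where "b = e / (2 * (\<bar>c\<bar> + 1))"
  have b: "b > 0" using \<open>0 < e\<close> by (simp add: b_def)
  have cb: "\<bar>c\<bar> * (2 * b) \<le> e"
    using \<open>0 < e\<close> by (simp add: b_def divide_simps add_nonneg_eq_0_iff algebra_simps)
  have "\<forall>\<^sub>F n in sequentially. \<exists>A\<in>events. prob A < d / 2 \<and> {x \<in> space M. b < \<bar>Y n x - Z x\<bar>} \<subseteq> A"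
    "\<forall>\<^sub>F n in sequentially. \<exists>A\<in>events. prob A < d / 2 \<and> {x \<in> space M. b < \<bar>V n x - 0\<bar>} \<subseteq> A"
    by (intro conv_in_probD[OF Y] conv_in_probD[OF V]; use \<open>0 < d\<close> b in simp)+
  then show "\<forall>\<^sub>F n in sequentially. \<exists>A\<in>events. prob A < d \<and> {x \<in> space M. e < \<bar>c * (Y n x - V n x) - c * Z x\<bar>} \<subseteq> A"
  proof eventually_elim
    case (elim n)
    then obtain A B where AB: "A \<in> events" "prob A < d / 2" "{x \<in> space M. b < \<bar>Y n x - Z x\<bar>} \<subseteq> A"
        "B \<in> events" "prob B < d / 2" "{x \<in> space M. b < \<bar>V n x - 0\<bar>} \<subseteq> B" by blast
    have "{x \<in> space M. e < \<bar>c * (Y n x - V n x) - c * Z x\<bar>} \<subseteq> A \<union> B"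
    proof (rule subsetI, rule ccontr)
      fix x assume x: "x \<in> {x \<in> space M. e < \<bar>c * (Y n x - V n x) - c * Z x\<bar>}" "x \<notin> A \<union> B"
      then have "\<bar>Y n x - Z x\<bar> \<le> b" "\<bar>V n x\<bar> \<le> b" using AB by force+
      then have "\<bar>c\<bar> * \<bar>Y n x - V n x - Z x\<bar> \<le> \<bar>c\<bar> * (2 * b)"
        by (intro mult_left_mono) linarith+
      then have "\<bar>c * (Y n x - V n x) - c * Z x\<bar> \<le> e"
        using cb by (simp add: abs_mult[symmetric] right_diff_distrib)
      with x show False by auto
    qed
    moreover have "prob (A \<union> B) < d"
      using measure_Un_le[of A M B] AB by linarith
    ultimately show ?case using AB by (intro bexI[of _ "A \<union> B"]) auto
  qed
qed

end

subsection \<open>Trigonometric approximation\<close>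

text \<open>The derivative of \<open>exp\<close> has modulus at most 1 on the convex half-plane Re z
  \<le> 0, so \<open>exp\<close> is 1-Lipschitz there.\<close>

lemma norm_exp_minus_1_le:
  assumes "Re z \<le> 0" shows "norm (exp z - 1) \<le> norm z"
proof -
  have "norm (exp z - exp 0) \<le> 1 * norm (z - 0)"
  proof (rule field_differentiable_bound[where f'=exp and S="{z. Re z \<le> 0}"])
    show "convex {z. Re z \<le> 0}" by (rule convex_halfspace_Re_le)
    show "(exp has_field_derivative exp w) (at w within {z. Re z \<le> 0})" for w :: complex
      by (auto intro!: derivative_eq_intros)
  qed (use assms in \<open>auto simp: norm_exp_eq_Re\<close>)
  then show ?thesis by simp
qed

text \<open>The characters are the functions whose expectations the characteristic exponent gives.
  Generator formulas are linear in the test function, so induction over this closure extends them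
  from characters to trigonometric polynomials.\<close>

inductive trig_polynomial :: "('a::euclidean_space \<Rightarrow> complex) \<Rightarrow> bool" where
  cis: "trig_polynomial (\<lambda>z. cis (\<theta> \<bullet> z))"
| scale: "trig_polynomial f \<Longrightarrow> trig_polynomial (\<lambda>z. c * f z)"
| add: "trig_polynomial f \<Longrightarrow> trig_polynomial g \<Longrightarrow> trig_polynomial (\<lambda>z. f z + g z)"

lemma trig_polynomial_const: "trig_polynomial (\<lambda>_. c)"
  using trig_polynomial.scale[OF trig_polynomial.cis[of 0], of c] by simp

lemma trig_polynomial_mult:
  assumes "trig_polynomial f" "trig_polynomial g"
  shows "trig_polynomial (\<lambda>z. f z * g z)"
  using assms(1)
proof induction
  case (cis \<theta>)
  show ?case using assms(2)
  proof induction
    case (cis \<theta>')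
    show ?case using trig_polynomial.cis[of "\<theta> + \<theta>'"] by (simp add: cis_mult inner_add_left)
  next
    case (scale f c)
    from trig_polynomial.scale[OF scale(2), of c] show ?case by (simp add: algebra_simps)
  next
    case (add f g)
    from trig_polynomial.add[OF add(3,4)] show ?case by (simp add: algebra_simps)
  qed
next
  case (scale f c)
  from trig_polynomial.scale[OF scale(2), of c] show ?case by (simp add: algebra_simps)
next
  case (add f g)
  from trig_polynomial.add[OF add(3,4)] show ?case by (simp add: algebra_simps)
qed

lemma trig_polynomial_sin: "trig_polynomial (\<lambda>z. complex_of_real (sin (\<theta> \<bullet> z)))"
proof -
  have "complex_of_real (sin x) = (- \<i> / 2) * cis x + (\<i> / 2) * cis (- x)" for x
    by (simp add: complex_eq_iff)
  with trig_polynomial.add[OF trig_polynomial.scale[OF trig_polynomial.cis[of \<theta>], of "-\<i>/2"]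
      trig_polynomial.scale[OF trig_polynomial.cis[of "-\<theta>"], of "\<i>/2"]]
  show ?thesis by simp
qed

text \<open>Through this lemma the Stone-Weierstrass theorem, applied in two sine coordinates,
  produces trigonometric polynomials.\<close>

lemma trig_polynomial_real_polynomial_function:
  fixes \<theta> \<theta>' :: "'a::euclidean_space"
  assumes "real_polynomial_function p"
  shows "trig_polynomial (\<lambda>z. complex_of_real (p (sin (\<theta> \<bullet> z), sin (\<theta>' \<bullet> z))))"
  using assms
proof induction
  case (linear f)
  interpret bounded_linear f by (rule linear)
  define c d where "c = f (1, 0)" and "d = f (0, 1)"
  have eq: "f (s, t) = c * s + d * t" for s t
  proof -
    have "f (s, t) = f (s *\<^sub>R (1, 0) + t *\<^sub>R (0, 1))" by simp
    also have "\<dots> = f (s *\<^sub>R (1, 0)) + f (t *\<^sub>R (0, 1))" by (rule add)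
    also have "\<dots> = s *\<^sub>R f (1, 0) + t *\<^sub>R f (0, 1)" by (simp only: scaleR)
    finally show ?thesis by (simp add: c_def d_def mult.commute)
  qed
  show ?case
    unfolding eq of_real_add of_real_mult
    by (intro trig_polynomial.add trig_polynomial.scale trig_polynomial_sin)
next
  case (const c)
  then show ?case by (rule trig_polynomial_const)
next
  case (add f g)
  from trig_polynomial.add[OF add(3,4)] show ?case by simp
next
  case (mult f g)
  from trig_polynomial_mult[OF mult(3,4)] show ?case by simp
qed

lemma trig_polynomial_continuous:
  assumes "trig_polynomial f" shows "continuous_on UNIV f"
  using assms
proof induction
  case (cis \<theta>)
  show ?case unfolding cis_conv_exp by (intro continuous_intros)
next
  case (scale f c)
  from continuous_on_mult_left[OF scale(2)] show ?case .
next
  case (add f g)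
  from continuous_on_add[OF add(3,4)] show ?case .
qed

lemma trig_polynomial_measurable:
  assumes "trig_polynomial f" shows "f \<in> borel_measurable borel"
  using trig_polynomial_continuous[OF assms] by (rule borel_measurable_continuous_onI)

lemma trig_polynomial_bounded:
  assumes "trig_polynomial f" shows "\<exists>C. \<forall>z. norm (f z) \<le> C"
  using assms
proof induction
  case (cis \<theta>)
  then show ?case by (auto intro!: exI[of _ 1])
next
  case (scale f c)
  then obtain C where "\<forall>z. norm (f z) \<le> C" by blast
  then show ?case by (auto intro!: exI[of _ "norm c * C"] simp: norm_mult mult_left_mono)
next
  case (add f g)
  then obtain C D where "\<forall>z. norm (f z) \<le> C" "\<forall>z. norm (g z) \<le> D" by blast
  then show ?case by (auto intro!: exI[of _ "C + D"] order_trans[OF norm_triangle_ineq] add_mono)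
qed

lemma abs_le_2_abs_sin:
  fixes x :: real assumes "\<bar>x\<bar> \<le> 1" shows "\<bar>x\<bar> \<le> 2 * \<bar>sin x\<bar>"
proof -
  have "x\<^sup>2 \<le> \<bar>x\<bar> * 1"
    using mult_left_mono[OF assms, of "\<bar>x\<bar>"] by (simp add: power2_eq_square)
  then show ?thesis using abs_sin_minus_le[of x] by linarith
qed

text \<open>The order o(|z|^2) at the origin. The filter is \<open>nhds\<close> and not the
  punctured one, so the bound also holds at 0 and r 0 = 0 is included.\<close>

definition little_square :: "('a::real_normed_vector \<Rightarrow> real) \<Rightarrow> bool" where
  "little_square r \<longleftrightarrow> (\<forall>e>0. \<forall>\<^sub>F z in nhds 0. \<bar>r z\<bar> \<le> e * (norm z)\<^sup>2)"

lemma little_square_0: "little_square r \<Longrightarrow> r 0 = 0"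
  unfolding little_square_def
  by (drule spec[of _ 1]) (auto dest: eventually_nhds_x_imp_x)

lemma norm_vec2: "(norm z)\<^sup>2 = (z $ 1)\<^sup>2 + (z $ 2)\<^sup>2" for z :: "real^2"
  unfolding power2_norm_eq_inner inner_vec_def sum_2 by (simp add: power2_eq_square)

text \<open>A polynomial in \<open>sin (a z1), sin (a z2)\<close> is controlled outside the square \<open>\<bar>zi\<bar> \<le> R\<close> as well,
  since every value it takes there is already taken inside the square.\<close>
lemma trig_polynomial_approx:
  fixes r :: "real^2 \<Rightarrow> real"
  assumes cont: "continuous_on UNIV r" and B: "\<And>z. \<bar>r z\<bar> \<le> B" and small: "little_square r"
    and R: "0 < R" and e: "0 < e"
  defines "a \<equiv> pi / (2 * R)"
  defines "w \<equiv> \<lambda>z::real^2. (sin (a * z $ 1))\<^sup>2 + (sin (a * z $ 2))\<^sup>2"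
  shows "\<exists>q. trig_polynomial (\<lambda>z. complex_of_real (q z)) \<and> \<bar>q 0\<bar> \<le> e \<and>
    (\<forall>z. \<bar>z $ 1\<bar> \<le> R \<longrightarrow> \<bar>z $ 2\<bar> \<le> R \<longrightarrow> \<bar>r z - w z * q z\<bar> \<le> e * w z) \<and>
    (\<forall>z. \<bar>r z - w z * q z\<bar> \<le> 2 * B + 2 * e)"
proof -
  have a: "a > 0" using R pi_gt_zero by (simp add: a_def)
  \<comment> \<open>Since a R = pi / 2, \<open>Z\<close> inverts the map z \<mapsto> (sin (a z1),
    sin (a z2)) on the square. \<open>F\<close> below is r / w in sine coordinates; division by 0
    gives it the value 0 at the origin, which is also its limit there by
    \<open>little_square\<close>.\<close>
  define Z where "Z = (\<lambda>p::real \<times> real. vector [arcsin (fst p) / a, arcsin (snd p) / a] :: real^2)"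
  define F where "F = (\<lambda>p::real \<times> real. r (Z p) / ((fst p)\<^sup>2 + (snd p)\<^sup>2))"
  define K where "K = {-1..1::real} \<times> {-1..1::real}"
  have Zc: "Z p $ 1 = arcsin (fst p) / a" "Z p $ 2 = arcsin (snd p) / a" for p
    by (simp_all add: Z_def)
  have contZ: "continuous_on K Z"
  proof -
    have "Z = (\<lambda>p. \<chi> i. if i = 1 then arcsin (fst p) / a else arcsin (snd p) / a)"
      by (auto simp: fun_eq_iff vec_eq_iff Zc forall_2)
    moreover have "continuous_on K (\<lambda>p. \<chi> i::2. if i = 1 then arcsin (fst p) / a else arcsin (snd p) / a)"
    proof (rule continuous_on_vec_lambda)
      show "continuous_on K (\<lambda>p. if i = 1 then arcsin (fst p) / a else arcsin (snd p) / a)" for i :: 2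
        using a by (cases "i = 1") (auto simp: K_def intro!: continuous_intros)
    qed
    ultimately show ?thesis by simp
  qed
  have r0: "r 0 = 0" using little_square_0[OF small] .
  have Z0: "Z 0 = 0" by (simp add: vec_eq_iff Zc forall_2)
  have contrZ: "continuous_on K (\<lambda>p. r (Z p))"
    by (rule continuous_on_compose2[OF cont contZ]) auto
  have "continuous_on K F"
    unfolding continuous_on_eq_continuous_within
  proof
    fix p assume p: "p \<in> K"
    show "continuous (at p within K) F"
    proof (cases "p = 0")
      case False
      then have "(fst p)\<^sup>2 + (snd p)\<^sup>2 \<noteq> 0" by (auto simp: prod_eq_iff sum_power2_eq_zero_iff)
      then show ?thesis
        unfolding F_def using contrZ p
        by (intro continuous_intros) (auto simp: continuous_on_eq_continuous_within)
    next
      case True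
      have "(F \<longlongrightarrow> 0) (at 0 within K)"
      proof (rule tendstoI)
        fix d :: real assume "0 < d"
        have lim: "(Z \<longlongrightarrow> 0) (at 0 within K)"
          using contZ p True Z0 unfolding continuous_on_def by metis
        \<comment> \<open>Below 1 / a both arcsines are at most 1 in absolute value, so
          \<open>abs_le_2_abs_sin\<close> applies and a^2 |Z p|^2 \<le> 4 D. With the factor d a^2 /
          8 this leaves at most d D / 2.\<close>
        have ev1: "\<forall>\<^sub>F p in at 0 within K. norm (Z p) < 1 / a"
          using tendstoD[OF lim, of "1 / a"] a by (simp add: dist_norm)
        have "\<forall>\<^sub>F z in nhds 0. \<bar>r z\<bar> \<le> (d * a\<^sup>2 / 8) * (norm z)\<^sup>2"
          using small[unfolded little_square_def, rule_format, of "d * a\<^sup>2 / 8"] \<open>0 < d\<close> a by simp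
        then have ev2: "\<forall>\<^sub>F p in at 0 within K. \<bar>r (Z p)\<bar> \<le> (d * a\<^sup>2 / 8) * (norm (Z p))\<^sup>2"
          using lim by (rule eventually_compose_filterlim)
        have ev3: "\<forall>\<^sub>F p in at 0 within K. p \<in> K \<and> p \<noteq> 0"
          by (auto simp: eventually_at_filter)
        show "\<forall>\<^sub>F p in at 0 within K. dist (F p) 0 < d"
          using ev1 ev2 ev3
        proof eventually_elim
          case (elim p)
          have pK: "-1 \<le> fst p" "fst p \<le> 1" "-1 \<le> snd p" "snd p \<le> 1" using elim by (auto simp: K_def)
          define D where "D = (fst p)\<^sup>2 + (snd p)\<^sup>2"
          have D: "D > 0" using elim by (auto simp: D_def sum_power2_gt_zero_iff prod_eq_iff)
          have "\<bar>Z p $ 1\<bar> \<le> 1 / a" "\<bar>Z p $ 2\<bar> \<le> 1 / a"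
            using elim(1) component_le_norm_cart[of "Z p" 1] component_le_norm_cart[of "Z p" 2] by linarith+
          then have "\<bar>arcsin (fst p)\<bar> \<le> 1" "\<bar>arcsin (snd p)\<bar> \<le> 1"
            using a by (simp_all add: Zc abs_divide divide_le_eq)
          then have "\<bar>arcsin (fst p)\<bar> \<le> 2 * \<bar>fst p\<bar>" "\<bar>arcsin (snd p)\<bar> \<le> 2 * \<bar>snd p\<bar>"
            using abs_le_2_abs_sin[of "arcsin (fst p)"] abs_le_2_abs_sin[of "arcsin (snd p)"] pK by simp_all
          then have "(arcsin (fst p))\<^sup>2 \<le> (2 * fst p)\<^sup>2" "(arcsin (snd p))\<^sup>2 \<le> (2 * snd p)\<^sup>2"
            unfolding abs_le_square_iff[symmetric] by (simp_all add: abs_mult)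
          then have "a\<^sup>2 * (norm (Z p))\<^sup>2 \<le> 4 * D"
            using a by (simp add: norm_vec2 Zc D_def power_divide distrib_left)
          then have "d / 8 * (a\<^sup>2 * (norm (Z p))\<^sup>2) \<le> d / 8 * (4 * D)"
            using \<open>0 < d\<close> by (intro mult_left_mono) auto
          moreover have "\<bar>r (Z p)\<bar> \<le> d / 8 * (a\<^sup>2 * (norm (Z p))\<^sup>2)"
            using elim(2) by (simp add: mult.assoc)
          ultimately have "\<bar>r (Z p)\<bar> \<le> d / 8 * (4 * D)" by linarith
          also have "\<dots> < d * D" using D \<open>0 < d\<close> by simp
          finally show ?case using D by (simp add: F_def D_def[symmetric] abs_divide divide_less_eq)
        qed
      qed
      then show ?thesis using True r0 Z0 by (simp add: continuous_within F_def)
    qed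
  qed
  moreover have "compact K" unfolding K_def by (intro compact_Times) auto
  ultimately obtain P where P: "real_polynomial_function P" and PF: "\<And>p. p \<in> K \<Longrightarrow> \<bar>F p - P p\<bar> < e"
    using Stone_Weierstrass_real_polynomial_function[of K F e] e by blast
  define s where "s = (\<lambda>z::real^2. (sin (a * z $ 1), sin (a * z $ 2)))"
  define q where "q = (\<lambda>z. P (s z))"
  have sK: "s z \<in> K" for z by (simp add: s_def K_def)
  have ws: "w z = (fst (s z))\<^sup>2 + (snd (s z))\<^sup>2" for z by (simp add: w_def s_def)
  have w0: "0 \<le> w z" "w z \<le> 2" for z
  proof -
    have "(sin x)\<^sup>2 \<le> 1" for x :: real by (simp add: abs_square_le_1)
    from add_mono[OF this this] show "0 \<le> w z" "w z \<le> 2" by (simp_all add: w_def)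
  qed
  have diff: "\<bar>w z * F (s z) - w z * q z\<bar> \<le> e * w z" for z
  proof -
    have "\<bar>w z * F (s z) - w z * q z\<bar> = w z * \<bar>F (s z) - q z\<bar>"
      using w0[of z] by (simp add: right_diff_distrib[symmetric] abs_mult)
    also have "\<dots> \<le> w z * e" using PF[OF sK[of z]] w0[of z] by (intro mult_left_mono) (auto simp: q_def)
    finally show ?thesis by (simp add: mult.commute)
  qed
  \<comment> \<open>Every value of w F is 0 or a value of \<open>r\<close>, also for z outside the
    square. This is the source of the global bound.\<close>
  have wF: "w z * F (s z) = (if w z = 0 then 0 else r (Z (s z)))" for z
    by (simp add: F_def ws[symmetric])
  show ?thesis
  proof (intro exI[of _ q] conjI allI impI)
    have "(\<lambda>z. complex_of_real (q z)) = (\<lambda>z. complex_of_real (P (sin (axis 1 a \<bullet> z), sin (axis 2 a \<bullet> z))))"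
      by (simp add: q_def s_def inner_axis')
    then show "trig_polynomial (\<lambda>z. complex_of_real (q z))"
      using trig_polynomial_real_polynomial_function[OF P] by simp
    have "s 0 = 0" by (simp add: s_def zero_prod_def)
    then show "\<bar>q 0\<bar> \<le> e" using PF[OF sK[of 0]] r0 Z0 by (simp add: q_def F_def)
    show "\<bar>r z - w z * q z\<bar> \<le> e * w z" if z: "\<bar>z $ 1\<bar> \<le> R" "\<bar>z $ 2\<bar> \<le> R" for z
    proof -
      have "\<bar>a * z $ 1\<bar> \<le> pi / 2" "\<bar>a * z $ 2\<bar> \<le> pi / 2"
        using z R mult_left_mono[of _ R a] a by (simp_all add: a_def abs_mult divide_simps mult_ac)
      then have "arcsin (sin (a * z $ 1)) = a * z $ 1" "arcsin (sin (a * z $ 2)) = a * z $ 2"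
        by (simp_all add: arcsin_sin abs_le_iff)
      then have Zs: "Z (s z) = z" using a by (simp add: vec_eq_iff Zc forall_2 s_def)
      have "w z * F (s z) = r z"
      proof (cases "w z = 0")
        case True
        then have "s z = 0" by (simp add: ws prod_eq_iff sum_power2_eq_zero_iff)
        then show ?thesis using Zs Z0 r0 True by simp
      qed (simp add: wF Zs)
      with diff[of z] show ?thesis by simp
    qed
    show "\<bar>r z - w z * q z\<bar> \<le> 2 * B + 2 * e" for z
    proof -
      have "0 \<le> B" using B[of 0] by linarith
      then have "\<bar>w z * F (s z)\<bar> \<le> B" using B by (simp add: wF)
      moreover have "e * w z \<le> e * 2" using w0[of z] e by (intro mult_left_mono) auto
      ultimately show ?thesis using diff[of z] B[of z] by linarith
    qed
  qed
qed

subsection \<open>The characteristic exponent\<close>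

locale bivariate_levy =
  fixes M :: "'a measure" and X :: "real \<Rightarrow> 'a \<Rightarrow> real^2"
    and g :: "real^2" and S :: "real^2^2" and L :: "(real^2) measure"
  assumes levy: "levy_process M X" and triplet: "levy_triplet M X g S L"
begin

sublocale prob_space M
  using levy by (simp add: levy_process_def)

abbreviation \<Psi> :: "real^2 \<Rightarrow> complex" where "\<Psi> \<equiv> levy_exponent g S L"

lemma X_measurable [measurable]: "0 \<le> t \<Longrightarrow> X t \<in> borel_measurable M"
  using levy by (simp add: levy_process_def)

lemma AE_X_0: "AE \<omega> in M. X 0 \<omega> = 0"
  using levy by (simp add: levy_process_def)

lemma sets_L [measurable_cong, simp]: "sets L = sets borel"
  using triplet by (simp add: levy_triplet_def)

lemma space_L [simp]: "space L = UNIV"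
  using sets_eq_imp_space_eq[OF sets_L] by simp

lemma integrable_L_min: "integrable L (\<lambda>z. min 1 ((norm z)\<^sup>2))"
  using triplet by (intro integrableI_nonneg) (auto simp: levy_triplet_def)

lemma integrable_LI:
  fixes f :: "real^2 \<Rightarrow> 'b::{banach, second_countable_topology}"
  assumes "f \<in> borel_measurable borel" "\<And>z. norm (f z) \<le> C * min 1 ((norm z)\<^sup>2)"
  shows "integrable L f"
  by (rule Bochner_Integration.integrable_bound[OF integrable_mult_right[OF integrable_L_min, of C]])
     (use assms in \<open>auto intro!: AE_I2 order_trans[OF _ abs_ge_self]\<close>)

text \<open>Near 0 the function is below |z|^2. At distance at least \<open>c\<close> from 0, with c
  \<le> 1, the constant \<open>B\<close> is at most B / c^2 times min 1 (|z|^2).\<close>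

lemma integrable_L_little_square:
  fixes r :: "real^2 \<Rightarrow> real"
  assumes "r \<in> borel_measurable borel" and B: "\<And>z. \<bar>r z\<bar> \<le> B"
    and ev: "\<forall>\<^sub>F z in nhds 0. \<bar>r z\<bar> \<le> (norm z)\<^sup>2"
  shows "integrable L r"
proof -
  obtain d where d: "0 < d" "\<And>z. norm z < d \<Longrightarrow> \<bar>r z\<bar> \<le> (norm z)\<^sup>2"
    using ev unfolding eventually_nhds_metric by (auto simp: dist_norm)
  have B0: "0 \<le> B" using B[of 0] by linarith
  define c where "c = min 1 d"
  have c: "0 < c" "c \<le> 1" "c \<le> d" using d by (auto simp: c_def)
  show ?thesis
  proof (rule integrable_LI[where C="1 + B / c\<^sup>2"])
    fix z :: "real^2"
    show "norm (r z) \<le> (1 + B / c\<^sup>2) * min 1 ((norm z)\<^sup>2)"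
    proof (cases "norm z < c")
      case True
      then have "(norm z)\<^sup>2 \<le> 1" using c by (simp add: abs_square_le_1)
      then have "norm (r z) \<le> 1 * min 1 ((norm z)\<^sup>2)" using True c d(2)[of z] by simp
      also have "\<dots> \<le> (1 + B / c\<^sup>2) * min 1 ((norm z)\<^sup>2)"
        using B0 c by (intro mult_right_mono) auto
      finally show ?thesis .
    next
      case False
      have "c\<^sup>2 \<le> 1" using c by (simp add: abs_square_le_1)
      moreover have "c\<^sup>2 \<le> (norm z)\<^sup>2" using False c by (intro power_mono) auto
      ultimately have m: "c\<^sup>2 \<le> min 1 ((norm z)\<^sup>2)" by simp
      have "norm (r z) \<le> B / c\<^sup>2 * c\<^sup>2" using B[of z] c by simp
      also have "\<dots> \<le> B / c\<^sup>2 * min 1 ((norm z)\<^sup>2)" using m B0 c by (intro mult_left_mono) auto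
      also have "\<dots> \<le> (1 + B / c\<^sup>2) * min 1 ((norm z)\<^sup>2)" by (simp add: distrib_right)
      finally show ?thesis .
    qed
  qed fact
qed

definition compensated :: "real^2 \<Rightarrow> real^2 \<Rightarrow> complex" where
  "compensated \<theta> z = cis (z \<bullet> \<theta>) - 1 - \<i> * complex_of_real (z \<bullet> \<theta>) * (if norm z \<le> 1 then 1 else 0)"

lemma \<Psi>_eq: "\<Psi> \<theta> = \<i> * complex_of_real (g \<bullet> \<theta>) - complex_of_real (\<theta> \<bullet> (S *v \<theta>)) / 2 + (\<integral>z. compensated \<theta> z \<partial>L)"
  by (simp add: levy_exponent_def compensated_def)

lemma compensated_measurable [measurable]: "compensated \<theta> \<in> borel_measurable borel"
  unfolding compensated_def[abs_def] cis_conv_exp by measurable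

text \<open>A second order Taylor bound where the compensator acts, the trivial bound 2 elsewhere.
  The constant depends on \<theta> through its norm only; being uniform on bounded sets, it gives
  the dominating function for the continuity of \<Psi>.\<close>

lemma norm_compensated_le: "norm (compensated \<theta> z) \<le> (2 + (norm \<theta>)\<^sup>2) * min 1 ((norm z)\<^sup>2)"
proof (cases "norm z \<le> 1")
  case True
  then have m: "min 1 ((norm z)\<^sup>2) = (norm z)\<^sup>2" by (simp add: abs_square_le_1)
  have "norm (compensated \<theta> z) \<le> (z \<bullet> \<theta>)\<^sup>2 / 2"
    using True norm_cis_approx2[of "z \<bullet> \<theta>"] by (simp add: compensated_def)
  also have "\<dots> \<le> (norm z * norm \<theta>)\<^sup>2 / 2"
    by (intro divide_right_mono) (auto simp: abs_le_square_iff[symmetric] Cauchy_Schwarz_ineq2)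
  also have "\<dots> \<le> (2 + (norm \<theta>)\<^sup>2) * (norm z)\<^sup>2"
    by (simp add: power_mult_distrib distrib_right algebra_simps)
  finally show ?thesis unfolding m .
next
  case False
  then have m: "min 1 ((norm z)\<^sup>2) = 1" using one_le_power[of "norm z" 2] by simp
  show ?thesis unfolding m using False norm_cis_minus_1_le_2[of "z \<bullet> \<theta>"]
    by (simp add: compensated_def add_increasing2)
qed

lemma integrable_compensated: "integrable L (compensated \<theta>)"
  by (rule integrable_LI[OF _ norm_compensated_le]) simp

lemma expectation_cis_X: "0 \<le> t \<Longrightarrow> (\<integral>\<omega>. cis (\<theta> \<bullet> X t \<omega>) \<partial>M) = exp (complex_of_real t * \<Psi> \<theta>)"
proof (cases "t = 0")
  case True
  have "(\<integral>\<omega>. cis (\<theta> \<bullet> X 0 \<omega>) \<partial>M) = (\<integral>\<omega>. 1 \<partial>M)"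
    by (rule integral_cong_AE) (use AE_X_0 in \<open>auto simp: cis_conv_exp\<close>)
  then show ?thesis using True by (simp add: prob_space)
qed (use triplet in \<open>auto simp: levy_triplet_def\<close>)

text \<open>The expectation of \<open>cis\<close> at time 1 has modulus exp (Re (\<Psi> \<theta>)),
  which is at most 1.\<close>

lemma Re_\<Psi>_le: "Re (\<Psi> \<theta>) \<le> 0"
  using norm_expectation_cis_le_1[of "\<lambda>\<omega>. \<theta> \<bullet> X 1 \<omega>"] by (simp add: expectation_cis_X)

lemma norm_exp_\<Psi>_le: "0 \<le> t \<Longrightarrow> norm (exp (complex_of_real t * \<Psi> \<theta>) - 1) \<le> t * norm (\<Psi> \<theta>)"
  using norm_exp_minus_1_le[of "complex_of_real t * \<Psi> \<theta>"] Re_\<Psi>_le[of \<theta>]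
  by (simp add: mult_nonneg_nonpos norm_mult)

lemma \<Psi>_0: "\<Psi> 0 = 0"
  by (simp add: levy_exponent_def)

lemma isCont_\<Psi>: "isCont \<Psi> \<theta>"
  unfolding continuous_at_sequentially
proof (intro allI impI)
  fix x :: "nat \<Rightarrow> real^2" assume x: "x \<longlonglongrightarrow> \<theta>"
  obtain C where C: "\<And>n. norm (x n) \<le> C"
    using convergent_imp_Bseq[OF convergentI[OF x]] unfolding Bseq_def by auto
  have "(\<lambda>n. \<integral>z. compensated (x n) z \<partial>L) \<longlonglongrightarrow> (\<integral>z. compensated \<theta> z \<partial>L)"
  proof (rule integral_dominated_convergence[where w="\<lambda>z. (2 + C\<^sup>2) * min 1 ((norm z)\<^sup>2)"])
    show "AE z in L. (\<lambda>n. compensated (x n) z) \<longlonglongrightarrow> compensated \<theta> z"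
      unfolding compensated_def cis_conv_exp by (intro AE_I2 tendsto_intros x)
    show "AE z in L. norm (compensated (x n) z) \<le> (2 + C\<^sup>2) * min 1 ((norm z)\<^sup>2)" for n
    proof (rule AE_I2)
      fix z :: "real^2"
      have "(norm (x n))\<^sup>2 \<le> C\<^sup>2" using C[of n] by (intro power_mono) auto
      then have "(2 + (norm (x n))\<^sup>2) * min 1 ((norm z)\<^sup>2) \<le> (2 + C\<^sup>2) * min 1 ((norm z)\<^sup>2)"
        by (intro mult_right_mono) auto
      with norm_compensated_le[of "x n" z] show "norm (compensated (x n) z) \<le> (2 + C\<^sup>2) * min 1 ((norm z)\<^sup>2)"
        by linarith
    qed
  qed (use integrable_L_min in auto)
  moreover have "(\<lambda>n. x n \<bullet> (S *v x n)) \<longlonglongrightarrow> \<theta> \<bullet> (S *v \<theta>)"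
    by (intro tendsto_inner x isCont_tendsto_compose[OF _ x, of "(*v) S"])
       (simp add: matrix_vector_mul_linear_gen linear_continuous_at)
  ultimately show "(\<Psi> \<circ> x) \<longlonglongrightarrow> \<Psi> \<theta>"
    unfolding comp_def \<Psi>_eq
    by (intro tendsto_add tendsto_diff tendsto_divide tendsto_mult tendsto_const tendsto_of_real
        tendsto_inner[OF tendsto_const x]) simp_all
qed

text \<open>This is the derivative of h \<mapsto> exp (h \<Psi> \<theta>) at 0. The case \<Psi>
  \<theta> = 0 is separate because the limit of (exp w - 1) / w is taken along nonzero w.\<close>

lemma generator_cis:
  "((\<lambda>h. ((\<integral>\<omega>. cis (\<theta> \<bullet> X h \<omega>) \<partial>M) - 1) / complex_of_real h) \<longlongrightarrow> \<Psi> \<theta>) (at_right 0)"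
proof -
  have "((\<lambda>h. (exp (complex_of_real h * \<Psi> \<theta>) - 1) / complex_of_real h) \<longlongrightarrow> \<Psi> \<theta>) (at_right 0)"
  proof (cases "\<Psi> \<theta> = 0")
    case False
    have "filterlim (\<lambda>h. complex_of_real h * \<Psi> \<theta>) (at 0) (at_right 0)"
      unfolding filterlim_at
    proof
      show "\<forall>\<^sub>F h in at_right 0. complex_of_real h * \<Psi> \<theta> \<in> UNIV \<and> complex_of_real h * \<Psi> \<theta> \<noteq> 0"
        using False by (auto simp: eventually_at_filter)
      have "((\<lambda>h. complex_of_real h * \<Psi> \<theta>) \<longlongrightarrow> complex_of_real 0 * \<Psi> \<theta>) (at_right 0)"
        by (intro tendsto_intros)
      then show "((\<lambda>h. complex_of_real h * \<Psi> \<theta>) \<longlongrightarrow> 0) (at_right 0)" by simp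
    qed
    from filterlim_compose[OF lim_exp_minus_1 this]
    have "((\<lambda>h. (exp (complex_of_real h * \<Psi> \<theta>) - 1) / (complex_of_real h * \<Psi> \<theta>) * \<Psi> \<theta>) \<longlongrightarrow> 1 * \<Psi> \<theta>) (at_right 0)"
      by (intro tendsto_intros)
    then show ?thesis using False by simp
  qed simp
  then show ?thesis
    by (rule Lim_transform_eventually) (auto simp: eventually_at_filter expectation_cis_X)
qed

lemma integrable_L_sin_sq_cis:
  "integrable L (\<lambda>z. complex_of_real ((sin (a * z $ j))\<^sup>2) * cis (\<theta> \<bullet> z))"
proof (rule integrable_LI[where C="1 + a\<^sup>2"])
  show "(\<lambda>z. complex_of_real ((sin (a * z $ j))\<^sup>2) * cis (\<theta> \<bullet> z)) \<in> borel_measurable borel"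
    unfolding cis_conv_exp by measurable
  fix z :: "real^2"
  have 1: "(sin (a * z $ j))\<^sup>2 \<le> 1" by (simp add: abs_square_le_1)
  have "(sin (a * z $ j))\<^sup>2 \<le> (a * z $ j)\<^sup>2"
    unfolding abs_le_square_iff[symmetric] by (rule abs_sin_x_le_abs_x)
  also have "\<dots> \<le> (a * norm z)\<^sup>2"
    unfolding abs_le_square_iff[symmetric] by (simp add: abs_mult mult_left_mono component_le_norm_cart)
  finally have 2: "(sin (a * z $ j))\<^sup>2 \<le> a\<^sup>2 * (norm z)\<^sup>2" by (simp add: power_mult_distrib)
  show "norm (complex_of_real ((sin (a * z $ j))\<^sup>2) * cis (\<theta> \<bullet> z)) \<le> (1 + a\<^sup>2) * min 1 ((norm z)\<^sup>2)"
  proof (cases "(norm z)\<^sup>2 \<le> 1")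
    case True
    with 2 show ?thesis by (simp add: norm_mult norm_power distrib_right add_increasing)
  next
    case False
    with 1 show ?thesis by (simp add: norm_mult norm_power add_increasing2)
  qed
qed

text \<open>Multiplication by \<open>sin\<^sup>2\<close> amounts to a second difference of \<open>\<Psi>\<close>, which removes the drift and
  reduces the Gaussian part to a constant.\<close>
lemma generator_sin_sq_cis:
  "((\<lambda>h. (\<integral>\<omega>. complex_of_real ((sin (a * X h \<omega> $ j))\<^sup>2) * cis (\<theta> \<bullet> X h \<omega>) \<partial>M) / complex_of_real h) \<longlongrightarrow>
    complex_of_real (a\<^sup>2 * S $ j $ j) + (\<integral>z. complex_of_real ((sin (a * z $ j))\<^sup>2) * cis (\<theta> \<bullet> z) \<partial>L)) (at_right 0)"
proof -
  \<comment> \<open>As sin^2 y is a combination of 1, cis (2 y) and cis (-2 y), multiplication by it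
    shifts the frequency \<theta> by 0 and by plus or minus \<open>e\<close>.\<close>
  define e where "e = axis j (2 * a)"
  have ez: "e \<bullet> z = 2 * (a * z $ j)" for z :: "real^2" by (simp add: e_def inner_axis')
  have pt: "complex_of_real ((sin (a * z $ j))\<^sup>2) * cis (\<theta> \<bullet> z)
     = cis (\<theta> \<bullet> z) / 2 - cis ((\<theta> + e) \<bullet> z) / 4 - cis ((\<theta> - e) \<bullet> z) / 4" for z :: "real^2"
  proof -
    define y where "y = a * z $ j"
    have "cis (2 * y) + cis (- (2 * y)) = complex_of_real (2 - 4 * (sin y)\<^sup>2)"
      by (simp add: complex_eq_iff cos_double_sin)
    then have s: "complex_of_real ((sin y)\<^sup>2) = 1 / 2 - (cis (2 * y) + cis (- (2 * y))) / 4" by (simp add: field_simps)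
    have "cis ((\<theta> + e) \<bullet> z) = cis (\<theta> \<bullet> z) * cis (2 * y)" "cis ((\<theta> - e) \<bullet> z) = cis (\<theta> \<bullet> z) * cis (- (2 * y))"
      by (simp_all add: inner_add_left inner_diff_left ez y_def cis_mult)
    then show ?thesis unfolding y_def[symmetric] s by (simp add: field_simps)
  qed
  let ?E = "\<lambda>\<theta> h. \<integral>\<omega>. cis (\<theta> \<bullet> X h \<omega>) \<partial>M"
  have "((\<lambda>h. (?E \<theta> h - 1) / complex_of_real h / 2 - (?E (\<theta> + e) h - 1) / complex_of_real h / 4
      - (?E (\<theta> - e) h - 1) / complex_of_real h / 4) \<longlongrightarrow> \<Psi> \<theta> / 2 - \<Psi> (\<theta> + e) / 4 - \<Psi> (\<theta> - e) / 4) (at_right 0)"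
    by (intro tendsto_intros generator_cis) auto
  then have "((\<lambda>h. (\<integral>\<omega>. complex_of_real ((sin (a * X h \<omega> $ j))\<^sup>2) * cis (\<theta> \<bullet> X h \<omega>) \<partial>M) / complex_of_real h) \<longlongrightarrow>
      \<Psi> \<theta> / 2 - \<Psi> (\<theta> + e) / 4 - \<Psi> (\<theta> - e) / 4) (at_right 0)"
  proof (rule Lim_transform_eventually)
    show "\<forall>\<^sub>F h in at_right 0. (?E \<theta> h - 1) / complex_of_real h / 2 - (?E (\<theta> + e) h - 1) / complex_of_real h / 4
        - (?E (\<theta> - e) h - 1) / complex_of_real h / 4
        = (\<integral>\<omega>. complex_of_real ((sin (a * X h \<omega> $ j))\<^sup>2) * cis (\<theta> \<bullet> X h \<omega>) \<partial>M) / complex_of_real h"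
      unfolding eventually_at_filter
    proof (intro always_eventually allI impI)
      fix h :: real assume "h \<noteq> 0" "h \<in> {0<..}"
      then have h: "0 < h" by simp
      have int: "integrable M (\<lambda>\<omega>. cis (\<theta> \<bullet> X h \<omega>))" for \<theta>
        using h by (intro integrable_cis) simp
      have "(\<integral>\<omega>. complex_of_real ((sin (a * X h \<omega> $ j))\<^sup>2) * cis (\<theta> \<bullet> X h \<omega>) \<partial>M) = ?E \<theta> h / 2 - ?E (\<theta> + e) h / 4 - ?E (\<theta> - e) h / 4"
        unfolding pt using int by simp
      moreover have "(A - 1) / complex_of_real h / 2 - (B - 1) / complex_of_real h / 4 - (C - 1) / complex_of_real h / 4
          = (A / 2 - B / 4 - C / 4) / complex_of_real h" for A B C
        using h by (simp add: field_simps)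
      ultimately show "(?E \<theta> h - 1) / complex_of_real h / 2 - (?E (\<theta> + e) h - 1) / complex_of_real h / 4
        - (?E (\<theta> - e) h - 1) / complex_of_real h / 4
        = (\<integral>\<omega>. complex_of_real ((sin (a * X h \<omega> $ j))\<^sup>2) * cis (\<theta> \<bullet> X h \<omega>) \<partial>M) / complex_of_real h"
        by metis
    qed
  qed
  moreover have "\<Psi> \<theta> / 2 - \<Psi> (\<theta> + e) / 4 - \<Psi> (\<theta> - e) / 4 =
      complex_of_real (a\<^sup>2 * S $ j $ j) + (\<integral>z. complex_of_real ((sin (a * z $ j))\<^sup>2) * cis (\<theta> \<bullet> z) \<partial>L)"
  proof -
    have "(\<integral>z. complex_of_real ((sin (a * z $ j))\<^sup>2) * cis (\<theta> \<bullet> z) \<partial>L)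
      = (\<integral>z. compensated \<theta> z / 2 - compensated (\<theta> + e) z / 4 - compensated (\<theta> - e) z / 4 \<partial>L)"
    proof (intro Bochner_Integration.integral_cong refl)
      fix z
      show "complex_of_real ((sin (a * z $ j))\<^sup>2) * cis (\<theta> \<bullet> z)
        = compensated \<theta> z / 2 - compensated (\<theta> + e) z / 4 - compensated (\<theta> - e) z / 4"
        unfolding pt compensated_def inner_commute[of z] inner_add_left inner_diff_left
        by (simp add: field_simps)
    qed
    also have "\<dots> = (\<integral>z. compensated \<theta> z \<partial>L) / 2 - (\<integral>z. compensated (\<theta> + e) z \<partial>L) / 4 - (\<integral>z. compensated (\<theta> - e) z \<partial>L) / 4"
      using integrable_compensated by simp
    finally have I: "(\<integral>z. complex_of_real ((sin (a * z $ j))\<^sup>2) * cis (\<theta> \<bullet> z) \<partial>L) = \<dots>" .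
    \<comment> \<open>The parallelogram law: in the second difference of the quadratic form only its
      value at \<open>e\<close> survives, and this is 4 a^2 times a diagonal entry of
      \<open>S\<close>.\<close>
    have Q: "(\<theta> + e) \<bullet> (S *v (\<theta> + e)) + (\<theta> - e) \<bullet> (S *v (\<theta> - e)) = 2 * (\<theta> \<bullet> (S *v \<theta>)) + 2 * (e \<bullet> (S *v e))"
      by (simp add: matrix_vector_right_distrib matrix_vector_mult_diff_distrib inner_add_left inner_add_right inner_diff_left inner_diff_right)
    have E: "e \<bullet> (S *v e) = 4 * a\<^sup>2 * S $ j $ j"
    proof -
      have "(S *v e) $ j = S $ j $ j * (2 * a)"
        unfolding matrix_vector_mult_def e_def
        by (simp add: axis_def if_distrib cong: if_cong)
      then show ?thesis by (simp add: e_def inner_axis' power2_eq_square)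
    qed
    have "complex_of_real (\<theta> \<bullet> (S *v \<theta>)) / 2 / 2 - complex_of_real ((\<theta> + e) \<bullet> (S *v (\<theta> + e))) / 2 / 4
        - complex_of_real ((\<theta> - e) \<bullet> (S *v (\<theta> - e))) / 2 / 4
      = complex_of_real ((4 * (\<theta> \<bullet> (S *v \<theta>)) - 2 * ((\<theta> + e) \<bullet> (S *v (\<theta> + e)) + (\<theta> - e) \<bullet> (S *v (\<theta> - e)))) / 16)"
      by (simp add: field_simps)
    also have "\<dots> = - complex_of_real (a\<^sup>2 * S $ j $ j)" unfolding Q E by simp
    finally have G: "complex_of_real (\<theta> \<bullet> (S *v \<theta>)) / 2 / 2 - complex_of_real ((\<theta> + e) \<bullet> (S *v (\<theta> + e))) / 2 / 4
        - complex_of_real ((\<theta> - e) \<bullet> (S *v (\<theta> - e))) / 2 / 4 = - complex_of_real (a\<^sup>2 * S $ j $ j)" .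
    have D: "\<i> * complex_of_real (g \<bullet> \<theta>) / 2 - \<i> * complex_of_real (g \<bullet> (\<theta> + e)) / 4 - \<i> * complex_of_real (g \<bullet> (\<theta> - e)) / 4 = 0"
      by (simp add: inner_add_right inner_diff_right field_simps)
    have rearrange: "(d1 - q1 / 2 + i1) / 2 - (d2 - q2 / 2 + i2) / 4 - (d3 - q3 / 2 + i3) / 4
      = (d1 / 2 - d2 / 4 - d3 / 4) - (q1 / 2 / 2 - q2 / 2 / 4 - q3 / 2 / 4) + (i1 / 2 - i2 / 4 - i3 / 4)"
      for d1 d2 d3 q1 q2 q3 i1 i2 i3 :: complex
      by (simp add: field_simps)
    show ?thesis unfolding \<Psi>_eq I rearrange G D by simp
  qed
  ultimately show ?thesis by simp
qed

end

section \<open>Functions of smaller order than the square\<close>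

lemma little_square_cubic:
  assumes "\<And>z. norm z \<le> 1 \<Longrightarrow> \<bar>r z\<bar> \<le> C * norm z ^ 3"
  shows "little_square r"
  unfolding little_square_def
proof (intro allI impI)
  fix e :: real assume "0 < e"
  define d where "d = min 1 (e / (\<bar>C\<bar> + 1))"
  have d: "0 < d" using \<open>0 < e\<close> by (simp add: d_def)
  show "\<forall>\<^sub>F z in nhds 0. \<bar>r z\<bar> \<le> e * (norm z)\<^sup>2"
    unfolding eventually_nhds_metric
  proof (intro exI[of _ d] conjI d allI impI)
    fix z :: 'a assume z: "dist z 0 < d"
    then have "norm z \<le> 1" "norm z \<le> e / (\<bar>C\<bar> + 1)" by (auto simp: d_def)
    then have "(\<bar>C\<bar> + 1) * norm z \<le> e" by (simp add: pos_le_divide_eq mult.commute)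
    moreover have "C * norm z \<le> (\<bar>C\<bar> + 1) * norm z" by (intro mult_right_mono) auto
    ultimately have "C * norm z \<le> e" by linarith
    then have "(C * norm z) * (norm z)\<^sup>2 \<le> e * (norm z)\<^sup>2" by (intro mult_right_mono) auto
    then show "\<bar>r z\<bar> \<le> e * (norm z)\<^sup>2"
      using assms[OF \<open>norm z \<le> 1\<close>] by (simp add: power3_eq_cube power2_eq_square mult.assoc)
  qed
qed

lemma little_square_add:
  assumes "little_square f" "little_square h" shows "little_square (\<lambda>z. f z + h z)"
  unfolding little_square_def
proof (intro allI impI)
  fix e :: real assume "0 < e"
  then have "\<forall>\<^sub>F z in nhds 0. \<bar>f z\<bar> \<le> e / 2 * (norm z)\<^sup>2" "\<forall>\<^sub>F z in nhds 0. \<bar>h z\<bar> \<le> e / 2 * (norm z)\<^sup>2"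
    using assms half_gt_zero unfolding little_square_def by blast+
  then show "\<forall>\<^sub>F z in nhds 0. \<bar>f z + h z\<bar> \<le> e * (norm z)\<^sup>2"
  proof eventually_elim
    case (elim z)
    have "e * (norm z)\<^sup>2 = e / 2 * (norm z)\<^sup>2 + e / 2 * (norm z)\<^sup>2" by simp
    with elim show ?case by linarith
  qed
qed

lemma little_square_compose:
  assumes F: "little_square F" and C: "\<And>z. norm z \<le> 1 \<Longrightarrow> \<bar>p z\<bar> \<le> C * norm z"
  shows "little_square (\<lambda>z. F (p z :: real))"
  unfolding little_square_def
proof (intro allI impI)
  fix e :: real assume e: "0 < e"
  define c where "c = \<bar>C\<bar> + 1"
  have c: "0 < c" by (simp add: c_def)
  have "\<forall>\<^sub>F w in nhds 0. \<bar>F w\<bar> \<le> e / c\<^sup>2 * (norm w)\<^sup>2"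
    using F[unfolded little_square_def, rule_format, of "e / c\<^sup>2"] e c by simp
  then obtain d where d: "0 < d" "\<And>w. \<bar>w\<bar> < d \<Longrightarrow> \<bar>F w\<bar> \<le> e / c\<^sup>2 * w\<^sup>2"
    unfolding eventually_nhds_metric by (auto simp: dist_norm)
  show "\<forall>\<^sub>F z in nhds 0. \<bar>F (p z)\<bar> \<le> e * (norm z)\<^sup>2"
    unfolding eventually_nhds_metric
  proof (intro exI[of _ "min 1 (d / c)"] conjI allI impI)
    show "0 < min 1 (d / c)" using d c by simp
    fix z :: 'a assume "dist z 0 < min 1 (d / c)"
    then have z: "norm z \<le> 1" "c * norm z < d" using c by (auto simp: pos_less_divide_eq mult.commute)
    have "C * norm z \<le> c * norm z" by (intro mult_right_mono) (auto simp: c_def)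
    with C[OF z(1)] have p: "\<bar>p z\<bar> \<le> c * norm z" by linarith
    then have "(p z)\<^sup>2 \<le> (c * norm z)\<^sup>2" by (simp add: abs_le_square_iff[symmetric] abs_mult c_def)
    then have "e / c\<^sup>2 * (p z)\<^sup>2 \<le> e / c\<^sup>2 * (c * norm z)\<^sup>2" using e by (intro mult_left_mono) auto
    also have "\<dots> = e * (norm z)\<^sup>2" using c by (simp add: power_mult_distrib)
    finally show "\<bar>F (p z)\<bar> \<le> e * (norm z)\<^sup>2" using d(2)[of "p z"] p z by linarith
  qed
qed

text \<open>The Taylor polynomial of degree 2 of exp (i x) has imaginary part x, so the cubic
  remainder applies; its factor 1/6 is dropped.\<close>

lemma abs_sin_minus_le_cube: "\<bar>sin x - x\<bar> \<le> \<bar>x\<bar> ^ 3" for x :: real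
proof -
  have "\<bar>Im (iexp x - (\<Sum>k\<le>2. (\<i> * x) ^ k / fact k))\<bar> \<le> \<bar>x\<bar> ^ 3 / 6"
    using order_trans[OF abs_Im_le_cmod iexp_approx1[of x 2]] by (simp add: fact_numeral eval_nat_numeral)
  moreover have "Im (iexp x - (\<Sum>k\<le>2. (\<i> * x) ^ k / fact k)) = sin x - x"
    by (simp add: numeral_2_eq_2 cis_conv_exp[symmetric] power2_eq_square)
  ultimately have "\<bar>sin x - x\<bar> \<le> \<bar>x\<bar> ^ 3 / 6" by (simp only:)
  moreover have "0 \<le> \<bar>x\<bar> ^ 3" by simp
  ultimately show ?thesis by linarith
qed

text \<open>The Lagrange remainder is exp t / 6 times the cube with \<bar>t\<bar> \<le> 1, and its
  coefficient is at most 1 because e \<le> 3.\<close>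

lemma abs_exp_minus_approx:
  fixes x :: real assumes "\<bar>x\<bar> \<le> 1" shows "\<bar>exp (- x) - 1 + x - x\<^sup>2 / 2\<bar> \<le> \<bar>x\<bar> ^ 3"
proof -
  obtain t where t: "\<bar>t\<bar> \<le> \<bar>- x\<bar>" "exp (- x) = (\<Sum>m<3. (- x) ^ m / fact m) + exp t / fact 3 * (- x) ^ 3"
    using Maclaurin_exp_le[of "-x" 3] by blast
  have "exp t \<le> exp 1" using t assms by simp
  also have "\<dots> \<le> 3" by (rule exp_le)
  finally have "exp t / 6 \<le> 1" by simp
  have "\<bar>exp (- x) - 1 + x - x\<^sup>2 / 2\<bar> = exp t / 6 * \<bar>x\<bar> ^ 3"
    unfolding t(2) by (simp add: eval_nat_numeral fact_numeral abs_mult power_abs)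
  also have "\<dots> \<le> 1 * \<bar>x\<bar> ^ 3" by (intro mult_right_mono) (use \<open>exp t / 6 \<le> 1\<close> in auto)
  finally show ?thesis by simp
qed

lemma borel_measurable_component [measurable]: "(\<lambda>z::real^'n. z $ j) \<in> borel_measurable borel"
  by (intro borel_measurable_continuous_onI continuous_intros)

section \<open>Tails linear in time and the weighted generator\<close>

context bivariate_levy
begin

text \<open>Linear in \<open>h\<close> because |exp (h \<Psi>) - 1| \<le> h |\<Psi>|. Divided by
  \<open>h\<close>, the bound controls the tails of P(X_h \<in> dz) / h uniformly in
  \<open>h\<close>.\<close>

lemma tail_X:
  assumes r: "0 < r" and h: "0 \<le> h" and le: "\<And>a. \<bar>a\<bar> \<le> 2 / r \<Longrightarrow> norm (\<Psi> (axis j a)) \<le> \<tau>"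
  shows "prob {\<omega> \<in> space M. r \<le> \<bar>X h \<omega> $ j\<bar>} \<le> h * (2 * \<tau>)"
proof -
  have [measurable]: "X h \<in> borel_measurable M" using h by simp
  have "prob {\<omega> \<in> space M. r \<le> \<bar>X h \<omega> $ j\<bar>} \<le> 2 * (h * \<tau>)"
  proof (rule tail_le_char[OF _ r])
    fix a :: real assume a: "\<bar>a\<bar> \<le> 2 / r"
    have "(\<integral>\<omega>. cis (a * X h \<omega> $ j) \<partial>M) = exp (complex_of_real h * \<Psi> (axis j a))"
      using expectation_cis_X[OF h, of "axis j a"] by (simp add: inner_axis')
    then show "norm ((\<integral>\<omega>. cis (a * X h \<omega> $ j) \<partial>M) - 1) \<le> h * \<tau>"
      using norm_exp_\<Psi>_le[OF h, of "axis j a"] mult_left_mono[OF le[OF a] h] by simp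
  qed measurable
  then show ?thesis by simp
qed

text \<open>Large \<open>r\<close> probes only small frequencies, where \<Psi> is small by
  continuity and \<Psi> 0 = 0. With R = 4 / d the relevant frequencies, at most 2 / r, stay below
  d.\<close>

lemma ex_tail_X:
  assumes "0 < \<tau>"
  shows "\<exists>R>0. \<forall>r\<ge>R. \<forall>h\<ge>0. \<forall>j. prob {\<omega> \<in> space M. r \<le> \<bar>X h \<omega> $ j\<bar>} \<le> h * \<tau>"
proof -
  have "\<forall>\<^sub>F \<theta> in nhds 0. norm (\<Psi> \<theta>) < \<tau> / 2"
    using isCont_\<Psi>[of 0] assms unfolding isCont_def \<Psi>_0 eventually_nhds_conv_at
    by (auto dest!: tendstoD[of _ _ _ "\<tau> / 2"] simp: dist_norm \<Psi>_0)
  then obtain d where d: "0 < d" "\<And>\<theta>. norm \<theta> < d \<Longrightarrow> norm (\<Psi> \<theta>) < \<tau> / 2"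
    unfolding eventually_nhds_metric by (auto simp: dist_norm)
  show ?thesis
  proof (intro exI[of _ "4 / d"] conjI allI impI)
    show "0 < 4 / d" using d by simp
    fix r h :: real and j :: 2 assume r: "4 / d \<le> r" and h: "0 \<le> h"
    have r0: "0 < r" using r d by (smt (verit) divide_pos_pos)
    have "prob {\<omega> \<in> space M. r \<le> \<bar>X h \<omega> $ j\<bar>} \<le> h * (2 * (\<tau> / 2))"
    proof (rule tail_X[OF r0 h])
      fix a :: real assume "\<bar>a\<bar> \<le> 2 / r"
      also have "2 / r < d"
      proof -
        have "4 \<le> r * d" using r d by (simp add: pos_divide_le_eq)
        then have "2 < d * r" by (simp add: mult.commute)
        then show ?thesis using r0 by (simp add: pos_divide_less_eq)
      qed
      finally show "norm (\<Psi> (axis j a)) \<le> \<tau> / 2"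
        using d(2)[of "axis j a"] by (simp add: norm_eq_sqrt_inner inner_axis_axis)
    qed
    then show "prob {\<omega> \<in> space M. r \<le> \<bar>X h \<omega> $ j\<bar>} \<le> h * \<tau>" by simp
  qed
qed

text \<open>A substitute for |z|^2: for a \<noteq> 0 it is comparable with |z|^2 near the origin,
  but it is bounded and a trigonometric polynomial, so its products with trigonometric polynomials
  have explicit generator limits.\<close>

definition weight :: "real \<Rightarrow> real^2 \<Rightarrow> real" where
  "weight a z = (sin (a * z $ 1))\<^sup>2 + (sin (a * z $ 2))\<^sup>2"

lemma weight_measurable [measurable]: "weight a \<in> borel_measurable borel"
  unfolding weight_def[abs_def] by measurable

lemma weight_bounds: "0 \<le> weight a z" "weight a z \<le> 2"
proof -
  have "(sin x)\<^sup>2 \<le> 1" for x :: real by (simp add: abs_square_le_1)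
  from add_mono[OF this this] show "0 \<le> weight a z" "weight a z \<le> 2" by (simp_all add: weight_def)
qed

lemma integrable_bounded_X:
  fixes f :: "real^2 \<Rightarrow> 'b::{banach, second_countable_topology}"
  assumes "f \<in> borel_measurable borel" "\<And>z. norm (f z) \<le> C" "0 \<le> h"
  shows "integrable M (\<lambda>\<omega>. f (X h \<omega>))"
  using measurable_compose[OF X_measurable[OF assms(3)] assms(1)]
  by (intro integrable_const_bound[of _ C]) (use assms(2) in auto)

text \<open>In terms of measures: \<open>weight a\<close> times P(X_h \<in> dz) / h converges,
  tested against trigonometric polynomials, to the finite measure that has density
  \<open>weight a\<close> with respect to \<open>L\<close> and an additional atom at 0 of mass a^2
  (S11 + S22). The Gaussian part survives only as this atom.\<close>

lemma generator_weight:
  assumes "trig_polynomial q"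
  shows "integrable L (\<lambda>z. complex_of_real (weight a z) * q z) \<and>
    ((\<lambda>h. (\<integral>\<omega>. complex_of_real (weight a (X h \<omega>)) * q (X h \<omega>) \<partial>M) / complex_of_real h) \<longlongrightarrow>
      complex_of_real (a\<^sup>2 * (S $ 1 $ 1 + S $ 2 $ 2)) * q 0 + (\<integral>z. complex_of_real (weight a z) * q z \<partial>L)) (at_right 0)"
  using assms
proof induction
  case (cis \<theta>)
  let ?f = "\<lambda>j z. complex_of_real ((sin (a * z $ j))\<^sup>2) * cis (\<theta> \<bullet> z)"
  have eq: "complex_of_real (weight a z) * cis (\<theta> \<bullet> z) = ?f 1 z + ?f 2 z" for z
    by (simp add: weight_def distrib_right)
  have "((\<lambda>h. (\<integral>\<omega>. ?f 1 (X h \<omega>) \<partial>M) / complex_of_real h + (\<integral>\<omega>. ?f 2 (X h \<omega>) \<partial>M) / complex_of_real h) \<longlongrightarrow>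
     (complex_of_real (a\<^sup>2 * S $ 1 $ 1) + (\<integral>z. ?f 1 z \<partial>L)) + (complex_of_real (a\<^sup>2 * S $ 2 $ 2) + (\<integral>z. ?f 2 z \<partial>L))) (at_right 0)"
    by (intro tendsto_add generator_sin_sq_cis)
  then have "((\<lambda>h. (\<integral>\<omega>. ?f 1 (X h \<omega>) + ?f 2 (X h \<omega>) \<partial>M) / complex_of_real h) \<longlongrightarrow>
     (complex_of_real (a\<^sup>2 * S $ 1 $ 1) + (\<integral>z. ?f 1 z \<partial>L)) + (complex_of_real (a\<^sup>2 * S $ 2 $ 2) + (\<integral>z. ?f 2 z \<partial>L))) (at_right 0)"
  proof (rule Lim_transform_eventually)
    have int: "integrable M (\<lambda>\<omega>. ?f j (X h \<omega>))" if "0 \<le> h" for j h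
    proof (rule integrable_bounded_X[OF _ _ that, of "?f j" 1])
      show "?f j \<in> borel_measurable borel" unfolding cis_conv_exp by measurable
      show "norm (?f j z) \<le> 1" for z by (simp add: norm_mult norm_power abs_square_le_1)
    qed
    have "(\<integral>\<omega>. ?f 1 (X h \<omega>) \<partial>M) / complex_of_real h + (\<integral>\<omega>. ?f 2 (X h \<omega>) \<partial>M) / complex_of_real h
       = (\<integral>\<omega>. ?f 1 (X h \<omega>) + ?f 2 (X h \<omega>) \<partial>M) / complex_of_real h" if "0 \<le> h" for h
      using int[OF that] by (simp add: add_divide_distrib)
    then show "\<forall>\<^sub>F h in at_right 0. (\<integral>\<omega>. ?f 1 (X h \<omega>) \<partial>M) / complex_of_real h + (\<integral>\<omega>. ?f 2 (X h \<omega>) \<partial>M) / complex_of_real h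
       = (\<integral>\<omega>. ?f 1 (X h \<omega>) + ?f 2 (X h \<omega>) \<partial>M) / complex_of_real h"
      by (simp add: eventually_at_filter)
  qed
  moreover have "(complex_of_real (a\<^sup>2 * S $ 1 $ 1) + (\<integral>z. ?f 1 z \<partial>L)) + (complex_of_real (a\<^sup>2 * S $ 2 $ 2) + (\<integral>z. ?f 2 z \<partial>L))
     = complex_of_real (a\<^sup>2 * (S $ 1 $ 1 + S $ 2 $ 2)) * cis (\<theta> \<bullet> 0) + (\<integral>z. ?f 1 z + ?f 2 z \<partial>L)"
    by (subst Bochner_Integration.integral_add)
      (auto simp: integrable_L_sin_sq_cis[unfolded of_real_power] integrable_L_sin_sq_cis distrib_left)
  ultimately show ?case unfolding eq using integrable_L_sin_sq_cis by simp
next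
  case (scale f c)
  have eq: "complex_of_real (weight a z) * (c * f z) = c * (complex_of_real (weight a z) * f z)" for z by simp
  from scale have int: "integrable L (\<lambda>z. complex_of_real (weight a z) * f z)" by simp
  from scale have "((\<lambda>h. c * ((\<integral>\<omega>. complex_of_real (weight a (X h \<omega>)) * f (X h \<omega>) \<partial>M) / complex_of_real h)) \<longlongrightarrow>
      c * (complex_of_real (a\<^sup>2 * (S $ 1 $ 1 + S $ 2 $ 2)) * f 0 + (\<integral>z. complex_of_real (weight a z) * f z \<partial>L))) (at_right 0)"
    by (intro tendsto_mult_left) simp
  then show ?case unfolding eq using int by (simp add: algebra_simps)
next
  case (add f k)
  have eq: "complex_of_real (weight a z) * (f z + k z) = complex_of_real (weight a z) * f z + complex_of_real (weight a z) * k z" for z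
    by (simp add: distrib_left)
  let ?g = "\<lambda>f h. \<integral>\<omega>. complex_of_real (weight a (X h \<omega>)) * f (X h \<omega>) \<partial>M"
  have int: "integrable M (\<lambda>\<omega>. complex_of_real (weight a (X h \<omega>)) * f (X h \<omega>))" if h: "0 \<le> h" and f: "trig_polynomial f" for h f
  proof -
    obtain C where C: "\<And>z. norm (f z) \<le> C" using trig_polynomial_bounded[OF f] by blast
    note [measurable] = trig_polynomial_measurable[OF f]
    show ?thesis
    proof (rule integrable_bounded_X[OF _ _ h, of "\<lambda>z. complex_of_real (weight a z) * f z" "2 * C"])
      show "norm (complex_of_real (weight a z) * f z) \<le> 2 * C" for z
        using weight_bounds[of a z] C[of z] by (simp add: norm_mult mult_mono)
    qed measurable
  qed
  have "((\<lambda>h. ?g f h / complex_of_real h + ?g k h / complex_of_real h) \<longlongrightarrow>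
      (complex_of_real (a\<^sup>2 * (S $ 1 $ 1 + S $ 2 $ 2)) * f 0 + (\<integral>z. complex_of_real (weight a z) * f z \<partial>L)) +
      (complex_of_real (a\<^sup>2 * (S $ 1 $ 1 + S $ 2 $ 2)) * k 0 + (\<integral>z. complex_of_real (weight a z) * k z \<partial>L))) (at_right 0)"
    using add by (intro tendsto_add) simp_all
  then have "((\<lambda>h. ?g (\<lambda>z. f z + k z) h / complex_of_real h) \<longlongrightarrow>
      (complex_of_real (a\<^sup>2 * (S $ 1 $ 1 + S $ 2 $ 2)) * f 0 + (\<integral>z. complex_of_real (weight a z) * f z \<partial>L)) +
      (complex_of_real (a\<^sup>2 * (S $ 1 $ 1 + S $ 2 $ 2)) * k 0 + (\<integral>z. complex_of_real (weight a z) * k z \<partial>L))) (at_right 0)"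
  proof (rule Lim_transform_eventually)
    have "?g f h / complex_of_real h + ?g k h / complex_of_real h = ?g (\<lambda>z. f z + k z) h / complex_of_real h" if "0 \<le> h" for h
      unfolding eq using int[OF that] add by (simp add: add_divide_distrib)
    then show "\<forall>\<^sub>F h in at_right 0. ?g f h / complex_of_real h + ?g k h / complex_of_real h = ?g (\<lambda>z. f z + k z) h / complex_of_real h"
      by (simp add: eventually_at_filter)
  qed
  then show ?case using add by (simp add: distrib_left add_ac)
qed

lemma generator_weight_real:
  assumes q: "trig_polynomial (\<lambda>z. complex_of_real (q z))"
  shows "integrable L (\<lambda>z. weight a z * q z)"
    and "((\<lambda>h. (\<integral>\<omega>. weight a (X h \<omega>) * q (X h \<omega>) \<partial>M) / h) \<longlongrightarrow>
      a\<^sup>2 * (S $ 1 $ 1 + S $ 2 $ 2) * q 0 + (\<integral>z. weight a z * q z \<partial>L)) (at_right 0)"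
proof -
  note G = generator_weight[OF q, of a]
  have "integrable L (\<lambda>z. complex_of_real (weight a z * q z))" using G by simp
  from integrable_Re[OF this] show int: "integrable L (\<lambda>z. weight a z * q z)" by simp
  have "((\<lambda>h. complex_of_real ((\<integral>\<omega>. weight a (X h \<omega>) * q (X h \<omega>) \<partial>M) / h)) \<longlongrightarrow>
      complex_of_real (a\<^sup>2 * (S $ 1 $ 1 + S $ 2 $ 2) * q 0 + (\<integral>z. weight a z * q z \<partial>L))) (at_right 0)"
    using conjunct2[OF G] unfolding of_real_mult[symmetric] integral_complex_of_real by simp
  then show "((\<lambda>h. (\<integral>\<omega>. weight a (X h \<omega>) * q (X h \<omega>) \<partial>M) / h) \<longlongrightarrow>
      a\<^sup>2 * (S $ 1 $ 1 + S $ 2 $ 2) * q 0 + (\<integral>z. weight a z * q z \<partial>L)) (at_right 0)"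
    by (rule tendsto_of_real_iff[THEN iffD1])
qed

end

subsection \<open>The generator at zero\<close>

text \<open>The function \<phi> of the overview. It vanishes exactly on the curve that has to carry
  the Levy measure.\<close>

definition first_integral :: "real \<Rightarrow> real^2 \<Rightarrow> real" where
  "first_integral k z = z $ 2 - k * (1 - exp (- (z $ 1)))"

text \<open>The gradient of \<open>first_integral k\<close> at the origin.\<close>

definition gradient :: "real \<Rightarrow> real^2" where
  "gradient k = vector [- k, 1]"

lemma inner_gradient: "gradient k \<bullet> z = z $ 2 - k * z $ 1"
  by (simp add: gradient_def inner_vec_def sum_2)

lemma first_integral_continuous: "continuous_on UNIV (first_integral k)"
  unfolding first_integral_def by (intro continuous_intros)

lemma first_integral_measurable [measurable]: "first_integral k \<in> borel_measurable borel"
  by (rule borel_measurable_continuous_onI) (rule first_integral_continuous)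

text \<open>With y = gradient k \<bullet> z, \<open>first_integral k z\<close> is y + k (exp (-x) -
  1 + x), so its second order expansion is y + k x^2 / 2. Sines replace y and x by bounded functions
  with the same expansion, for which the generator is explicit. The other bounds serve for the
  square of \<open>first_integral\<close> and for compositions with it.\<close>

lemma first_integral_expansion:
  "\<exists>C\<ge>0. \<forall>z. norm z \<le> 1 \<longrightarrow>
     \<bar>first_integral k z - sin (gradient k \<bullet> z) - k / 2 * (sin (z $ 1))\<^sup>2\<bar> \<le> C * norm z ^ 3 \<and>
     \<bar>first_integral k z - sin (gradient k \<bullet> z)\<bar> \<le> C * (norm z)\<^sup>2 \<and>
     \<bar>first_integral k z + sin (gradient k \<bullet> z)\<bar> \<le> C * norm z \<and>
     \<bar>first_integral k z\<bar> \<le> C * norm z"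
proof -
  define c where "c = norm (gradient k)"
  \<comment> \<open>\<open>c ^ 3\<close> accounts for y - sin y, 2 \<bar>k\<bar> for the errors of
    exp and of sin^2 x, and one more \<bar>k\<bar> for the term k / 2 sin^2 x itself. Adding 2 c
    below covers the linear term.\<close>
  define C0 where "C0 = c ^ 3 + 3 * \<bar>k\<bar>"
  have c0: "0 \<le> c" by (simp add: c_def)
  then have C0: "0 \<le> C0" "c ^ 3 + 2 * \<bar>k\<bar> \<le> C0" by (simp_all add: C0_def)
  show ?thesis
  proof (intro exI[of _ "C0 + 2 * c"] conjI allI impI)
    show "0 \<le> C0 + 2 * c" using C0 c0 by simp
    fix z :: "real^2" assume z: "norm z \<le> 1"
    define n where "n = norm z"
    define x where "x = z $ 1"
    define y where "y = gradient k \<bullet> z"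
    have n: "0 \<le> n" "n \<le> 1" using z by (simp_all add: n_def)
    have x: "\<bar>x\<bar> \<le> n" by (simp add: x_def n_def component_le_norm_cart)
    have y: "\<bar>y\<bar> \<le> c * n" by (simp add: y_def c_def n_def Cauchy_Schwarz_ineq2)
    have x3: "\<bar>x\<bar> ^ 3 \<le> n ^ 3" using x by (intro power_mono) auto
    have y3: "\<bar>y\<bar> ^ 3 \<le> c ^ 3 * n ^ 3" using power_mono[OF y, of 3] by (simp add: power_mult_distrib)
    have n3: "n ^ 3 \<le> n\<^sup>2" "n\<^sup>2 \<le> n"
      using n power_decreasing[of 2 3 n] power_decreasing[of 1 2 n] by simp_all
    have phi: "first_integral k z = y + k * (exp (- x) - 1 + x)"
      by (simp add: first_integral_def y_def x_def inner_gradient algebra_simps)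
    have sx: "\<bar>sin x - x\<bar> \<le> n ^ 3" using abs_sin_minus_le_cube[of x] x3 by linarith
    have sq: "\<bar>x\<^sup>2 - (sin x)\<^sup>2\<bar> \<le> 2 * n ^ 3"
    proof -
      have "\<bar>x\<^sup>2 - (sin x)\<^sup>2\<bar> = \<bar>sin x - x\<bar> * \<bar>sin x + x\<bar>"
        by (simp add: abs_mult[symmetric] power2_eq_square algebra_simps abs_minus_commute)
      also have "\<dots> \<le> n ^ 3 * 2"
        using sx x n abs_sin_x_le_abs_x[of x] by (intro mult_mono) auto
      finally show ?thesis by simp
    qed
    have ex: "\<bar>exp (- x) - 1 + x - x\<^sup>2 / 2\<bar> \<le> n ^ 3" using abs_exp_minus_approx[of x] x x3 n by linarith
    have "first_integral k z - sin y - k / 2 * (sin x)\<^sup>2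
      = (y - sin y) + k * ((exp (- x) - 1 + x - x\<^sup>2 / 2) + (x\<^sup>2 - (sin x)\<^sup>2) / 2)"
      unfolding phi by (simp add: field_simps)
    also have "\<bar>\<dots>\<bar> \<le> c ^ 3 * n ^ 3 + \<bar>k\<bar> * (2 * n ^ 3)"
    proof (rule order_trans[OF abs_triangle_ineq add_mono])
      show "\<bar>y - sin y\<bar> \<le> c ^ 3 * n ^ 3" using abs_sin_minus_le_cube[of y] y3 by linarith
      have "\<bar>(exp (- x) - 1 + x - x\<^sup>2 / 2) + (x\<^sup>2 - (sin x)\<^sup>2) / 2\<bar> \<le> 2 * n ^ 3"
      proof -
        have "\<bar>A + D / 2\<bar> \<le> 2 * N" if "\<bar>A\<bar> \<le> N" "\<bar>D\<bar> \<le> 2 * N" for A D N :: real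
          using that by linarith
        from this[OF ex sq] show ?thesis .
      qed
      then show "\<bar>k * ((exp (- x) - 1 + x - x\<^sup>2 / 2) + (x\<^sup>2 - (sin x)\<^sup>2) / 2)\<bar> \<le> \<bar>k\<bar> * (2 * n ^ 3)"
        unfolding abs_mult by (intro mult_left_mono) auto
    qed
    also have "\<dots> = (c ^ 3 + 2 * \<bar>k\<bar>) * n ^ 3" by (simp add: algebra_simps)
    finally have 1: "\<bar>first_integral k z - sin y - k / 2 * (sin x)\<^sup>2\<bar> \<le> (c ^ 3 + 2 * \<bar>k\<bar>) * n ^ 3" .
    have "0 \<le> n ^ 3" "0 \<le> n\<^sup>2" using n by simp_all
    have p1: "\<bar>first_integral k z - sin y - k / 2 * (sin x)\<^sup>2\<bar> \<le> C0 * n ^ 3"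
      using 1 mult_right_mono[OF C0(2) \<open>0 \<le> n ^ 3\<close>] by linarith
    have s2: "(sin x)\<^sup>2 \<le> n\<^sup>2"
      using x abs_sin_x_le_abs_x[of x] n by (simp add: abs_le_square_iff[symmetric])
    have "(c ^ 3 + 2 * \<bar>k\<bar>) * n ^ 3 \<le> (c ^ 3 + 2 * \<bar>k\<bar>) * n\<^sup>2"
      using c0 n3 by (intro mult_left_mono) auto
    moreover have "\<bar>k / 2 * (sin x)\<^sup>2\<bar> \<le> \<bar>k\<bar> * n\<^sup>2"
    proof -
      have "\<bar>k / 2 * (sin x)\<^sup>2\<bar> = \<bar>k\<bar> / 2 * (sin x)\<^sup>2" by (simp add: abs_mult)
      also have "\<dots> \<le> \<bar>k\<bar> * n\<^sup>2" using s2 by (intro mult_mono) auto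
      finally show ?thesis .
    qed
    moreover have "C0 * n\<^sup>2 = (c ^ 3 + 2 * \<bar>k\<bar>) * n\<^sup>2 + \<bar>k\<bar> * n\<^sup>2" by (simp add: C0_def algebra_simps)
    ultimately have 2: "\<bar>first_integral k z - sin y\<bar> \<le> C0 * n\<^sup>2" using 1 by linarith
    have p2: "C0 * n\<^sup>2 \<le> C0 * n" using n3 C0 by (intro mult_left_mono) auto
    have sy: "\<bar>sin y\<bar> \<le> c * n" using y abs_sin_x_le_abs_x[of y] by linarith
    have 3: "\<bar>first_integral k z + sin y\<bar> \<le> C0 * n + 2 * (c * n)" "\<bar>first_integral k z\<bar> \<le> C0 * n + 2 * (c * n)"
      using 2 p2 sy by linarith+
    have m: "0 \<le> c * n" "0 \<le> c * n\<^sup>2" "0 \<le> c * n ^ 3" using c0 n by simp_all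
    show "\<bar>first_integral k z - sin (gradient k \<bullet> z) - k / 2 * (sin (z $ 1))\<^sup>2\<bar> \<le> (C0 + 2 * c) * norm z ^ 3"
      using p1 m unfolding n_def[symmetric] x_def[symmetric] y_def[symmetric] distrib_right by linarith
    show "\<bar>first_integral k z - sin (gradient k \<bullet> z)\<bar> \<le> (C0 + 2 * c) * (norm z)\<^sup>2"
      using 2 m unfolding n_def[symmetric] y_def[symmetric] distrib_right by linarith
    show "\<bar>first_integral k z + sin (gradient k \<bullet> z)\<bar> \<le> (C0 + 2 * c) * norm z"
      "\<bar>first_integral k z\<bar> \<le> (C0 + 2 * c) * norm z"
      using 3 unfolding n_def[symmetric] y_def[symmetric] distrib_right by simp_all
  qed
qed

text \<open>If F expands as \<alpha> w + \<beta> w^2, the composition expands as \<alpha> sin y +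
  \<alpha> k / 2 sin^2 x + \<beta> sin^2 y. The remainder has three parts: that of F, \<alpha> times
  that of \<open>first_integral\<close>, and \<beta> times a difference of squares, which factors
  into a second order and a first order term.\<close>

lemma little_square_first_integral:
  assumes F: "little_square (\<lambda>w. F w - \<alpha> * w - \<beta> * w\<^sup>2)"
  shows "little_square (\<lambda>z. F (first_integral k z) - \<alpha> * sin (gradient k \<bullet> z) - \<alpha> * k / 2 * (sin (z $ 1))\<^sup>2
     - \<beta> * (sin (gradient k \<bullet> z))\<^sup>2)"
proof -
  obtain C where C0: "0 \<le> C" and C: "\<And>z. norm z \<le> 1 \<Longrightarrow>
     \<bar>first_integral k z - sin (gradient k \<bullet> z) - k / 2 * (sin (z $ 1))\<^sup>2\<bar> \<le> C * norm z ^ 3"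
     "\<And>z. norm z \<le> 1 \<Longrightarrow> \<bar>first_integral k z - sin (gradient k \<bullet> z)\<bar> \<le> C * (norm z)\<^sup>2"
     "\<And>z. norm z \<le> 1 \<Longrightarrow> \<bar>first_integral k z + sin (gradient k \<bullet> z)\<bar> \<le> C * norm z"
     "\<And>z. norm z \<le> 1 \<Longrightarrow> \<bar>first_integral k z\<bar> \<le> C * norm z"
    using first_integral_expansion[of k] by blast
  have 1: "little_square (\<lambda>z. F (first_integral k z) - \<alpha> * first_integral k z - \<beta> * (first_integral k z)\<^sup>2)"
    by (rule little_square_compose[OF F C(4)])
  have 2: "little_square (\<lambda>z. \<alpha> * (first_integral k z - sin (gradient k \<bullet> z) - k / 2 * (sin (z $ 1))\<^sup>2))"
  proof (rule little_square_cubic)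
    show "\<bar>\<alpha> * (first_integral k z - sin (gradient k \<bullet> z) - k / 2 * (sin (z $ 1))\<^sup>2)\<bar> \<le> (\<bar>\<alpha>\<bar> * C) * norm z ^ 3"
      if "norm z \<le> 1" for z
      unfolding abs_mult mult.assoc by (intro mult_left_mono C(1) that) auto
  qed
  have 3: "little_square (\<lambda>z. \<beta> * ((first_integral k z - sin (gradient k \<bullet> z)) * (first_integral k z + sin (gradient k \<bullet> z))))"
  proof (rule little_square_cubic)
    fix z :: "real^2" assume z: "norm z \<le> 1"
    have "\<bar>first_integral k z - sin (gradient k \<bullet> z)\<bar> * \<bar>first_integral k z + sin (gradient k \<bullet> z)\<bar>
        \<le> (C * (norm z)\<^sup>2) * (C * norm z)"
      by (intro mult_mono C(2,3) z mult_nonneg_nonneg C0) auto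
    also have "\<dots> = C\<^sup>2 * norm z ^ 3" by (simp add: power2_eq_square power3_eq_cube)
    finally show "\<bar>\<beta> * ((first_integral k z - sin (gradient k \<bullet> z)) * (first_integral k z + sin (gradient k \<bullet> z)))\<bar>
        \<le> (\<bar>\<beta>\<bar> * C\<^sup>2) * norm z ^ 3"
      unfolding abs_mult mult.assoc by (intro mult_left_mono) auto
  qed
  have "(\<lambda>z. F (first_integral k z) - \<alpha> * sin (gradient k \<bullet> z) - \<alpha> * k / 2 * (sin (z $ 1))\<^sup>2
     - \<beta> * (sin (gradient k \<bullet> z))\<^sup>2) =
    (\<lambda>z. (F (first_integral k z) - \<alpha> * first_integral k z - \<beta> * (first_integral k z)\<^sup>2)
      + \<alpha> * (first_integral k z - sin (gradient k \<bullet> z) - k / 2 * (sin (z $ 1))\<^sup>2)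
      + \<beta> * ((first_integral k z - sin (gradient k \<bullet> z)) * (first_integral k z + sin (gradient k \<bullet> z))))"
    by (simp add: fun_eq_iff algebra_simps power2_eq_square)
  then show ?thesis using little_square_add[OF little_square_add[OF 1 2] 3] by simp
qed

context bivariate_levy
begin

definition outside :: "real \<Rightarrow> (real^2) set" where
  "outside R = {z. R < \<bar>z $ 1\<bar> \<or> R < \<bar>z $ 2\<bar>}"

lemma outside_measurable [measurable]: "outside R \<in> sets borel"
  unfolding outside_def by measurable

lemma integrable_L_outside:
  assumes "1 \<le> R" shows "integrable L (indicator (outside R) :: _ \<Rightarrow> real)"
proof (rule integrable_LI[where C=1])
  show "norm (indicator (outside R) z :: real) \<le> 1 * min 1 ((norm z)\<^sup>2)" for z
  proof (cases "z \<in> outside R")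
    case True
    then have "1 \<le> norm z"
      using component_le_norm_cart[of z 1] component_le_norm_cart[of z 2] assms by (auto simp: outside_def)
    then show ?thesis using one_le_power[of "norm z" 2] by simp
  qed simp
qed measurable

lemma L_outside_tendsto_0: "(\<lambda>n. \<integral>z. indicator (outside (1 + real n)) z \<partial>L :: real) \<longlonglongrightarrow> 0"
proof -
  have "(\<lambda>n. \<integral>z. indicator (outside (1 + real n)) z \<partial>L :: real) \<longlonglongrightarrow> (\<integral>z. 0 \<partial>L)"
  proof (rule integral_dominated_convergence[where w="indicator (outside 1)"])
    show "AE z in L. (\<lambda>n. indicator (outside (1 + real n)) z :: real) \<longlonglongrightarrow> 0"
    proof (rule AE_I2, rule tendsto_eventually)
      fix z :: "real^2"
      obtain N :: nat where N: "max \<bar>z $ 1\<bar> \<bar>z $ 2\<bar> < real N" using reals_Archimedean2 by blast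
      show "\<forall>\<^sub>F n in sequentially. indicator (outside (1 + real n)) z = (0::real)"
        using eventually_ge_at_top[of N]
      proof eventually_elim
        case (elim n)
        then have "real N \<le> real n" by simp
        with N have "z \<notin> outside (1 + real n)" unfolding outside_def by simp
        then show ?case by simp
      qed
    qed
    show "AE z in L. norm (indicator (outside (1 + real n)) z :: real) \<le> indicator (outside 1) z" for n
      by (rule AE_I2) (auto simp: outside_def split: split_indicator)
  qed (auto intro: integrable_L_outside)
  then show ?thesis by simp
qed

text \<open>Tightness: one large square captures, up to mass \<tau>, both \<open>L\<close> and all
  measures P(X_h \<in> dz) / h with h > 0.\<close>

lemma ex_outside_small:
  assumes "0 < \<tau>"
  shows "\<exists>R>0. integrable L (indicator (outside R) :: _ \<Rightarrow> real) \<and> (\<integral>z. indicator (outside R) z \<partial>L) \<le> \<tau> \<and>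
    (\<forall>h\<ge>0. (\<integral>\<omega>. indicator (outside R) (X h \<omega>) \<partial>M) \<le> h * \<tau>)"
proof -
  obtain R0 where R0: "\<And>r h j. R0 \<le> r \<Longrightarrow> 0 \<le> h \<Longrightarrow> prob {\<omega> \<in> space M. r \<le> \<bar>X h \<omega> $ j\<bar>} \<le> h * (\<tau> / 2)"
    using ex_tail_X[of "\<tau> / 2"] assms by auto
  have "\<forall>\<^sub>F n in sequentially. (\<integral>z. indicator (outside (1 + real n)) z \<partial>L :: real) < \<tau>"
    using order_tendstoD(2)[OF L_outside_tendsto_0 assms] .
  moreover have "\<forall>\<^sub>F n in sequentially. R0 \<le> real n"
    by (rule eventually_sequentiallyI[of "nat \<lceil>R0\<rceil>"]) linarith
  ultimately have "\<forall>\<^sub>F n in sequentially. (\<integral>z. indicator (outside (1 + real n)) z \<partial>L :: real) < \<tau> \<and> R0 \<le> real n"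
    by (rule eventually_conj)
  then obtain n where n: "(\<integral>z. indicator (outside (1 + real n)) z \<partial>L :: real) < \<tau>" "R0 \<le> real n"
    using eventually_happens'[OF sequentially_bot] by blast
  define R where "R = 1 + real n"
  show ?thesis
  proof (intro exI[of _ R] conjI allI impI)
    show "0 < R" by (simp add: R_def)
    show "integrable L (indicator (outside R) :: _ \<Rightarrow> real)" unfolding R_def by (rule integrable_L_outside) simp
    show "(\<integral>z. indicator (outside R) z \<partial>L) \<le> \<tau>" using n by (simp add: R_def)
    fix h :: real assume h: "0 \<le> h"
    have [measurable]: "X h \<in> borel_measurable M" using h by simp
    let ?A = "\<lambda>j. {\<omega> \<in> space M. R \<le> \<bar>X h \<omega> $ j\<bar>}"
    have "(\<integral>\<omega>. indicator (outside R) (X h \<omega>) \<partial>M) = (\<integral>\<omega>. indicator (X h -` outside R \<inter> space M) \<omega> \<partial>M :: real)"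
      by (intro Bochner_Integration.integral_cong) (auto split: split_indicator)
    also have "\<dots> = prob (X h -` outside R \<inter> space M)" by simp
    also have "\<dots> \<le> prob (?A 1 \<union> ?A 2)"
      by (intro finite_measure_mono) (auto simp: outside_def)
    also have "\<dots> \<le> prob (?A 1) + prob (?A 2)" by (intro measure_Un_le) auto
    also have "\<dots> \<le> h * (\<tau> / 2) + h * (\<tau> / 2)" using n by (intro add_mono R0 h) (simp_all add: R_def)
    finally show "(\<integral>\<omega>. indicator (outside R) (X h \<omega>) \<partial>M) \<le> h * \<tau>" by (simp add: mult.commute)
  qed
qed

lemma S_diag_nonneg: "0 \<le> S $ j $ j"
proof -
  have "0 \<le> axis j 1 \<bullet> (S *v axis j 1)" using triplet by (simp add: levy_triplet_def)
  moreover have "(S *v axis j 1) $ j = S $ j $ j"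
    unfolding matrix_vector_mult_def by (simp add: axis_def if_distrib cong: if_cong)
  ultimately show ?thesis by (simp add: inner_axis')
qed

text \<open>Such an \<open>r\<close> is approximated by the weight times a trigonometric polynomial
  \<open>q\<close> with q 0 close to 0. The smallness of q 0 suppresses the Gaussian atom in the
  limit of \<open>generator_weight\<close>, which leaves the integral over \<open>L\<close>; outside
  a large square there is little mass.\<close>

lemma generator_little_square:
  fixes r :: "real^2 \<Rightarrow> real"
  assumes cont: "continuous_on UNIV r" and B: "\<And>z. \<bar>r z\<bar> \<le> B" and small: "little_square r"
  shows "integrable L r" and "((\<lambda>h. (\<integral>\<omega>. r (X h \<omega>) \<partial>M) / h) \<longlongrightarrow> (\<integral>z. r z \<partial>L)) (at_right 0)"
proof -
  have rm[measurable]: "r \<in> borel_measurable borel" by (rule borel_measurable_continuous_onI[OF cont])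
  show intr: "integrable L r"
    by (rule integrable_L_little_square[OF rm B]) (use small[unfolded little_square_def, rule_format, of 1] in simp)
  have B0: "0 \<le> B" using B[of 0] by linarith
  show "((\<lambda>h. (\<integral>\<omega>. r (X h \<omega>) \<partial>M) / h) \<longlongrightarrow> (\<integral>z. r z \<partial>L)) (at_right 0)"
  proof (rule tendstoI)
    fix e :: real assume e: "0 < e"
    \<comment> \<open>Five errors of at most e / 8: the outside of the square enters twice, for X_h
      and for \<open>L\<close>, through (2 B + 2) \<tau>; the approximation inside enters twice, for
      \<open>L\<close> together with the atom, through d (\<kappa> + m + 1); the convergence for
      \<open>q\<close> enters once.\<close>
    define \<tau> where "\<tau> = e / (8 * (2 * B + 2))"
    have \<tau>: "0 < \<tau>" using e B0 by (simp add: \<tau>_def)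
    have \<tau>e: "(2 * B + 2) * \<tau> = e / 8" using B0 by (simp add: \<tau>_def field_simps)
    obtain R where R: "0 < R" "integrable L (indicator (outside R) :: _ \<Rightarrow> real)" "(\<integral>z. indicator (outside R) z \<partial>L) \<le> \<tau>"
      "\<And>h. 0 \<le> h \<Longrightarrow> (\<integral>\<omega>. indicator (outside R) (X h \<omega>) \<partial>M) \<le> h * \<tau>"
      using ex_outside_small[OF \<tau>] by blast
    define a where "a = pi / (2 * R)"
    let ?w = "weight a"
    define \<kappa> where "\<kappa> = a\<^sup>2 * (S $ 1 $ 1 + S $ 2 $ 2)"
    have \<kappa>: "0 \<le> \<kappa>" by (simp add: \<kappa>_def S_diag_nonneg)
    have intw: "integrable L ?w"
      and limw: "((\<lambda>h. (\<integral>\<omega>. ?w (X h \<omega>) \<partial>M) / h) \<longlongrightarrow> \<kappa> + (\<integral>z. ?w z \<partial>L)) (at_right 0)"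
      using generator_weight_real[of "\<lambda>_. 1" a] trig_polynomial_const[of 1] by (simp_all add: \<kappa>_def)
    define m where "m = (\<integral>z. ?w z \<partial>L)"
    have m: "0 \<le> m" unfolding m_def by (intro integral_nonneg_AE) (simp add: weight_bounds)
    define d where "d = min 1 (e / (8 * (\<kappa> + m + 1)))"
    have d: "0 < d" "d \<le> 1" using e \<kappa> m by (simp_all add: d_def)
    have de: "d * (\<kappa> + m + 1) \<le> e / 8"
    proof -
      have "d \<le> e / 8 / (\<kappa> + m + 1)" by (simp add: d_def)
      then show ?thesis using \<kappa> m by (subst (asm) pos_le_divide_eq) simp_all
    qed
    obtain q where q: "trig_polynomial (\<lambda>z. complex_of_real (q z))" and q0: "\<bar>q 0\<bar> \<le> d"
      and qin: "\<And>z. \<bar>z $ 1\<bar> \<le> R \<Longrightarrow> \<bar>z $ 2\<bar> \<le> R \<Longrightarrow> \<bar>r z - ?w z * q z\<bar> \<le> d * ?w z"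
      and qall: "\<And>z. \<bar>r z - ?w z * q z\<bar> \<le> 2 * B + 2 * d"
      using trig_polynomial_approx[OF cont B small R(1) d(1)] unfolding a_def weight_def by auto
    have [measurable]: "q \<in> borel_measurable borel"
      using measurable_compose[OF trig_polynomial_measurable[OF q] borel_measurable_Re] by simp
    note G = generator_weight_real[OF q, of a, folded \<kappa>_def]
    have bound: "\<bar>r z - ?w z * q z\<bar> \<le> d * ?w z + (2 * B + 2) * indicator (outside R) z" for z
    proof (cases "z \<in> outside R")
      case True
      have "0 \<le> d * ?w z" using d weight_bounds[of a z] by simp
      moreover have "\<bar>r z - ?w z * q z\<bar> \<le> 2 * B + 2" using qall[of z] d by linarith
      ultimately show ?thesis using True by simp
    next
      case False
      then show ?thesis using qin[of z] by (simp add: outside_def not_less)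
    qed
    have LL: "\<bar>(\<integral>z. r z \<partial>L) - (\<integral>z. ?w z * q z \<partial>L)\<bar> \<le> d * m + (2 * B + 2) * \<tau>"
    proof -
      have "\<bar>(\<integral>z. r z \<partial>L) - (\<integral>z. ?w z * q z \<partial>L)\<bar> = \<bar>\<integral>z. r z - ?w z * q z \<partial>L\<bar>"
        using intr G(1) by simp
      also have "\<dots> \<le> (\<integral>z. \<bar>r z - ?w z * q z\<bar> \<partial>L)" by (rule integral_abs_bound)
      also have "\<dots> \<le> (\<integral>z. d * ?w z + (2 * B + 2) * indicator (outside R) z \<partial>L)"
        using intr G(1) intw R(2) by (intro integral_mono) (auto intro!: bound)
      also have "\<dots> = d * m + (2 * B + 2) * (\<integral>z. indicator (outside R) z \<partial>L)"
        using intw R(2) by (simp add: m_def)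
      also have "\<dots> \<le> d * m + (2 * B + 2) * \<tau>" using R(3) B0 by (intro add_left_mono mult_left_mono) auto
      finally show ?thesis .
    qed
    have XX: "\<bar>(\<integral>\<omega>. r (X h \<omega>) \<partial>M) / h - (\<integral>\<omega>. ?w (X h \<omega>) * q (X h \<omega>) \<partial>M) / h\<bar>
        \<le> d * ((\<integral>\<omega>. ?w (X h \<omega>) \<partial>M) / h) + (2 * B + 2) * \<tau>" if h: "0 < h" for h
    proof -
      have h': "0 \<le> h" using h by simp
      obtain C where C: "\<And>z. norm (complex_of_real (q z)) \<le> C" using trig_polynomial_bounded[OF q] by blast
      have i1: "integrable M (\<lambda>\<omega>. r (X h \<omega>))" by (rule integrable_bounded_X[of r B]) (use B h' in auto)
      have i2: "integrable M (\<lambda>\<omega>. ?w (X h \<omega>) * q (X h \<omega>))"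
      proof (rule integrable_bounded_X[of "\<lambda>z. ?w z * q z" "2 * C"])
        show "norm (?w z * q z) \<le> 2 * C" for z
          using C[of z] weight_bounds[of a z] by (auto simp: abs_mult intro!: mult_mono)
      qed (use h' in measurable)
      have i3: "integrable M (\<lambda>\<omega>. ?w (X h \<omega>))"
        by (rule integrable_bounded_X[of ?w 2]) (use h' weight_bounds in auto)
      have i4: "integrable M (\<lambda>\<omega>. indicator (outside R) (X h \<omega>) :: real)"
        by (rule integrable_bounded_X[of "indicator (outside R)" 1]) (use h' in auto)
      have "\<bar>(\<integral>\<omega>. r (X h \<omega>) \<partial>M) - (\<integral>\<omega>. ?w (X h \<omega>) * q (X h \<omega>) \<partial>M)\<bar> = \<bar>\<integral>\<omega>. r (X h \<omega>) - ?w (X h \<omega>) * q (X h \<omega>) \<partial>M\<bar>"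
        using i1 i2 by simp
      also have "\<dots> \<le> (\<integral>\<omega>. \<bar>r (X h \<omega>) - ?w (X h \<omega>) * q (X h \<omega>)\<bar> \<partial>M)" by (rule integral_abs_bound)
      also have "\<dots> \<le> (\<integral>\<omega>. d * ?w (X h \<omega>) + (2 * B + 2) * indicator (outside R) (X h \<omega>) \<partial>M)"
        using i1 i2 i3 i4 by (intro integral_mono) (auto intro!: bound)
      also have "\<dots> = d * (\<integral>\<omega>. ?w (X h \<omega>) \<partial>M) + (2 * B + 2) * (\<integral>\<omega>. indicator (outside R) (X h \<omega>) \<partial>M)"
        using i3 i4 by simp
      also have "\<dots> \<le> d * (\<integral>\<omega>. ?w (X h \<omega>) \<partial>M) + (2 * B + 2) * (h * \<tau>)"
        using R(4)[OF h'] B0 by (intro add_left_mono mult_left_mono) auto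
      finally have "\<bar>(\<integral>\<omega>. r (X h \<omega>) \<partial>M) - (\<integral>\<omega>. ?w (X h \<omega>) * q (X h \<omega>) \<partial>M)\<bar> / h
          \<le> (d * (\<integral>\<omega>. ?w (X h \<omega>) \<partial>M) + (2 * B + 2) * (h * \<tau>)) / h"
        using h by (intro divide_right_mono) auto
      then show ?thesis using h by (simp add: diff_divide_distrib[symmetric] abs_divide add_divide_distrib)
    qed
    have "\<forall>\<^sub>F h in at_right 0. dist ((\<integral>\<omega>. ?w (X h \<omega>) * q (X h \<omega>) \<partial>M) / h) (\<kappa> * q 0 + (\<integral>z. ?w z * q z \<partial>L)) < e / 8"
      using tendstoD[OF G(2), of "e / 8"] e by simp
    moreover have "\<forall>\<^sub>F h in at_right 0. (\<integral>\<omega>. ?w (X h \<omega>) \<partial>M) / h < \<kappa> + m + 1"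
      using order_tendstoD(2)[OF limw, of "\<kappa> + m + 1"] by (simp add: m_def)
    moreover have "\<forall>\<^sub>F h in at_right (0::real). 0 < h" by (simp add: eventually_at_filter)
    ultimately show "\<forall>\<^sub>F h in at_right 0. dist ((\<integral>\<omega>. r (X h \<omega>) \<partial>M) / h) (\<integral>z. r z \<partial>L) < e"
    proof eventually_elim
      case (elim h)
      have "\<bar>\<kappa> * q 0\<bar> \<le> \<kappa> * d" using q0 \<kappa> by (simp add: abs_mult mult_left_mono)
      moreover have "d * ((\<integral>\<omega>. ?w (X h \<omega>) \<partial>M) / h) \<le> d * (\<kappa> + m + 1)"
        using elim(2) d by (intro mult_left_mono) auto
      moreover have "\<kappa> * d + d * m \<le> d * (\<kappa> + m + 1)" using d by (simp add: algebra_simps)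
      ultimately show ?case
        using XX[OF elim(3)] LL elim(1) de e unfolding \<tau>e dist_real_def by linarith
    qed
  qed
qed

end

section \<open>The generator on functions of \<open>first_integral\<close>\<close>

context bivariate_levy
begin

lemma Im_\<Psi>: "integrable L (\<lambda>z. sin (z \<bullet> \<theta>) - (z \<bullet> \<theta>) * (if norm z \<le> 1 then 1 else 0))"
    "Im (\<Psi> \<theta>) = g \<bullet> \<theta> + (\<integral>z. sin (z \<bullet> \<theta>) - (z \<bullet> \<theta>) * (if norm z \<le> 1 then 1 else 0) \<partial>L)"
proof -
  have eq: "Im (compensated \<theta> z) = sin (z \<bullet> \<theta>) - (z \<bullet> \<theta>) * (if norm z \<le> 1 then 1 else 0)" for z
    by (simp add: compensated_def)
  from integrable_Im[OF integrable_compensated[of \<theta>]]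
  show "integrable L (\<lambda>z. sin (z \<bullet> \<theta>) - (z \<bullet> \<theta>) * (if norm z \<le> 1 then 1 else 0))" unfolding eq .
  from integral_Im[OF integrable_compensated[of \<theta>]]
  show "Im (\<Psi> \<theta>) = g \<bullet> \<theta> + (\<integral>z. sin (z \<bullet> \<theta>) - (z \<bullet> \<theta>) * (if norm z \<le> 1 then 1 else 0) \<partial>L)"
    unfolding \<Psi>_eq by (simp add: eq)
qed

lemma Re_\<Psi>: "integrable L (\<lambda>z. 1 - cos (z \<bullet> \<theta>))"
    "Re (\<Psi> \<theta>) = - (\<theta> \<bullet> (S *v \<theta>)) / 2 - (\<integral>z. 1 - cos (z \<bullet> \<theta>) \<partial>L)"
proof -
  have eq: "- Re (compensated \<theta> z) = 1 - cos (z \<bullet> \<theta>)" for z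
    by (simp add: compensated_def)
  from Bochner_Integration.integrable_minus[OF integrable_Re[OF integrable_compensated[of \<theta>]]]
  show "integrable L (\<lambda>z. 1 - cos (z \<bullet> \<theta>))" unfolding eq .
  have "(\<integral>z. 1 - cos (z \<bullet> \<theta>) \<partial>L) = - Re (\<integral>z. compensated \<theta> z \<partial>L)"
    unfolding eq[symmetric] using integral_Re[OF integrable_compensated[of \<theta>]] by simp
  then show "Re (\<Psi> \<theta>) = - (\<theta> \<bullet> (S *v \<theta>)) / 2 - (\<integral>z. 1 - cos (z \<bullet> \<theta>) \<partial>L)"
    unfolding \<Psi>_eq by simp
qed

lemma integrable_L_sin_sq: "integrable L (\<lambda>z. (sin (z $ j))\<^sup>2)"
  using integrable_Re[OF integrable_L_sin_sq_cis[of 1 j 0]] by simp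

lemma generator_sin_sq:
  "((\<lambda>h. (\<integral>\<omega>. (sin (X h \<omega> $ j))\<^sup>2 \<partial>M) / h) \<longlongrightarrow> S $ j $ j + (\<integral>z. (sin (z $ j))\<^sup>2 \<partial>L)) (at_right 0)"
proof -
  have "((\<lambda>h. complex_of_real ((\<integral>\<omega>. (sin (X h \<omega> $ j))\<^sup>2 \<partial>M) / h)) \<longlongrightarrow>
      complex_of_real (S $ j $ j + (\<integral>z. (sin (z $ j))\<^sup>2 \<partial>L))) (at_right 0)"
    using generator_sin_sq_cis[of 1 j 0]
    unfolding inner_zero_left cis_zero mult_1_right mult_1 integral_complex_of_real by simp
  then show ?thesis by (rule tendsto_of_real_iff[THEN iffD1])
qed

lemma generator_sin:
  "((\<lambda>h. (\<integral>\<omega>. sin (\<theta> \<bullet> X h \<omega>) \<partial>M) / h) \<longlongrightarrow> Im (\<Psi> \<theta>)) (at_right 0)"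
proof (rule Lim_transform_eventually[OF tendsto_Im[OF generator_cis]])
  have "Im (((\<integral>\<omega>. cis (\<theta> \<bullet> X h \<omega>) \<partial>M) - 1) / complex_of_real h) = (\<integral>\<omega>. sin (\<theta> \<bullet> X h \<omega>) \<partial>M) / h" if "0 < h" for h
    using that Re_expectation_cis(2)[of "\<lambda>\<omega>. \<theta> \<bullet> X h \<omega>"] by (simp add: Im_divide_of_real)
  then show "\<forall>\<^sub>F h in at_right 0. Im (((\<integral>\<omega>. cis (\<theta> \<bullet> X h \<omega>) \<partial>M) - 1) / complex_of_real h) = (\<integral>\<omega>. sin (\<theta> \<bullet> X h \<omega>) \<partial>M) / h"
    by (simp add: eventually_at_filter)
qed

lemma generator_cos:
  "((\<lambda>h. (\<integral>\<omega>. 1 - cos (\<theta> \<bullet> X h \<omega>) \<partial>M) / h) \<longlongrightarrow> - Re (\<Psi> \<theta>)) (at_right 0)"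
proof (rule Lim_transform_eventually[OF tendsto_minus[OF tendsto_Re[OF generator_cis]]])
  have "- Re (((\<integral>\<omega>. cis (\<theta> \<bullet> X h \<omega>) \<partial>M) - 1) / complex_of_real h) = (\<integral>\<omega>. 1 - cos (\<theta> \<bullet> X h \<omega>) \<partial>M) / h" if h: "0 < h" for h
  proof -
    have "integrable M (\<lambda>\<omega>. cos (\<theta> \<bullet> X h \<omega>))"
      by (rule integrable_bounded_X[of "\<lambda>z. cos (\<theta> \<bullet> z)" 1]) (use h in auto)
    then show ?thesis
      using h Re_expectation_cis(1)[of "\<lambda>\<omega>. \<theta> \<bullet> X h \<omega>"]
      by (simp add: Re_divide_of_real prob_space minus_divide_left)
  qed
  then show "\<forall>\<^sub>F h in at_right 0. - Re (((\<integral>\<omega>. cis (\<theta> \<bullet> X h \<omega>) \<partial>M) - 1) / complex_of_real h) = (\<integral>\<omega>. 1 - cos (\<theta> \<bullet> X h \<omega>) \<partial>M) / h"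
    by (simp add: eventually_at_filter)
qed

text \<open>The limit is the generator of \<open>X\<close> at 0 applied to F composed with
  \<open>first_integral k\<close>: \<alpha> and 2 \<beta> stand for the first two derivatives of F
  at 0, \<open>gradient k\<close> is the first derivative of the inner function, and
  \<open>k\<close> its second derivative in x. The remainder \<open>r\<close> falls under
  \<open>generator_little_square\<close>; the trigonometric terms have explicit limits.\<close>

lemma generator_first_integral:
  assumes cont: "continuous_on UNIV F" and B: "\<And>w. \<bar>F w\<bar> \<le> B"
    and F: "little_square (\<lambda>w. F w - \<alpha> * w - \<beta> * w\<^sup>2)"
  shows "integrable L (\<lambda>z. F (first_integral k z) - \<alpha> * (z \<bullet> gradient k) * (if norm z \<le> 1 then 1 else 0))"
    and "((\<lambda>h. (\<integral>\<omega>. F (first_integral k (X h \<omega>)) \<partial>M) / h) \<longlongrightarrow>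
      \<alpha> * (g \<bullet> gradient k + k * S $ 1 $ 1 / 2) + \<beta> * (gradient k \<bullet> (S *v gradient k)) +
      (\<integral>z. F (first_integral k z) - \<alpha> * (z \<bullet> gradient k) * (if norm z \<le> 1 then 1 else 0) \<partial>L)) (at_right 0)"
proof -
  let ?\<theta> = "gradient k" and ?p = "first_integral k"
  let ?f1 = "\<lambda>z. sin (z \<bullet> ?\<theta>) - (z \<bullet> ?\<theta>) * (if norm z \<le> 1 then 1 else 0)"
  let ?f2 = "\<lambda>z::real^2. (sin (z $ 1))\<^sup>2"
  let ?f3 = "\<lambda>z. 1 - cos (z \<bullet> (2 *\<^sub>R ?\<theta>))"
  define r where "r = (\<lambda>z. F (?p z) - \<alpha> * sin (?\<theta> \<bullet> z) - \<alpha> * k / 2 * (sin (z $ 1))\<^sup>2 - \<beta> * (sin (?\<theta> \<bullet> z))\<^sup>2)"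
  have small: "little_square r" unfolding r_def by (rule little_square_first_integral[OF F])
  have contr: "continuous_on UNIV r"
    unfolding r_def
    by (intro continuous_intros continuous_on_compose2[OF cont first_integral_continuous]) auto
  have Br: "\<bar>r z\<bar> \<le> B + \<bar>\<alpha>\<bar> + \<bar>\<alpha> * k / 2\<bar> + \<bar>\<beta>\<bar>" for z
  proof -
    have s: "\<bar>c * s\<bar> \<le> \<bar>c\<bar>" if "\<bar>s\<bar> \<le> 1" for c s :: real
      using that by (simp add: abs_mult mult_left_le)
    have "\<bar>\<alpha> * sin (?\<theta> \<bullet> z)\<bar> \<le> \<bar>\<alpha>\<bar>" "\<bar>\<alpha> * k / 2 * (sin (z $ 1))\<^sup>2\<bar> \<le> \<bar>\<alpha> * k / 2\<bar>" "\<bar>\<beta> * (sin (?\<theta> \<bullet> z))\<^sup>2\<bar> \<le> \<bar>\<beta>\<bar>"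
      by (intro s; simp add: abs_square_le_1)+
    then show ?thesis using B[of "?p z"] unfolding r_def by linarith
  qed
  note R = generator_little_square[OF contr Br small]
  \<comment> \<open>Rewriting sin^2 by a cosine at the doubled frequency brings it under the real
    part of \<Psi>.\<close>
  have sin2: "(sin (?\<theta> \<bullet> z))\<^sup>2 = ?f3 z / 2" for z
    by (simp add: inner_commute[of z] cos_double_sin)
  have pt: "F (?p z) - \<alpha> * (z \<bullet> ?\<theta>) * (if norm z \<le> 1 then 1 else 0)
      = r z + \<alpha> * ?f1 z + \<alpha> * k / 2 * ?f2 z + \<beta> / 2 * ?f3 z" for z
    unfolding r_def sin2 by (simp add: inner_commute[of z] field_simps)
  have int: "integrable L r" "integrable L ?f1" "integrable L ?f2" "integrable L ?f3"
    by (rule R(1) Im_\<Psi>(1) integrable_L_sin_sq Re_\<Psi>(1))+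
  show "integrable L (\<lambda>z. F (?p z) - \<alpha> * (z \<bullet> ?\<theta>) * (if norm z \<le> 1 then 1 else 0))"
    unfolding pt by (intro Bochner_Integration.integrable_add integrable_mult_right int)
  have I: "(\<integral>z. F (?p z) - \<alpha> * (z \<bullet> ?\<theta>) * (if norm z \<le> 1 then 1 else 0) \<partial>L)
    = (\<integral>z. r z \<partial>L) + \<alpha> * (\<integral>z. ?f1 z \<partial>L) + \<alpha> * k / 2 * (\<integral>z. ?f2 z \<partial>L) + \<beta> / 2 * (\<integral>z. ?f3 z \<partial>L)"
    unfolding pt using int by (simp del: inner_scaleR_right)
  have "((\<lambda>h. (\<integral>\<omega>. r (X h \<omega>) \<partial>M) / h + \<alpha> * ((\<integral>\<omega>. sin (?\<theta> \<bullet> X h \<omega>) \<partial>M) / h)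
      + \<alpha> * k / 2 * ((\<integral>\<omega>. (sin (X h \<omega> $ 1))\<^sup>2 \<partial>M) / h)
      + \<beta> / 2 * ((\<integral>\<omega>. 1 - cos ((2 *\<^sub>R ?\<theta>) \<bullet> X h \<omega>) \<partial>M) / h)) \<longlongrightarrow>
     (\<integral>z. r z \<partial>L) + \<alpha> * Im (\<Psi> ?\<theta>) + \<alpha> * k / 2 * (S $ 1 $ 1 + (\<integral>z. ?f2 z \<partial>L)) + \<beta> / 2 * (- Re (\<Psi> (2 *\<^sub>R ?\<theta>)))) (at_right 0)"
    by (intro tendsto_add tendsto_mult_left R(2) generator_sin generator_sin_sq generator_cos)
  then have "((\<lambda>h. (\<integral>\<omega>. F (?p (X h \<omega>)) \<partial>M) / h) \<longlongrightarrow>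
     (\<integral>z. r z \<partial>L) + \<alpha> * Im (\<Psi> ?\<theta>) + \<alpha> * k / 2 * (S $ 1 $ 1 + (\<integral>z. ?f2 z \<partial>L)) + \<beta> / 2 * (- Re (\<Psi> (2 *\<^sub>R ?\<theta>)))) (at_right 0)"
  proof (rule Lim_transform_eventually)
    have "(\<integral>\<omega>. r (X h \<omega>) \<partial>M) / h + \<alpha> * ((\<integral>\<omega>. sin (?\<theta> \<bullet> X h \<omega>) \<partial>M) / h)
      + \<alpha> * k / 2 * ((\<integral>\<omega>. (sin (X h \<omega> $ 1))\<^sup>2 \<partial>M) / h)
      + \<beta> / 2 * ((\<integral>\<omega>. 1 - cos ((2 *\<^sub>R ?\<theta>) \<bullet> X h \<omega>) \<partial>M) / h) = (\<integral>\<omega>. F (?p (X h \<omega>)) \<partial>M) / h" if h: "0 < h" for h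
    proof -
      have i: "integrable M (\<lambda>\<omega>. r (X h \<omega>))" "integrable M (\<lambda>\<omega>. sin (?\<theta> \<bullet> X h \<omega>))"
        "integrable M (\<lambda>\<omega>. (sin (X h \<omega> $ 1))\<^sup>2)" "integrable M (\<lambda>\<omega>. 1 - cos ((2 *\<^sub>R ?\<theta>) \<bullet> X h \<omega>))"
      proof -
        show "integrable M (\<lambda>\<omega>. r (X h \<omega>))"
          by (rule integrable_bounded_X) (use Br h borel_measurable_continuous_onI[OF contr] in auto)
        show "integrable M (\<lambda>\<omega>. sin (?\<theta> \<bullet> X h \<omega>))"
          by (rule integrable_bounded_X[of "\<lambda>z. sin (?\<theta> \<bullet> z)" 1]) (use h in auto)
        show "integrable M (\<lambda>\<omega>. (sin (X h \<omega> $ 1))\<^sup>2)"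
          by (rule integrable_bounded_X[of "\<lambda>z. (sin (z $ 1))\<^sup>2" 1]) (use h in \<open>auto simp: abs_square_le_1\<close>)
        show "integrable M (\<lambda>\<omega>. 1 - cos ((2 *\<^sub>R ?\<theta>) \<bullet> X h \<omega>))"
        proof (rule integrable_bounded_X[of "\<lambda>z. 1 - cos ((2 *\<^sub>R ?\<theta>) \<bullet> z)" 2])
          show "norm (1 - cos ((2 *\<^sub>R ?\<theta>) \<bullet> z)) \<le> 2" for z
            using norm_triangle_ineq4[of 1 "cos ((2 *\<^sub>R ?\<theta>) \<bullet> z)"] abs_cos_le_one[of "(2 *\<^sub>R ?\<theta>) \<bullet> z"] by simp
        qed (use h in auto)
      qed
      have F: "F (?p z) = r z + \<alpha> * sin (?\<theta> \<bullet> z) + \<alpha> * k / 2 * (sin (z $ 1))\<^sup>2 + \<beta> / 2 * (1 - cos ((2 *\<^sub>R ?\<theta>) \<bullet> z))" for z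
        using sin2[of z] unfolding r_def inner_commute[of z "2 *\<^sub>R ?\<theta>"] by simp
      have "(\<integral>\<omega>. F (?p (X h \<omega>)) \<partial>M) = (\<integral>\<omega>. r (X h \<omega>) \<partial>M) + \<alpha> * (\<integral>\<omega>. sin (?\<theta> \<bullet> X h \<omega>) \<partial>M)
        + \<alpha> * k / 2 * (\<integral>\<omega>. (sin (X h \<omega> $ 1))\<^sup>2 \<partial>M) + \<beta> / 2 * (\<integral>\<omega>. 1 - cos ((2 *\<^sub>R ?\<theta>) \<bullet> X h \<omega>) \<partial>M)"
        unfolding F using i by (simp del: inner_scaleR_left)
      then show ?thesis using h by (simp only: add_divide_distrib times_divide_eq_right)
    qed
    then show "\<forall>\<^sub>F h in at_right 0. (\<integral>\<omega>. r (X h \<omega>) \<partial>M) / h + \<alpha> * ((\<integral>\<omega>. sin (?\<theta> \<bullet> X h \<omega>) \<partial>M) / h)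
      + \<alpha> * k / 2 * ((\<integral>\<omega>. (sin (X h \<omega> $ 1))\<^sup>2 \<partial>M) / h)
      + \<beta> / 2 * ((\<integral>\<omega>. 1 - cos ((2 *\<^sub>R ?\<theta>) \<bullet> X h \<omega>) \<partial>M) / h) = (\<integral>\<omega>. F (?p (X h \<omega>)) \<partial>M) / h"
      by (auto simp: eventually_at_filter)
  qed
  moreover have "- Re (\<Psi> (2 *\<^sub>R ?\<theta>)) = 2 * (?\<theta> \<bullet> (S *v ?\<theta>)) + (\<integral>z. ?f3 z \<partial>L)"
    unfolding Re_\<Psi>(2) by (simp add: scaleR_matrix_vector_assoc[symmetric] matrix_vector_mult_scaleR)
  ultimately show "((\<lambda>h. (\<integral>\<omega>. F (?p (X h \<omega>)) \<partial>M) / h) \<longlongrightarrow>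
      \<alpha> * (g \<bullet> ?\<theta> + k * S $ 1 $ 1 / 2) + \<beta> * (?\<theta> \<bullet> (S *v ?\<theta>)) +
      (\<integral>z. F (?p z) - \<alpha> * (z \<bullet> ?\<theta>) * (if norm z \<le> 1 then 1 else 0) \<partial>L)) (at_right 0)"
    unfolding I Im_\<Psi>(2) by (simp add: algebra_simps)
qed

end

subsection \<open>Increments and Riemann sums\<close>

text \<open>The left-endpoint sum for the integral of exp (-\<xi>) against \<eta>, as a function of
  the increments alone. Independence and stationarity of blocks of increments thus apply to it
  directly.\<close>

definition exp_riemann_sum :: "(nat \<Rightarrow> real^2) \<Rightarrow> nat \<Rightarrow> real" where
  "exp_riemann_sum d N = (\<Sum>i<N. exp (- (\<Sum>j<i. d j) $ 1) * d i $ 2)"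

text \<open>The discrete form of J_(T+s) = J_T + exp (-\<xi>_T) J'_s, where J' is built from the
  increments after T.\<close>

lemma exp_riemann_sum_add:
  "exp_riemann_sum d (N + N') = exp_riemann_sum d N + exp (- (\<Sum>j<N. d j) $ 1) * exp_riemann_sum (\<lambda>i. d (N + i)) N'"
proof -
  have split: "(\<Sum>i<N + N'. f i) = (\<Sum>i<N. f i) + (\<Sum>i<N'. f (N + i))" for f :: "nat \<Rightarrow> 'b::comm_monoid_add" and N'
    by (induction N') (simp_all add: ac_simps)
  show ?thesis
    unfolding exp_riemann_sum_def split
    by (simp add: sum_distrib_left exp_diff exp_minus divide_inverse mult.assoc)
qed

text \<open>Here 1 - exp (-S_N) telescopes into the sum of exp (-S_i) (1 - exp (-x_i)), where x_i is
  the first component of the increment and S_i the sum of the earlier ones.\<close>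

lemma exp_riemann_sum_first_integral:
  "exp_riemann_sum d N - k * (1 - exp (- (\<Sum>j<N. d j) $ 1))
    = (\<Sum>i<N. exp (- (\<Sum>j<i. d j) $ 1) * first_integral k (d i))"
proof (induction N)
  case 0
  then show ?case by (simp add: exp_riemann_sum_def)
next
  case (Suc N)
  have "exp (- (\<Sum>j<Suc N. d j) $ 1) = exp (- (\<Sum>j<N. d j) $ 1) * exp (- d N $ 1)"
    by (simp add: exp_add[symmetric])
  then have "exp_riemann_sum d (Suc N) - k * (1 - exp (- (\<Sum>j<Suc N. d j) $ 1))
    = (exp_riemann_sum d N - k * (1 - exp (- (\<Sum>j<N. d j) $ 1))) + exp (- (\<Sum>j<N. d j) $ 1) * first_integral k (d N)"
    by (simp only: exp_riemann_sum_def first_integral_def sum.lessThan_Suc) (simp add: algebra_simps)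
  with Suc show ?case by simp
qed

text \<open>For n \<ge> q the end time is a point of the grid of mesh 2^-n, so the truncations by
  \<open>min\<close> in \<open>riemann_sum\<close> never act.\<close>

lemma riemann_sum_dyadic:
  assumes "q \<le> n"
  shows "riemann_sum H Y n (real m / 2 ^ q) \<omega> =
    (\<Sum>i<m * 2 ^ (n - q). H (real i / 2 ^ n) \<omega> * (Y (real (Suc i) / 2 ^ n) \<omega> - Y (real i / 2 ^ n) \<omega>))"
proof -
  have eq: "real m / 2 ^ q = real (m * 2 ^ (n - q)) / 2 ^ n"
  proof -
    have "(2::real) ^ n = 2 ^ q * 2 ^ (n - q)" using assms by (simp add: power_add[symmetric])
    then show ?thesis by simp
  qed
  have "real m / 2 ^ q * 2 ^ n = real (m * 2 ^ (n - q))"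
    unfolding eq by simp
  then have c: "nat \<lceil>real m / 2 ^ q * 2 ^ n\<rceil> = m * 2 ^ (n - q)" by (simp only: ceiling_of_nat nat_int)
  show ?thesis
    unfolding riemann_sum_def c
  proof (intro sum.cong refl)
    fix i assume "i \<in> {..<m * 2 ^ (n - q)}"
    then have "Suc i \<le> m * 2 ^ (n - q)" by simp
    then have le: "real (Suc i) \<le> real (m * 2 ^ (n - q))" by (simp only: of_nat_le_iff)
    then have "real i \<le> real (m * 2 ^ (n - q))" by linarith
    with le show "H (real i / 2 ^ n) \<omega> * (Y (min (real (Suc i) / 2 ^ n) (real m / 2 ^ q)) \<omega> - Y (min (real i / 2 ^ n) (real m / 2 ^ q)) \<omega>)
        = H (real i / 2 ^ n) \<omega> * (Y (real (Suc i) / 2 ^ n) \<omega> - Y (real i / 2 ^ n) \<omega>)"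
      unfolding eq by (simp add: min_def divide_right_mono del: of_nat_Suc of_nat_mult)
  qed
qed

section \<open>Dyadic increments, absence of fixed jumps, localization\<close>

context bivariate_levy
begin

definition inc :: "nat \<Rightarrow> nat \<Rightarrow> 'a \<Rightarrow> real^2" where
  "inc n i \<omega> = X (real (Suc i) / 2 ^ n) \<omega> - X (real i / 2 ^ n) \<omega>"

lemma inc_measurable [measurable]: "inc n i \<in> borel_measurable M"
proof -
  have "X (real (Suc i) / 2 ^ n) \<in> borel_measurable M" "X (real i / 2 ^ n) \<in> borel_measurable M"
    by (rule X_measurable; simp)+
  then show ?thesis unfolding inc_def[abs_def] by (rule borel_measurable_diff)
qed

lemma indep_inc_shift: "indep_vars (\<lambda>_. borel) (\<lambda>i. inc n (m + i)) {..<N}"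
proof -
  have "\<forall>(ts::nat \<Rightarrow> real) n. 0 \<le> ts 0 \<and> (\<forall>i<n. ts i \<le> ts (Suc i)) \<longrightarrow>
      indep_vars (\<lambda>_. borel) (\<lambda>i \<omega>. X (ts (Suc i)) \<omega> - X (ts i) \<omega>) {..<n}"
    using levy unfolding levy_process_def by (elim conjE)
  from this[rule_format, of "\<lambda>i. real (m + i) / 2 ^ n" N]
  have "indep_vars (\<lambda>_. borel) (\<lambda>i \<omega>. X (real (m + Suc i) / 2 ^ n) \<omega> - X (real (m + i) / 2 ^ n) \<omega>) {..<N}"
    by (simp add: divide_right_mono)
  then show ?thesis by (simp add: inc_def[abs_def])
qed

lemma indep_inc: "indep_vars (\<lambda>_. borel) (inc n) {..<N}"
  using indep_inc_shift[of n 0 N] by simp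

lemma distr_increment:
  assumes "0 \<le> s" "s \<le> t"
  shows "distr M borel (\<lambda>\<omega>. X t \<omega> - X s \<omega>) = distr M borel (X (t - s))"
proof -
  have "\<forall>s t. 0 \<le> s \<and> 0 \<le> t \<longrightarrow> distr M borel (\<lambda>\<omega>. X (t + s) \<omega> - X s \<omega>) = distr M borel (X t)"
    using levy by (simp add: levy_process_def)
  from this[rule_format, of s "t - s"] show ?thesis using assms by simp
qed

lemma distr_inc: "distr M borel (inc n i) = distr M borel (X (1 / 2 ^ n))"
proof -
  have "real (Suc i) / 2 ^ n - real i / 2 ^ n = 1 / 2 ^ n" by (simp add: diff_divide_distrib[symmetric])
  then show ?thesis
    using distr_increment[of "real i / 2 ^ n" "real (Suc i) / 2 ^ n"]
    by (simp add: inc_def[abs_def] divide_right_mono)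
qed

lemma integral_increment:
  fixes f :: "real^2 \<Rightarrow> 'b::{banach, second_countable_topology}"
  assumes st: "0 \<le> s" "s \<le> t" and [measurable]: "f \<in> borel_measurable borel"
  shows "(\<integral>\<omega>. f (X t \<omega> - X s \<omega>) \<partial>M) = (\<integral>\<omega>. f (X (t - s) \<omega>) \<partial>M)"
proof -
  have [measurable]: "X t \<in> borel_measurable M" "X s \<in> borel_measurable M" "X (t - s) \<in> borel_measurable M"
    using st by simp_all
  have "(\<integral>\<omega>. f (X t \<omega> - X s \<omega>) \<partial>M) = (\<integral>z. f z \<partial>distr M borel (\<lambda>\<omega>. X t \<omega> - X s \<omega>))"
    by (subst integral_distr) simp_all
  also have "\<dots> = (\<integral>\<omega>. f (X (t - s) \<omega>) \<partial>M)"
    unfolding distr_increment[OF st] by (subst integral_distr) simp_all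
  finally show ?thesis .
qed

lemma integral_inc:
  fixes f :: "real^2 \<Rightarrow> 'b::{banach, second_countable_topology}"
  assumes [measurable]: "f \<in> borel_measurable borel"
  shows "(\<integral>\<omega>. f (inc n i \<omega>) \<partial>M) = (\<integral>\<omega>. f (X (1 / 2 ^ n) \<omega>) \<partial>M)"
proof -
  have [measurable]: "X (1 / 2 ^ n) \<in> borel_measurable M" by simp
  have "(\<integral>\<omega>. f (inc n i \<omega>) \<partial>M) = (\<integral>z. f z \<partial>distr M borel (inc n i))"
    by (subst integral_distr) simp_all
  also have "\<dots> = (\<integral>\<omega>. f (X (1 / 2 ^ n) \<omega>) \<partial>M)"
    unfolding distr_inc by (subst integral_distr) simp_all
  finally show ?thesis .
qed

lemma sum_inc: "i \<le> N \<Longrightarrow> (\<Sum>j\<in>{i..<N}. inc n j \<omega>) = X (real N / 2 ^ n) \<omega> - X (real i / 2 ^ n) \<omega>"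
proof (induction N)
  case (Suc N)
  show ?case
  proof (cases "i = Suc N")
    case False
    then show ?thesis using Suc by (simp add: inc_def)
  qed simp
qed simp

text \<open>One null set serves all grids: X 0 = 0 is the almost sure part, the rest telescopes
  pointwise.\<close>

lemma AE_X_eq_sum: "AE \<omega> in M. \<forall>n N. X (real N / 2 ^ n) \<omega> = (\<Sum>j<N. inc n j \<omega>)"
  using AE_X_0 by eventually_elim (use sum_inc[of 0] in \<open>simp add: lessThan_atLeast0\<close>)

lemma AE_cadlag: "AE \<omega> in M. cadlag (\<lambda>t. X t \<omega>)"
  using levy by (simp add: levy_process_def)

lemma left_lim_eqI: "0 < t \<Longrightarrow> (f \<longlongrightarrow> l) (at_left t) \<Longrightarrow> left_lim f t = l"
  unfolding left_lim_def by (simp add: tendsto_Lim)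

text \<open>There is almost surely no jump at a fixed time: the first component of the increment
  from \<open>s n\<close> to \<open>t\<close> has characteristic function exp ((t - s n) \<Psi>),
  restricted to the first axis, which tends to 1. So the jump has characteristic function 1.\<close>

lemma AE_left_lim:
  assumes t: "0 < t"
  shows "AE \<omega> in M. ((\<lambda>u. X u \<omega> $ 1) \<longlongrightarrow> X t \<omega> $ 1) (at_left t)"
proof -
  define s where "s = (\<lambda>n::nat. t - t / real (n + 2))"
  have s: "0 \<le> s n" "s n < t" for n
    using t by (simp_all add: s_def divide_le_eq mult_le_cancel_left1)
  have s_lim: "filterlim s (at_left t) sequentially"
    unfolding filterlim_at
  proof
    have "(\<lambda>n. t - t * inverse (real (n + 2))) \<longlonglongrightarrow> t - t * 0"
      by (intro tendsto_intros LIMSEQ_ignore_initial_segment[OF lim_inverse_n])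
    then show "s \<longlonglongrightarrow> t" by (simp add: s_def divide_inverse)
    show "\<forall>\<^sub>F x in sequentially. s x \<in> {..<t} \<and> s x \<noteq> t" using s by (auto simp: less_le)
  qed
  have [measurable]: "X t \<in> borel_measurable M" "\<And>n. X (s n) \<in> borel_measurable M" using s t by simp_all
  have left: "AE \<omega> in M. \<exists>l. ((\<lambda>u. X u \<omega> $ 1) \<longlongrightarrow> l) (at_left t)"
    using AE_cadlag
  proof eventually_elim
    case (elim \<omega>)
    then obtain l where "((\<lambda>t. X t \<omega>) \<longlongrightarrow> l) (at_left t)" using t unfolding cadlag_def by force
    from tendsto_vec_nth[OF this, of 1] show ?case by blast
  qed
  \<comment> \<open>\<open>lim\<close> yields a function that is measurable on the whole space and
    agrees with the jump wherever the left limit exists.\<close>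
  define V where "V = (\<lambda>\<omega>. X t \<omega> $ 1 - lim (\<lambda>n. X (s n) \<omega> $ 1))"
  have [measurable]: "V \<in> borel_measurable M" unfolding V_def by measurable
  have lim: "AE \<omega> in M. (\<lambda>n. X t \<omega> $ 1 - X (s n) \<omega> $ 1) \<longlonglongrightarrow> V \<omega>"
    using left
  proof eventually_elim
    case (elim \<omega>)
    then obtain l where "((\<lambda>u. X u \<omega> $ 1) \<longlongrightarrow> l) (at_left t)" by blast
    from filterlim_compose[OF this s_lim] have "(\<lambda>n. X (s n) \<omega> $ 1) \<longlonglongrightarrow> l" .
    then show ?case unfolding V_def by (auto intro!: tendsto_intros simp: limI)
  qed
  have "AE \<omega> in M. V \<omega> = 0"
  proof (rule AE_eq_0_if_expectation_cis)
    fix u :: real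
    let ?\<theta> = "axis 1 u :: real^2"
    have "(\<lambda>n. \<integral>\<omega>. cis (u * (X t \<omega> $ 1 - X (s n) \<omega> $ 1)) \<partial>M) \<longlonglongrightarrow> (\<integral>\<omega>. cis (u * V \<omega>) \<partial>M)"
    proof (rule integral_dominated_convergence[where w="\<lambda>_. 1"])
      show "AE \<omega> in M. (\<lambda>n. cis (u * (X t \<omega> $ 1 - X (s n) \<omega> $ 1))) \<longlonglongrightarrow> cis (u * V \<omega>)"
        using lim by eventually_elim (unfold cis_conv_exp, intro tendsto_intros)
    qed (auto simp: cis_conv_exp)
    moreover have "(\<integral>\<omega>. cis (u * (X t \<omega> $ 1 - X (s n) \<omega> $ 1)) \<partial>M) = exp (complex_of_real (t - s n) * \<Psi> ?\<theta>)" for n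
    proof -
      have "(\<integral>\<omega>. cis (?\<theta> \<bullet> (X t \<omega> - X (s n) \<omega>)) \<partial>M) = (\<integral>\<omega>. cis (?\<theta> \<bullet> X (t - s n) \<omega>) \<partial>M)"
        using s[of n] by (intro integral_increment) (auto simp: cis_conv_exp)
      also have "\<dots> = exp (complex_of_real (t - s n) * \<Psi> ?\<theta>)" using s[of n] by (intro expectation_cis_X) simp
      finally show ?thesis by (simp add: inner_axis')
    qed
    moreover have "(\<lambda>n. exp (complex_of_real (t - s n) * \<Psi> ?\<theta>)) \<longlonglongrightarrow> exp (complex_of_real (t - t) * \<Psi> ?\<theta>)"
      using s_lim unfolding filterlim_at by (intro tendsto_intros) auto
    ultimately show "(\<integral>\<omega>. cis (u * V \<omega>) \<partial>M) = 1"
      using LIMSEQ_unique by fastforce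
  qed simp
  with left lim show ?thesis
  proof eventually_elim
    case (elim \<omega>)
    then obtain l where l: "((\<lambda>u. X u \<omega> $ 1) \<longlongrightarrow> l) (at_left t)" by blast
    from filterlim_compose[OF this s_lim] have "(\<lambda>n. X t \<omega> $ 1 - X (s n) \<omega> $ 1) \<longlonglongrightarrow> X t \<omega> $ 1 - l"
      by (intro tendsto_intros)
    with elim have "X t \<omega> $ 1 - l = 0" using LIMSEQ_unique by metis
    with l show ?case by simp
  qed
qed

text \<open>At positive dyadic times left limits are values, as there are no fixed jumps. At 0 the
  convention f(0-) = 0 agrees with the empty sum.\<close>

lemma AE_left_lim_dyadic:
  "AE \<omega> in M. \<forall>n i. left_lim (\<lambda>u. X u \<omega> $ 1) (real i / 2 ^ n) = (\<Sum>j<i. inc n j \<omega>) $ 1"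
proof -
  have "AE \<omega> in M. \<forall>n i. 0 < i \<longrightarrow> ((\<lambda>u. X u \<omega> $ 1) \<longlongrightarrow> X (real i / 2 ^ n) \<omega> $ 1) (at_left (real i / 2 ^ n))"
    unfolding AE_all_countable
  proof (intro allI)
    fix n i :: nat
    show "AE \<omega> in M. 0 < i \<longrightarrow> ((\<lambda>u. X u \<omega> $ 1) \<longlongrightarrow> X (real i / 2 ^ n) \<omega> $ 1) (at_left (real i / 2 ^ n))"
      using AE_left_lim[of "real i / 2 ^ n"] by (cases "i = 0") auto
  qed
  with AE_X_eq_sum show ?thesis
  proof eventually_elim
    case (elim \<omega>)
    show ?case
    proof (intro allI)
      fix n i :: nat
      show "left_lim (\<lambda>u. X u \<omega> $ 1) (real i / 2 ^ n) = (\<Sum>j<i. inc n j \<omega>) $ 1"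
      proof (cases "i = 0")
        case True
        then show ?thesis by (simp add: left_lim_def)
      next
        case False
        then show ?thesis using elim left_lim_eqI[of "real i / 2 ^ n"] by simp
      qed
    qed
  qed
qed

lemma exp_riemann_sum_measurable [measurable]:
  "(\<lambda>\<omega>. exp_riemann_sum (\<lambda>i. inc n (m + i) \<omega>) N) \<in> borel_measurable M"
  "(\<lambda>\<omega>. exp_riemann_sum (\<lambda>i. inc n i \<omega>) N) \<in> borel_measurable M"
  unfolding exp_riemann_sum_def by measurable

text \<open>Truncating the integrand where the walk leaves \<open>[-K, K]\<close> changes the sum only on the event
  that it ever does.\<close>
lemma localized_char_bound:
  fixes H :: "real \<Rightarrow> real" and w :: "real^2 \<Rightarrow> real"
  assumes [measurable]: "H \<in> borel_measurable borel" "w \<in> borel_measurable borel" and K: "0 \<le> K"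
    and bd: "\<And>v. norm ((\<integral>\<omega>. cis (H v * w (X (1 / 2 ^ n) \<omega>)) \<partial>M) - 1) \<le> \<beta> v"
    and [measurable]: "\<beta> \<in> borel_measurable borel" and bK: "\<And>v. \<bar>v\<bar> \<le> K \<Longrightarrow> \<beta> v \<le> C"
  shows "norm ((\<integral>\<omega>. cis (\<Sum>i<N. H ((\<Sum>j<i. inc n j \<omega>) $ 1) * w (inc n i \<omega>)) \<partial>M) - 1)
    \<le> 2 * prob {\<omega> \<in> space M. \<exists>i\<le>N. K < \<bar>(\<Sum>j<i. inc n j \<omega>) $ 1\<bar>}
      + (\<Sum>i<N. \<integral>\<omega>. \<beta> ((\<Sum>j<i. inc n j \<omega>) $ 1) * indicator {-K..K} ((\<Sum>j<i. inc n j \<omega>) $ 1) \<partial>M)"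
proof -
  define HK where "HK = (\<lambda>x::real^2. H (x $ 1) * indicator {-K..K} (x $ 1))"
  have [measurable]: "HK \<in> borel_measurable borel" unfolding HK_def by measurable
  define S where "S = (\<lambda>i \<omega>. \<Sum>j<i. inc n j \<omega>)"
  have [measurable]: "S i \<in> borel_measurable M" for i unfolding S_def by measurable
  define A where "A = {\<omega> \<in> space M. \<exists>i\<le>N. K < \<bar>S i \<omega> $ 1\<bar>}"
  have [measurable]: "A \<in> events"
    unfolding A_def by measurable
  let ?f = "\<lambda>\<omega>. \<Sum>i<N. H (S i \<omega> $ 1) * w (inc n i \<omega>)" and ?g = "\<lambda>\<omega>. \<Sum>i<N. HK (S i \<omega>) * w (inc n i \<omega>)"
  have b0: "0 \<le> \<beta> v" for v using bd[of v] norm_ge_zero order_trans by blast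
  have "norm ((\<integral>\<omega>. cis (?f \<omega>) \<partial>M) - (\<integral>\<omega>. cis (?g \<omega>) \<partial>M)) \<le> 2 * prob A"
  proof -
    have i: "integrable M (\<lambda>\<omega>. cis (?f \<omega>))" "integrable M (\<lambda>\<omega>. cis (?g \<omega>))"
      by (rule integrable_cis, measurable)+
    have "norm ((\<integral>\<omega>. cis (?f \<omega>) \<partial>M) - (\<integral>\<omega>. cis (?g \<omega>) \<partial>M)) = norm (\<integral>\<omega>. cis (?f \<omega>) - cis (?g \<omega>) \<partial>M)"
      using i by simp
    also have "\<dots> \<le> (\<integral>\<omega>. norm (cis (?f \<omega>) - cis (?g \<omega>)) \<partial>M)" by (rule integral_norm_bound)
    also have "\<dots> \<le> (\<integral>\<omega>. 2 * indicator A \<omega> \<partial>M)"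
    proof (rule integral_mono)
      fix \<omega> assume w: "\<omega> \<in> space M"
      show "norm (cis (?f \<omega>) - cis (?g \<omega>)) \<le> 2 * indicator A \<omega>"
      proof (cases "\<omega> \<in> A")
        case True
        then show ?thesis using norm_triangle_ineq4[of "cis (?f \<omega>)" "cis (?g \<omega>)"] by simp
      next
        case False
        then have "\<forall>i\<le>N. \<bar>S i \<omega> $ 1\<bar> \<le> K" using w by (auto simp: A_def not_less)
        have "S i \<omega> $ 1 \<in> {-K..K}" if "i < N" for i
          using \<open>\<forall>i\<le>N. \<bar>S i \<omega> $ 1\<bar> \<le> K\<close>[rule_format, of i] that unfolding atLeastAtMost_iff by linarith
        then have "?f \<omega> = ?g \<omega>" by (intro sum.cong refl) (simp add: HK_def)
        then show ?thesis by simp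
      qed
    qed (use i in \<open>auto simp: less_top[symmetric]\<close>)
    finally show ?thesis by simp
  qed
  moreover have "norm ((\<integral>\<omega>. cis (?g \<omega>) \<partial>M) - 1) \<le> (\<Sum>i<N. \<integral>\<omega>. \<beta> (S i \<omega> $ 1) * indicator {-K..K} (S i \<omega> $ 1) \<partial>M)"
  proof -
    have "norm ((\<integral>\<omega>. cis (?g \<omega>) \<partial>M) - 1)
      \<le> (\<Sum>i<N. \<integral>\<omega>. norm ((\<integral>\<omega>'. cis (HK (S i \<omega>) * w (inc n i \<omega>')) \<partial>M) - 1) \<partial>M)"
      unfolding S_def by (rule norm_expectation_cis_sum_minus_1_le[OF indep_inc]) auto
    also have "\<dots> \<le> (\<Sum>i<N. \<integral>\<omega>. \<beta> (S i \<omega> $ 1) * indicator {-K..K} (S i \<omega> $ 1) \<partial>M)"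
    proof (intro sum_mono integral_mono')
      fix i
      show "integrable M (\<lambda>\<omega>. \<beta> (S i \<omega> $ 1) * indicator {-K..K} (S i \<omega> $ 1))"
      proof (rule integrable_const_bound[of _ "\<bar>C\<bar>"])
        show "AE \<omega> in M. norm (\<beta> (S i \<omega> $ 1) * indicator {-K..K} (S i \<omega> $ 1)) \<le> \<bar>C\<bar>"
        proof (rule AE_I2)
          fix \<omega>
          show "norm (\<beta> (S i \<omega> $ 1) * indicator {-K..K} (S i \<omega> $ 1)) \<le> \<bar>C\<bar>"
            using bK[of "S i \<omega> $ 1"] b0[of "S i \<omega> $ 1"] by (auto simp: indicator_def abs_le_iff)
        qed
      qed measurable
      fix \<omega>
      show "0 \<le> \<beta> (S i \<omega> $ 1) * indicator {-K..K} (S i \<omega> $ 1)" using b0 by simp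
      have "(\<integral>\<omega>'. cis (HK (S i \<omega>) * w (inc n i \<omega>')) \<partial>M) = (\<integral>\<omega>'. cis (HK (S i \<omega>) * w (X (1 / 2 ^ n) \<omega>')) \<partial>M)"
        by (rule integral_inc[of "\<lambda>z. cis (HK (S i \<omega>) * w z)"]) (simp add: cis_conv_exp)
      then show "norm ((\<integral>\<omega>'. cis (HK (S i \<omega>) * w (inc n i \<omega>')) \<partial>M) - 1) \<le> \<beta> (S i \<omega> $ 1) * indicator {-K..K} (S i \<omega> $ 1)"
        using bd[of "S i \<omega> $ 1"] by (auto simp: HK_def indicator_def prob_space)
    qed
    finally show ?thesis .
  qed
  ultimately show ?thesis
    using norm_triangle_ineq[of "(\<integral>\<omega>. cis (?f \<omega>) \<partial>M) - (\<integral>\<omega>. cis (?g \<omega>) \<partial>M)" "(\<integral>\<omega>. cis (?g \<omega>) \<partial>M) - 1"]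
    unfolding A_def S_def by simp
qed

text \<open>A sum of consecutive increments has the law of \<open>X\<close> at the elapsed time,
  which is at most N / 2^n. The linear tail bound therefore supplies both the probability 1/2 that
  \<open>Ottaviani\<close> asks for and the final estimate.\<close>

lemma maximal_inequality:
  assumes tail: "\<And>h. 0 \<le> h \<Longrightarrow> prob {\<omega> \<in> space M. r \<le> \<bar>X h \<omega> $ 1\<bar>} \<le> h * \<tau>"
    and \<tau>: "0 \<le> \<tau>" "real N / 2 ^ n * \<tau> \<le> 1 / 2"
  shows "prob {\<omega> \<in> space M. \<exists>i\<le>N. 2 * r \<le> \<bar>(\<Sum>j<i. inc n j \<omega>) $ 1\<bar>} \<le> 2 * (real N / 2 ^ n * \<tau>)"
proof -
  have tail': "prob {\<omega> \<in> space M. r \<le> \<bar>\<Sum>j\<in>{i..<N}. inc n j \<omega> $ 1\<bar>} \<le> real N / 2 ^ n * \<tau>" if i: "i \<le> N" for i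
  proof -
    let ?s = "real i / 2 ^ n" and ?t = "real N / 2 ^ n"
    have st: "0 \<le> ?s" "?s \<le> ?t" using i by (auto intro!: divide_right_mono)
    have [measurable]: "X ?t \<in> borel_measurable M" "X ?s \<in> borel_measurable M" "X (?t - ?s) \<in> borel_measurable M"
      by (rule X_measurable, use st in simp)+
    let ?A = "{z::real^2. r \<le> \<bar>z $ 1\<bar>}"
    have A: "?A \<in> sets borel" by measurable
    have "{\<omega> \<in> space M. r \<le> \<bar>\<Sum>j\<in>{i..<N}. inc n j \<omega> $ 1\<bar>} = (\<lambda>\<omega>. X ?t \<omega> - X ?s \<omega>) -` ?A \<inter> space M"
      using sum_inc[OF i] by (auto simp: sum_component[symmetric])
    then have "prob {\<omega> \<in> space M. r \<le> \<bar>\<Sum>j\<in>{i..<N}. inc n j \<omega> $ 1\<bar>} = measure (distr M borel (\<lambda>\<omega>. X ?t \<omega> - X ?s \<omega>)) ?A"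
      using A by (simp add: measure_distr)
    also have "\<dots> = prob (X (?t - ?s) -` ?A \<inter> space M)"
      unfolding distr_increment[OF st] using A by (simp add: measure_distr)
    also have "X (?t - ?s) -` ?A \<inter> space M = {\<omega> \<in> space M. r \<le> \<bar>X (?t - ?s) \<omega> $ 1\<bar>}" by auto
    also have "prob \<dots> \<le> (?t - ?s) * \<tau>" using st by (intro tail) simp
    also have "\<dots> \<le> ?t * \<tau>" using st \<tau> by (intro mult_right_mono) auto
    finally show ?thesis .
  qed
  have "indep_vars (\<lambda>_. borel) (\<lambda>i \<omega>. inc n i \<omega> $ 1) {..<N}"
    by (rule indep_vars_compose2[OF indep_inc]) simp
  then have "prob {\<omega> \<in> space M. \<exists>i\<le>N. 2 * r \<le> \<bar>\<Sum>j<i. inc n j \<omega> $ 1\<bar>} \<le> 2 * prob {\<omega> \<in> space M. r \<le> \<bar>\<Sum>j<N. inc n j \<omega> $ 1\<bar>}"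
    by (rule Ottaviani) (rule order_trans[OF tail' \<tau>(2)])
  also have "prob {\<omega> \<in> space M. r \<le> \<bar>\<Sum>j<N. inc n j \<omega> $ 1\<bar>} \<le> real N / 2 ^ n * \<tau>"
    using tail'[of 0] by (simp add: lessThan_atLeast0)
  finally show ?thesis by (simp add: sum_component)
qed

end

subsection \<open>The stochastic integral\<close>

text \<open>Subtracting i v sin w leaves an error controlled by w^2 / (1 + w^2), with
  \<open>v\<close> only in a polynomial factor. Two bounded test functions of w thus suffice: if the
  generator vanishes on both, the characteristic function of w at frequency v is 1 + o(h), locally
  uniformly in v.\<close>

lemma cis_approx_sin:
  "norm (cis (v * w) - 1 - \<i> * complex_of_real (v * sin w)) \<le> (4 + 2 * \<bar>v\<bar> + v\<^sup>2) * (w\<^sup>2 / (1 + w\<^sup>2))"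
proof (cases "\<bar>w\<bar> \<le> 1")
  case True
  have "w\<^sup>2 \<le> 1" using True by (simp add: abs_square_le_1)
  then have "w\<^sup>2 * (1 + w\<^sup>2) \<le> w\<^sup>2 * 2" by (intro mult_left_mono) auto
  then have half: "w\<^sup>2 / 2 \<le> w\<^sup>2 / (1 + w\<^sup>2)"
    by (simp add: divide_simps add_pos_nonneg mult.commute)
  have "cis (v * w) - 1 - \<i> * complex_of_real (v * sin w)
      = (cis (v * w) - 1 - \<i> * complex_of_real (v * w)) + \<i> * complex_of_real (v * (w - sin w))"
    by (simp add: algebra_simps)
  also have "norm \<dots> \<le> (v * w)\<^sup>2 / 2 + \<bar>v\<bar> * (w\<^sup>2 / 2)"
  proof (rule order_trans[OF norm_triangle_ineq add_mono])
    show "norm (cis (v * w) - 1 - \<i> * complex_of_real (v * w)) \<le> (v * w)\<^sup>2 / 2" by (rule norm_cis_approx2)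
    have "norm (\<i> * complex_of_real (v * (w - sin w))) = \<bar>v\<bar> * \<bar>sin w - w\<bar>"
      unfolding norm_mult norm_of_real by (simp add: abs_mult abs_minus_commute)
    also have "\<dots> \<le> \<bar>v\<bar> * (w\<^sup>2 / 2)" by (intro mult_left_mono abs_sin_minus_le) auto
    finally show "norm (\<i> * complex_of_real (v * (w - sin w))) \<le> \<bar>v\<bar> * (w\<^sup>2 / 2)" .
  qed
  also have "\<dots> = (v\<^sup>2 + \<bar>v\<bar>) * (w\<^sup>2 / 2)" by (simp add: power_mult_distrib algebra_simps)
  also have "\<dots> \<le> (4 + 2 * \<bar>v\<bar> + v\<^sup>2) * (w\<^sup>2 / (1 + w\<^sup>2))"
    using half by (intro mult_mono) auto
  finally show ?thesis .
next
  case False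
  then have "1 \<le> w\<^sup>2" using one_le_power[of "\<bar>w\<bar>" 2] by simp
  then have half: "1 / 2 \<le> w\<^sup>2 / (1 + w\<^sup>2)" by (simp add: divide_simps add_pos_nonneg)
  have "norm (cis (v * w) - 1 - \<i> * complex_of_real (v * sin w)) \<le> norm (cis (v * w) - 1) + norm (\<i> * complex_of_real (v * sin w))"
    by (rule norm_triangle_ineq4)
  also have "\<dots> \<le> 2 + \<bar>v\<bar>"
    using norm_cis_minus_1_le_2[of "v * w"] by (intro add_mono) (auto simp: norm_mult abs_mult mult_left_le)
  also have "\<dots> \<le> (4 + 2 * \<bar>v\<bar> + v\<^sup>2) * (1 / 2)" by (simp add: field_simps)
  also have "\<dots> \<le> (4 + 2 * \<bar>v\<bar> + v\<^sup>2) * (w\<^sup>2 / (1 + w\<^sup>2))"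
    using half by (intro mult_left_mono) auto
  finally show ?thesis .
qed

lemma eq_0_if_eq_0_on_dyadics:
  fixes f :: "real \<Rightarrow> real"
  assumes lim: "(f \<longlongrightarrow> f t) (at_right t)" and t: "0 \<le> t" and 0: "\<And>m q. 0 < m \<Longrightarrow> f (real m / 2 ^ q) = 0"
  shows "f t = 0"
proof -
  \<comment> \<open>The first dyadic of level n strictly above \<open>t\<close>: it approaches
    \<open>t\<close> from the right, and its numerator is positive even for t = 0.\<close>
  define d where "d = (\<lambda>n. real (Suc (nat \<lfloor>t * 2 ^ n\<rfloor>)) / 2 ^ n)"
  have b: "t < d n" "d n \<le> t + (1 / 2) ^ n" for n
  proof -
    have "0 \<le> t * 2 ^ n" using t by simp
    then have "t * 2 ^ n < real (Suc (nat \<lfloor>t * 2 ^ n\<rfloor>))" "real (Suc (nat \<lfloor>t * 2 ^ n\<rfloor>)) \<le> t * 2 ^ n + 1"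
      by linarith+
    then show "t < d n" "d n \<le> t + (1 / 2) ^ n"
      by (simp_all add: d_def divide_simps power_one_over del: of_nat_Suc)
  qed
  have "d \<longlonglongrightarrow> t"
  proof (rule tendsto_sandwich[of "\<lambda>_. t" d _ "\<lambda>n. t + (1 / 2) ^ n"])
    show "(\<lambda>n. t + (1 / 2) ^ n) \<longlonglongrightarrow> t"
      using tendsto_add[OF tendsto_const LIMSEQ_power_zero[of "1 / 2 :: real"], of t] by simp
  qed (use b in \<open>auto intro!: always_eventually less_imp_le\<close>)
  then have "filterlim d (at_right t) sequentially"
    unfolding filterlim_at
  proof (intro conjI)
    have "d n \<in> {t<..} \<and> d n \<noteq> t" for n using b(1)[of n] by simp
    then show "\<forall>\<^sub>F n in sequentially. d n \<in> {t<..} \<and> d n \<noteq> t" by simp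
  qed assumption
  from filterlim_compose[OF lim this] have "(\<lambda>n. f (d n)) \<longlonglongrightarrow> f t" .
  moreover have "f (d n) = 0" for n unfolding d_def by (rule 0) simp
  ultimately show ?thesis by (simp add: LIMSEQ_const_iff)
qed

lemma continuous_on_axis:
  assumes "continuous_on A f" shows "continuous_on A (\<lambda>x. axis j (f x) :: real^'n)"
proof -
  have eq: "(\<lambda>x. axis j (f x) :: real^'n) = (\<lambda>x. f x *\<^sub>R axis j 1)"
    by (auto simp: fun_eq_iff vec_eq_iff axis_def)
  show ?thesis unfolding eq by (intro continuous_on_scaleR assms continuous_on_const)
qed

locale levy_integral = bivariate_levy +
  fixes J :: "real \<Rightarrow> 'a \<Rightarrow> real"
  assumes J: "stoch_integral M (\<lambda>s \<omega>. exp (- left_lim (\<lambda>u. X u \<omega> $ 1) s)) (\<lambda>s \<omega>. X s \<omega> $ 2) J"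
begin

lemma J_measurable [measurable]: "0 \<le> t \<Longrightarrow> J t \<in> borel_measurable M"
  using J by (simp add: stoch_integral_def)

lemma AE_cadlag_J: "AE \<omega> in M. cadlag (\<lambda>t. J t \<omega>)"
  using J by (simp add: stoch_integral_def)

lemma J_conv: "0 \<le> t \<Longrightarrow> conv_in_prob M (\<lambda>n. riemann_sum (\<lambda>s \<omega>. exp (- left_lim (\<lambda>u. X u \<omega> $ 1) s)) (\<lambda>s \<omega>. X s \<omega> $ 2) n t) (J t)"
  using J by (simp add: stoch_integral_def)

lemma AE_J_0: "AE \<omega> in M. J 0 \<omega> = 0"
proof -
  have "conv_in_prob M (\<lambda>n \<omega>. 0) (J 0)"
    using J_conv[of 0] by (simp add: riemann_sum_def[abs_def])
  moreover have "conv_in_prob M (\<lambda>n \<omega>. 0) (\<lambda>\<omega>. 0)"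
    by (rule AE_tendsto_0_imp_conv_in_prob) auto
  ultimately show ?thesis by (intro conv_in_prob_unique) auto
qed

text \<open>Once the grid is fine enough to contain the end time, the left limits in the Riemann
  sums are almost surely partial sums of increments.\<close>

lemma J_conv_dyadic:
  "conv_in_prob M (\<lambda>n \<omega>. exp_riemann_sum (\<lambda>i. inc n i \<omega>) (m * 2 ^ (n - q))) (J (real m / 2 ^ q))"
proof (rule conv_in_prob_AE_cong[OF J_conv])
  show "\<forall>\<^sub>F n in sequentially. AE \<omega> in M. riemann_sum (\<lambda>s \<omega>. exp (- left_lim (\<lambda>u. X u \<omega> $ 1) s)) (\<lambda>s \<omega>. X s \<omega> $ 2) n (real m / 2 ^ q) \<omega>
      = exp_riemann_sum (\<lambda>i. inc n i \<omega>) (m * 2 ^ (n - q))"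
    using eventually_ge_at_top[of q]
  proof eventually_elim
    case (elim n)
    show ?case
      using AE_left_lim_dyadic
    proof eventually_elim
      case (elim \<omega>)
      then show ?case
        unfolding riemann_sum_dyadic[OF \<open>q \<le> n\<close>] exp_riemann_sum_def
        by (intro sum.cong) (simp_all add: inc_def)
    qed
  qed
qed simp

lemma char_J_conv:
  assumes [measurable]: "A \<in> borel_measurable M" "B \<in> borel_measurable M"
  shows "(\<lambda>n. \<integral>\<omega>. cis (A \<omega> + B \<omega> * exp_riemann_sum (\<lambda>i. inc n i \<omega>) (m * 2 ^ (n - q))) \<partial>M)
    \<longlonglongrightarrow> (\<integral>\<omega>. cis (A \<omega> + B \<omega> * J (real m / 2 ^ q) \<omega>) \<partial>M)"
  by (rule conv_in_prob_cis[OF _ _ _ _ J_conv_dyadic]) auto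

text \<open>Here \<open>r\<close> is an arbitrary positive number and the constant need not be
  small: it is twice a bound for |\<Psi>| on the compact range of relevant frequencies.\<close>

lemma tail_linear:
  assumes "0 < r" shows "\<exists>c\<ge>0. \<forall>h\<ge>0. prob {\<omega> \<in> space M. r \<le> \<bar>X h \<omega> $ 1\<bar>} \<le> h * c"
proof -
  have "continuous_on {- (2 / r)..2 / r} (\<lambda>a. norm (\<Psi> (axis 1 a)))"
  proof (rule continuous_on_norm, rule continuous_on_compose2[of UNIV \<Psi>])
    show "continuous_on UNIV \<Psi>" by (intro continuous_at_imp_continuous_on ballI isCont_\<Psi>)
    show "continuous_on {- (2 / r)..2 / r} (\<lambda>a. axis 1 a :: real^2)" by (intro continuous_on_axis continuous_on_id)
  qed simp
  then have "bounded ((\<lambda>a. norm (\<Psi> (axis 1 a))) ` {- (2 / r)..2 / r})"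
    by (intro compact_imp_bounded compact_continuous_image) auto
  then obtain C where "\<forall>x\<in>(\<lambda>a. norm (\<Psi> (axis 1 a))) ` {- (2 / r)..2 / r}. \<bar>x\<bar> \<le> C"
    unfolding bounded_real by blast
  then have C: "norm (\<Psi> (axis 1 a)) \<le> C" if "a \<in> {- (2 / r)..2 / r}" for a
    using that abs_le_D1 by blast
  have "0 \<le> C" using order_trans[OF norm_ge_zero C[of 0]] assms by simp
  show ?thesis
  proof (intro exI[of _ "2 * C"] conjI allI impI)
    fix h :: real assume "0 \<le> h"
    then show "prob {\<omega> \<in> space M. r \<le> \<bar>X h \<omega> $ 1\<bar>} \<le> h * (2 * C)"
      by (rule tail_X[OF assms]) (rule C, simp add: abs_le_iff minus_le_iff)
  qed (use \<open>0 \<le> C\<close> in simp)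
qed

text \<open>\<beta> is below \<open>e\<close> near 0 and bounded on [-K, K], while X_h leaves the
  neighbourhood of 0 with probability at most linear in \<open>h\<close>.\<close>

lemma integral_little_near_0:
  assumes \<beta>: "continuous_on UNIV \<beta>" "\<And>v. 0 \<le> \<beta> v" "\<beta> 0 = (0::real)" and K: "0 \<le> K" and e: "0 < e"
  shows "\<exists>c\<ge>0. \<forall>h\<ge>0. (\<integral>\<omega>. \<beta> (X h \<omega> $ 1) * indicator {-K..K} (X h \<omega> $ 1) \<partial>M) \<le> e + h * c"
proof -
  have "isCont \<beta> 0" using \<beta>(1) by (simp add: continuous_on_eq_continuous_at)
  then have "\<forall>\<^sub>F v in nhds 0. \<beta> v < e"
    using order_tendstoD(2)[of \<beta> "\<beta> 0" "nhds 0" e] e \<beta>(3) by (simp add: isCont_def eventually_nhds_conv_at order_tendstoD(2))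
  then obtain \<kappa> where \<kappa>: "0 < \<kappa>" "\<And>v. \<bar>v\<bar> < \<kappa> \<Longrightarrow> \<beta> v < e"
    unfolding eventually_nhds_metric by (auto simp: dist_norm)
  have "bounded (\<beta> ` {-K..K})"
    by (intro compact_imp_bounded compact_continuous_image continuous_on_subset[OF \<beta>(1)]) auto
  then obtain C where "\<forall>x\<in>\<beta> ` {-K..K}. \<bar>x\<bar> \<le> C"
    unfolding bounded_real by blast
  then have C: "\<beta> v \<le> C" if "v \<in> {-K..K}" for v
    using that abs_le_D1 by blast
  have C0: "0 \<le> C" using C[of 0] \<beta>(3) K by simp
  obtain c where c: "0 \<le> c" "\<And>h. 0 \<le> h \<Longrightarrow> prob {\<omega> \<in> space M. \<kappa> \<le> \<bar>X h \<omega> $ 1\<bar>} \<le> h * c"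
    using tail_linear[OF \<kappa>(1)] by blast
  have [measurable]: "\<beta> \<in> borel_measurable borel" by (rule borel_measurable_continuous_onI[OF \<beta>(1)])
  show ?thesis
  proof (intro exI[of _ "C * c"] conjI allI impI)
    show "0 \<le> C * c" using C0 c by simp
    fix h :: real assume h: "0 \<le> h"
    have [measurable]: "X h \<in> borel_measurable M" using h by simp
    let ?A = "{\<omega> \<in> space M. \<kappa> \<le> \<bar>X h \<omega> $ 1\<bar>}"
    have "(\<integral>\<omega>. \<beta> (X h \<omega> $ 1) * indicator {-K..K} (X h \<omega> $ 1) \<partial>M) \<le> (\<integral>\<omega>. e + C * indicator ?A \<omega> \<partial>M)"
    proof (rule integral_mono')
      show "integrable M (\<lambda>\<omega>. e + C * indicator ?A \<omega>)" by (auto simp: less_top[symmetric])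
      fix \<omega> assume w: "\<omega> \<in> space M"
      show "0 \<le> e + C * indicator ?A \<omega>" using e C0 by simp
      show "\<beta> (X h \<omega> $ 1) * indicator {-K..K} (X h \<omega> $ 1) \<le> e + C * indicator ?A \<omega>"
      proof (cases "\<omega> \<in> ?A")
        case True
        then show ?thesis using C[of "X h \<omega> $ 1"] e C0 by (auto simp: indicator_def)
      next
        case False
        then have "\<bar>X h \<omega> $ 1\<bar> < \<kappa>" using w by auto
        then show ?thesis using \<kappa>(2)[of "X h \<omega> $ 1"] e False by (auto simp: indicator_def)
      qed
    qed
    also have "\<dots> = e + C * prob ?A" by (simp add: less_top[symmetric] prob_space)
    also have "\<dots> \<le> e + C * (h * c)" using c(2)[OF h] C0 by (intro add_left_mono mult_left_mono) auto
    finally show "(\<integral>\<omega>. \<beta> (X h \<omega> $ 1) * indicator {-K..K} (X h \<omega> $ 1) \<partial>M) \<le> e + h * (C * c)"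
      by (simp add: mult_ac)
  qed
qed

text \<open>On a short interval the integrand \<open>1 - exp (-\<xi>)\<close> of \<open>\<eta> - J\<close> is small.\<close>
lemma small_time:
  assumes e: "0 < e"
  shows "\<forall>\<^sub>F q in sequentially. norm ((\<integral>\<omega>. cis (u * (X (1 / 2 ^ q) \<omega> $ 2 - J (1 / 2 ^ q) \<omega>)) \<partial>M) - 1) \<le> e * (1 / 2 ^ q)"
proof -
  \<comment> \<open>Leaving [-K, K] will cost at most 4 h \<tau> = h e / 4 and the increments inside
    at most h e / 2, together less than e h.\<close>
  define \<tau> where "\<tau> = e / 16"
  have \<tau>: "0 < \<tau>" using e by (simp add: \<tau>_def)
  obtain r where r: "0 < r" "\<And>h. 0 \<le> h \<Longrightarrow> prob {\<omega> \<in> space M. r \<le> \<bar>X h \<omega> $ 1\<bar>} \<le> h * \<tau>"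
    using ex_tail_X[OF \<tau>] by blast
  define K where "K = 2 * r"
  \<comment> \<open>The Riemann sums of u (\<eta> - J) have the coefficient u (1 - exp (-v)) at
    position v. Given the past, an increment contributes its characteristic function at this
    frequency on the second axis, and H 0 = 0 makes \<beta> vanish at 0.\<close>
  define H where "H = (\<lambda>v. u * (1 - exp (- v)))"
  define \<beta> where "\<beta> = (\<lambda>v. norm (\<Psi> (axis 2 (H v))))"
  have \<beta>c: "continuous_on UNIV \<beta>"
    unfolding \<beta>_def
  proof (rule continuous_on_norm, rule continuous_on_compose2[of UNIV \<Psi>])
    show "continuous_on UNIV \<Psi>" by (intro continuous_at_imp_continuous_on ballI isCont_\<Psi>)
    show "continuous_on UNIV (\<lambda>v. axis 2 (H v) :: real^2)"
      unfolding H_def by (intro continuous_on_axis continuous_intros)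
  qed simp
  have \<beta>pos: "0 \<le> \<beta> v" for v by (simp add: \<beta>_def)
  have \<beta>0: "\<beta> 0 = 0"
  proof -
    have "axis 2 (H 0) = (0 :: real^2)" by (simp add: H_def axis_eq_0_iff)
    then show ?thesis unfolding \<beta>_def by (simp only: \<Psi>_0 norm_zero)
  qed
  have [measurable]: "\<beta> \<in> borel_measurable borel" by (rule borel_measurable_continuous_onI[OF \<beta>c])
  have [measurable]: "H \<in> borel_measurable borel" unfolding H_def by measurable
  obtain c where c: "0 \<le> c" "\<And>h. 0 \<le> h \<Longrightarrow> (\<integral>\<omega>. \<beta> (X h \<omega> $ 1) * indicator {-K..K} (X h \<omega> $ 1) \<partial>M) \<le> e / 4 + h * c"
    using integral_little_near_0[OF \<beta>c \<beta>pos \<beta>0, of K "e / 4"] r e by (auto simp: K_def)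
  have "bounded (\<beta> ` {-K..K})"
    by (intro compact_imp_bounded compact_continuous_image continuous_on_subset[OF \<beta>c]) auto
  then obtain C where "\<forall>x\<in>\<beta> ` {-K..K}. \<bar>x\<bar> \<le> C"
    unfolding bounded_real by blast
  then have C: "\<beta> v \<le> C" if "v \<in> {-K..K}" for v
    using that abs_le_D1 by blast
  have "(\<lambda>q. (1 / 2) ^ q * (\<tau> + c)) \<longlonglongrightarrow> 0 * (\<tau> + c)"
    by (intro tendsto_mult tendsto_const LIMSEQ_power_zero) simp
  then have "(\<lambda>q. 1 / 2 ^ q * (\<tau> + c)) \<longlonglongrightarrow> 0" by (simp add: power_one_over)
  then have "\<forall>\<^sub>F q in sequentially. 1 / 2 ^ q * (\<tau> + c) < min (1 / 2) (e / 4)"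
    using e by (intro order_tendstoD(2)) auto
  then show ?thesis
  proof eventually_elim
    case (elim q)
    let ?h = "1 / 2 ^ q :: real"
    have h\<tau>: "?h * \<tau> \<le> 1 / 2" "?h * c \<le> e / 4"
    proof -
      have "0 \<le> ?h * \<tau>" "0 \<le> ?h * c" "?h * (\<tau> + c) = ?h * \<tau> + ?h * c"
        using c \<tau> by (simp_all add: distrib_left add_divide_distrib)
      then show "?h * \<tau> \<le> 1 / 2" "?h * c \<le> e / 4" using elim by linarith+
    qed
    let ?Z = "\<lambda>n \<omega>. u * X ?h \<omega> $ 2 + (- u) * exp_riemann_sum (\<lambda>i. inc n i \<omega>) (1 * 2 ^ (n - q))"
    have lim: "(\<lambda>n. \<integral>\<omega>. cis (?Z n \<omega>) \<partial>M) \<longlonglongrightarrow> (\<integral>\<omega>. cis (u * X ?h \<omega> $ 2 + (- u) * J (real 1 / 2 ^ q) \<omega>) \<partial>M)"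
    proof (rule char_J_conv)
      have "X ?h \<in> borel_measurable M" by simp
      then show "(\<lambda>\<omega>. u * X ?h \<omega> $ 2) \<in> borel_measurable M" by measurable
    qed simp
    have bd: "norm ((\<integral>\<omega>. cis (?Z n \<omega>) \<partial>M) - 1) \<le> e * ?h" if n: "q \<le> n" for n
    proof -
      define N :: nat where "N = 2 ^ (n - q)"
      define \<delta> :: real where "\<delta> = 1 / 2 ^ n"
      have N: "real N / 2 ^ n = ?h"
      proof -
        have "(2::real) ^ n = 2 ^ q * 2 ^ (n - q)" using n by (simp add: power_add[symmetric])
        then show ?thesis by (simp add: N_def)
      qed
      have \<delta>: "0 \<le> \<delta>" "real N * \<delta> = ?h" using N by (simp_all add: \<delta>_def)
      define S where "S = (\<lambda>i \<omega>. (\<Sum>j<i. inc n j \<omega>) $ 1)"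
      have "AE \<omega> in M. ?Z n \<omega> = (\<Sum>i<N. H (S i \<omega>) * (inc n i \<omega> $ 2))"
        using AE_X_eq_sum
      proof eventually_elim
        case (elim \<omega>)
        then have "X (real N / 2 ^ n) \<omega> = (\<Sum>i<N. inc n i \<omega>)" by blast
        then have "X ?h \<omega> $ 2 = (\<Sum>i<N. inc n i \<omega> $ 2)" unfolding N by (simp add: sum_component)
        then show ?case
          by (simp add: exp_riemann_sum_def N_def[symmetric] H_def S_def sum_distrib_left sum_subtractf sum_negf algebra_simps)
      qed
      then have eq: "(\<integral>\<omega>. cis (?Z n \<omega>) \<partial>M) = (\<integral>\<omega>. cis (\<Sum>i<N. H (S i \<omega>) * (inc n i \<omega> $ 2)) \<partial>M)"
      proof (intro integral_cong_AE)
        have "X ?h \<in> borel_measurable M" by simp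
        then show "(\<lambda>\<omega>. cis (?Z n \<omega>)) \<in> borel_measurable M"
          unfolding cis_conv_exp by measurable
        show "(\<lambda>\<omega>. cis (\<Sum>i<N. H (S i \<omega>) * (inc n i \<omega> $ 2))) \<in> borel_measurable M"
          unfolding cis_conv_exp S_def by measurable
      qed auto
      have b: "norm ((\<integral>\<omega>. cis (H v * (X (1 / 2 ^ n) \<omega> $ 2)) \<partial>M) - 1) \<le> \<delta> * \<beta> v" for v
        using norm_exp_\<Psi>_le[OF \<delta>(1), of "axis 2 (H v)"] expectation_cis_X[OF \<delta>(1), of "axis 2 (H v)"]
        by (simp add: inner_axis' \<beta>_def \<delta>_def)
      have "norm ((\<integral>\<omega>. cis (\<Sum>i<N. H (S i \<omega>) * (inc n i \<omega> $ 2)) \<partial>M) - 1)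
          \<le> 2 * prob {\<omega> \<in> space M. \<exists>i\<le>N. K < \<bar>S i \<omega>\<bar>} + (\<Sum>i<N. \<integral>\<omega>. \<delta> * \<beta> (S i \<omega>) * indicator {-K..K} (S i \<omega>) \<partial>M)"
        unfolding S_def
      proof (rule localized_char_bound[where C="\<delta> * C" and w="\<lambda>z. z $ 2" and \<beta>="\<lambda>v. \<delta> * \<beta> v"])
        show "0 \<le> K" using r by (simp add: K_def)
        show "\<delta> * \<beta> v \<le> \<delta> * C" if "\<bar>v\<bar> \<le> K" for v
          using that \<delta> by (intro mult_left_mono C) (auto simp: abs_le_iff)
      qed (use b in auto)
      moreover have "prob {\<omega> \<in> space M. \<exists>i\<le>N. K < \<bar>S i \<omega>\<bar>} \<le> 2 * (?h * \<tau>)"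
      proof -
        have [measurable]: "S i \<in> borel_measurable M" for i unfolding S_def by measurable
        have "prob {\<omega> \<in> space M. \<exists>i\<le>N. K < \<bar>S i \<omega>\<bar>} \<le> prob {\<omega> \<in> space M. \<exists>i\<le>N. 2 * r \<le> \<bar>S i \<omega>\<bar>}"
          by (intro finite_measure_mono) (auto simp: K_def intro: less_imp_le)
        also have "\<dots> \<le> 2 * (real N / 2 ^ n * \<tau>)"
          unfolding S_def by (rule maximal_inequality) (use r \<tau> N h\<tau> in auto)
        finally show ?thesis unfolding N .
      qed
      \<comment> \<open>All positions belong to times up to \<open>?h\<close>, so each expectation
        of \<beta> is at most e / 4 from the vicinity of 0 plus \<open>?h\<close> c \<le> e / 4 from
        the rest.\<close>
      moreover have "(\<Sum>i<N. \<integral>\<omega>. \<delta> * \<beta> (S i \<omega>) * indicator {-K..K} (S i \<omega>) \<partial>M) \<le> (\<Sum>i<N. \<delta> * (e / 2))"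
      proof (rule sum_mono)
        fix i assume "i \<in> {..<N}"
        then have i: "real i / 2 ^ n \<le> ?h" unfolding N[symmetric] by (intro divide_right_mono) auto
        have [measurable]: "X (real i / 2 ^ n) \<in> borel_measurable M" by simp
        have "(\<integral>\<omega>. \<delta> * \<beta> (S i \<omega>) * indicator {-K..K} (S i \<omega>) \<partial>M)
          = (\<integral>\<omega>. \<delta> * (\<beta> (X (real i / 2 ^ n) \<omega> $ 1) * indicator {-K..K} (X (real i / 2 ^ n) \<omega> $ 1)) \<partial>M)"
        proof (rule integral_cong_AE)
          show "AE \<omega> in M. \<delta> * \<beta> (S i \<omega>) * indicator {-K..K} (S i \<omega>)
            = \<delta> * (\<beta> (X (real i / 2 ^ n) \<omega> $ 1) * indicator {-K..K} (X (real i / 2 ^ n) \<omega> $ 1))"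
            using AE_X_eq_sum by eventually_elim (simp add: S_def)
        qed (unfold S_def, measurable)
        also have "\<dots> = \<delta> * (\<integral>\<omega>. \<beta> (X (real i / 2 ^ n) \<omega> $ 1) * indicator {-K..K} (X (real i / 2 ^ n) \<omega> $ 1) \<partial>M)"
          by simp
        also have "\<dots> \<le> \<delta> * (e / 4 + real i / 2 ^ n * c)"
          by (intro mult_left_mono c(2) \<delta>(1)) simp
        also have "\<dots> \<le> \<delta> * (e / 2)"
        proof (intro mult_left_mono \<delta>(1))
          have "real i / 2 ^ n * c \<le> ?h * c" using i c(1) by (intro mult_right_mono) auto
          then show "e / 4 + real i / 2 ^ n * c \<le> e / 2" using h\<tau>(2) by linarith
        qed
        finally show "(\<integral>\<omega>. \<delta> * \<beta> (S i \<omega>) * indicator {-K..K} (S i \<omega>) \<partial>M) \<le> \<delta> * (e / 2)" .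
      qed
      moreover have "(\<Sum>i<N. \<delta> * (e / 2)) = ?h * (e / 2)"
        using \<delta>(2) by (simp add: mult.assoc[symmetric])
      moreover have "2 * (2 * (?h * \<tau>)) + ?h * (e / 2) \<le> e * ?h" using e by (simp add: \<tau>_def field_simps)
      ultimately show ?thesis unfolding eq by linarith
    qed
    have "norm ((\<integral>\<omega>. cis (u * X ?h \<omega> $ 2 + (- u) * J (real 1 / 2 ^ q) \<omega>) \<partial>M) - 1) \<le> e * ?h"
    proof (rule tendsto_upperbound[OF _ _ sequentially_bot])
      show "(\<lambda>n. norm ((\<integral>\<omega>. cis (?Z n \<omega>) \<partial>M) - 1)) \<longlonglongrightarrow> norm ((\<integral>\<omega>. cis (u * X ?h \<omega> $ 2 + (- u) * J (real 1 / 2 ^ q) \<omega>) \<partial>M) - 1)"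
        by (intro tendsto_intros lim)
      show "\<forall>\<^sub>F n in sequentially. norm ((\<integral>\<omega>. cis (?Z n \<omega>) \<partial>M) - 1) \<le> e * ?h"
        using eventually_ge_at_top[of q] by eventually_elim (rule bd)
    qed
    then show ?case by (simp add: right_diff_distrib)
  qed
qed

end

section \<open>Vanishing generator and the closed form of the integral\<close>

context levy_integral
begin

lemma J_eq_if_eq_on_dyadics:
  assumes dy: "\<And>m q. 0 < m \<Longrightarrow> AE \<omega> in M. J (real m / 2 ^ q) \<omega> = k * (1 - exp (- (X (real m / 2 ^ q) \<omega> $ 1)))"
  shows "AE \<omega> in M. \<forall>t>0. J t \<omega> = k * (1 - exp (- (X t \<omega> $ 1)))"
proof -
  have "AE \<omega> in M. \<forall>m q. 0 < m \<longrightarrow> J (real m / 2 ^ q) \<omega> = k * (1 - exp (- (X (real m / 2 ^ q) \<omega> $ 1)))"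
    unfolding AE_all_countable
  proof (intro allI)
    fix m q :: nat
    show "AE \<omega> in M. 0 < m \<longrightarrow> J (real m / 2 ^ q) \<omega> = k * (1 - exp (- (X (real m / 2 ^ q) \<omega> $ 1)))"
      using dy[of m q] by (cases "0 < m") auto
  qed
  with AE_cadlag AE_cadlag_J show ?thesis
  proof eventually_elim
    case (elim \<omega>)
    show ?case
    proof (intro allI impI)
      fix t :: real assume t: "0 < t"
      let ?f = "\<lambda>t. J t \<omega> - k * (1 - exp (- (X t \<omega> $ 1)))"
      have "((\<lambda>t. X t \<omega>) \<longlongrightarrow> X t \<omega>) (at_right t)" "((\<lambda>t. J t \<omega>) \<longlongrightarrow> J t \<omega>) (at_right t)"
        using elim(1,2) t unfolding cadlag_def by (meson less_imp_le)+
      then have "(?f \<longlongrightarrow> ?f t) (at_right t)" by (intro tendsto_intros)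
      then have "?f t = 0"
        by (rule eq_0_if_eq_0_on_dyadics) (use elim(3) t in auto)
      then show "J t \<omega> = k * (1 - exp (- (X t \<omega> $ 1)))" by simp
    qed
  qed
qed

text \<open>Each increment contributes a characteristic function within o(2^-n) of 1, uniformly
  while the walk stays in [-K, K], and there are t 2^n increments, so their joint contribution
  vanishes in the limit. What remains is the localization error 4 t \<tau>, with \<tau> arbitrarily
  small.\<close>

lemma J_eq_if_generator_0:
  assumes lim1: "(\<lambda>n. (\<integral>\<omega>. sin (first_integral k (X (1 / 2 ^ n) \<omega>)) \<partial>M) * 2 ^ n) \<longlonglongrightarrow> 0"
    and lim2: "(\<lambda>n. (\<integral>\<omega>. (first_integral k (X (1 / 2 ^ n) \<omega>))\<^sup>2 / (1 + (first_integral k (X (1 / 2 ^ n) \<omega>))\<^sup>2) \<partial>M) * 2 ^ n) \<longlonglongrightarrow> 0"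
  shows "AE \<omega> in M. \<forall>t>0. J t \<omega> = k * (1 - exp (- (X t \<omega> $ 1)))"
proof (rule J_eq_if_eq_on_dyadics)
  fix m q :: nat assume "0 < m"
  define t where "t = real m / 2 ^ q"
  have t: "0 < t" using \<open>0 < m\<close> by (simp add: t_def)
  have [measurable]: "X t \<in> borel_measurable M" "J t \<in> borel_measurable M" using t by simp_all
  let ?p = "first_integral k"
  define a where "a = (\<lambda>n. (\<integral>\<omega>. sin (?p (X (1 / 2 ^ n) \<omega>)) \<partial>M))"
  define b where "b = (\<lambda>n. (\<integral>\<omega>. (?p (X (1 / 2 ^ n) \<omega>))\<^sup>2 / (1 + (?p (X (1 / 2 ^ n) \<omega>))\<^sup>2) \<partial>M))"
  have b0: "0 \<le> b n" for n unfolding b_def by (intro integral_nonneg_AE) auto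
  have "AE \<omega> in M. J t \<omega> - k * (1 - exp (- (X t \<omega> $ 1))) = 0"
  proof (rule AE_eq_0_if_expectation_cis)
    fix u :: real
    let ?D = "\<lambda>\<omega>. u * (J t \<omega> - k * (1 - exp (- (X t \<omega> $ 1))))"
    have bound: "norm ((\<integral>\<omega>. cis (?D \<omega>) \<partial>M) - 1) \<le> 4 * (t * \<tau>)" if \<tau>: "0 < \<tau>" "t * \<tau> \<le> 1 / 2" for \<tau>
    proof -
      obtain r where r: "0 < r" "\<And>h. 0 \<le> h \<Longrightarrow> prob {\<omega> \<in> space M. r \<le> \<bar>X h \<omega> $ 1\<bar>} \<le> h * \<tau>"
        using ex_tail_X[OF \<tau>(1)] by blast
      define K where "K = 2 * r"
      define H where "H = (\<lambda>v. u * exp (- v))"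
      define V where "V = \<bar>u\<bar> * exp K"
      have V: "\<bar>H v\<bar> \<le> V" if "\<bar>v\<bar> \<le> K" for v
        using that by (auto simp: H_def V_def abs_mult intro!: mult_left_mono)
      have V0: "0 \<le> V" by (simp add: V_def)
      define \<beta> where "\<beta> = (\<lambda>n v. \<bar>H v\<bar> * \<bar>a n\<bar> + (4 + 2 * \<bar>H v\<bar> + \<bar>H v\<bar>\<^sup>2) * b n)"
      define C where "C = (\<lambda>n. V * \<bar>a n\<bar> + (4 + 2 * V + V\<^sup>2) * b n)"
      have [measurable]: "H \<in> borel_measurable borel" unfolding H_def by measurable
      have [measurable]: "\<beta> n \<in> borel_measurable borel" for n unfolding \<beta>_def by measurable
      have \<beta>C: "\<beta> n v \<le> C n" if "\<bar>v\<bar> \<le> K" for n v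
        unfolding \<beta>_def C_def using V[OF that] b0[of n] V0
        by (intro add_mono mult_right_mono power_mono) auto
      have \<beta>0: "0 \<le> \<beta> n v" for n v using b0[of n] by (simp add: \<beta>_def)
      have C0: "0 \<le> C n" for n using b0[of n] V0 by (simp add: C_def)
      have chi: "norm ((\<integral>\<omega>. cis (H v * ?p (X (1 / 2 ^ n) \<omega>)) \<partial>M) - 1) \<le> \<beta> n v" for n v
      proof -
        let ?Y = "\<lambda>\<omega>. ?p (X (1 / 2 ^ n) \<omega>)"
        have [measurable]: "X (1 / 2 ^ n) \<in> borel_measurable M" by simp
        have i1: "integrable M (\<lambda>\<omega>. cis (H v * ?Y \<omega>))" by (rule integrable_cis) measurable
        have i2: "integrable M (\<lambda>\<omega>. complex_of_real (sin (?Y \<omega>)))"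
          by (rule integrable_const_bound[of _ 1]) auto
        have i3: "integrable M (\<lambda>\<omega>. (?Y \<omega>)\<^sup>2 / (1 + (?Y \<omega>)\<^sup>2))"
          by (rule integrable_const_bound[of _ 1]) (auto simp: divide_le_eq add_pos_nonneg)
        define R where "R = (\<lambda>\<omega>. cis (H v * ?Y \<omega>) - 1 - \<i> * complex_of_real (H v * sin (?Y \<omega>)))"
        have "(\<integral>\<omega>. cis (H v * ?Y \<omega>) \<partial>M) - 1 = (\<integral>\<omega>. R \<omega> \<partial>M) + \<i> * complex_of_real (H v * a n)"
          using i1 i2 by (simp add: R_def a_def prob_space)
        then have "norm ((\<integral>\<omega>. cis (H v * ?Y \<omega>) \<partial>M) - 1) \<le> norm (\<integral>\<omega>. R \<omega> \<partial>M) + \<bar>H v\<bar> * \<bar>a n\<bar>"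
          using norm_triangle_ineq[of "\<integral>\<omega>. R \<omega> \<partial>M" "\<i> * complex_of_real (H v * a n)"]
          by (simp add: norm_mult abs_mult)
        moreover have "norm (\<integral>\<omega>. R \<omega> \<partial>M) \<le> (\<integral>\<omega>. norm (R \<omega>) \<partial>M)"
          by (rule integral_norm_bound)
        moreover have "(\<integral>\<omega>. norm (R \<omega>) \<partial>M) \<le> (\<integral>\<omega>. (4 + 2 * \<bar>H v\<bar> + (H v)\<^sup>2) * ((?Y \<omega>)\<^sup>2 / (1 + (?Y \<omega>)\<^sup>2)) \<partial>M)"
        proof (rule integral_mono')
          show "integrable M (\<lambda>\<omega>. (4 + 2 * \<bar>H v\<bar> + (H v)\<^sup>2) * ((?Y \<omega>)\<^sup>2 / (1 + (?Y \<omega>)\<^sup>2)))"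
            by (rule integrable_mult_right[OF i3])
          show "norm (R \<omega>) \<le> (4 + 2 * \<bar>H v\<bar> + (H v)\<^sup>2) * ((?Y \<omega>)\<^sup>2 / (1 + (?Y \<omega>)\<^sup>2))" for \<omega>
            unfolding R_def by (rule cis_approx_sin)
        qed simp
        moreover have "(\<integral>\<omega>. (4 + 2 * \<bar>H v\<bar> + (H v)\<^sup>2) * ((?Y \<omega>)\<^sup>2 / (1 + (?Y \<omega>)\<^sup>2)) \<partial>M)
            = (4 + 2 * \<bar>H v\<bar> + \<bar>H v\<bar>\<^sup>2) * b n"
          unfolding b_def power2_abs by (rule integral_mult_right_zero)
        ultimately show ?thesis unfolding \<beta>_def by linarith
      qed
      let ?Z = "\<lambda>n \<omega>. - u * k * (1 - exp (- (X t \<omega> $ 1))) + u * exp_riemann_sum (\<lambda>i. inc n i \<omega>) (m * 2 ^ (n - q))"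
      have lim: "(\<lambda>n. \<integral>\<omega>. cis (?Z n \<omega>) \<partial>M) \<longlonglongrightarrow> (\<integral>\<omega>. cis (- u * k * (1 - exp (- (X t \<omega> $ 1))) + u * J t \<omega>) \<partial>M)"
        unfolding t_def[symmetric] by (rule char_J_conv[of _ _ m q, folded t_def]) auto
      have bd: "norm ((\<integral>\<omega>. cis (?Z n \<omega>) \<partial>M) - 1) \<le> 4 * (t * \<tau>) + t * (2 ^ n * C n)" if n: "q \<le> n" for n
      proof -
        define N where "N = m * 2 ^ (n - q)"
        have N: "real N / 2 ^ n = t"
        proof -
          have "(2::real) ^ n = 2 ^ q * 2 ^ (n - q)" using n by (simp add: power_add[symmetric])
          then show ?thesis by (simp add: N_def t_def)
        qed
        define S where "S = (\<lambda>i \<omega>. (\<Sum>j<i. inc n j \<omega>) $ 1)"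
        have "AE \<omega> in M. ?Z n \<omega> = (\<Sum>i<N. H (S i \<omega>) * ?p (inc n i \<omega>))"
          using AE_X_eq_sum
        proof eventually_elim
          case (elim \<omega>)
          then have "X (real N / 2 ^ n) \<omega> = (\<Sum>i<N. inc n i \<omega>)" by blast
          then have "X t \<omega> = (\<Sum>i<N. inc n i \<omega>)" unfolding N .
          then have "?Z n \<omega> = u * (exp_riemann_sum (\<lambda>i. inc n i \<omega>) N - k * (1 - exp (- (\<Sum>j<N. inc n j \<omega>) $ 1)))"
            by (simp add: N_def algebra_simps)
          then show ?case
            unfolding exp_riemann_sum_first_integral by (simp add: H_def S_def sum_distrib_left mult.assoc)
        qed
        then have eq: "(\<integral>\<omega>. cis (?Z n \<omega>) \<partial>M) = (\<integral>\<omega>. cis (\<Sum>i<N. H (S i \<omega>) * ?p (inc n i \<omega>)) \<partial>M)"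
        proof (intro integral_cong_AE)
          show "(\<lambda>\<omega>. cis (?Z n \<omega>)) \<in> borel_measurable M"
            unfolding cis_conv_exp by measurable
          show "(\<lambda>\<omega>. cis (\<Sum>i<N. H (S i \<omega>) * ?p (inc n i \<omega>))) \<in> borel_measurable M"
            unfolding cis_conv_exp S_def by measurable
        qed auto
        have [measurable]: "S i \<in> borel_measurable M" for i unfolding S_def by measurable
        have "norm ((\<integral>\<omega>. cis (\<Sum>i<N. H (S i \<omega>) * ?p (inc n i \<omega>)) \<partial>M) - 1)
            \<le> 2 * prob {\<omega> \<in> space M. \<exists>i\<le>N. K < \<bar>S i \<omega>\<bar>} + (\<Sum>i<N. \<integral>\<omega>. \<beta> n (S i \<omega>) * indicator {-K..K} (S i \<omega>) \<partial>M)"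
          unfolding S_def
          by (rule localized_char_bound[where C="C n"]) (use chi \<beta>C r in \<open>auto simp: K_def\<close>)
        moreover have "prob {\<omega> \<in> space M. \<exists>i\<le>N. K < \<bar>S i \<omega>\<bar>} \<le> 2 * (t * \<tau>)"
        proof -
          have "prob {\<omega> \<in> space M. \<exists>i\<le>N. K < \<bar>S i \<omega>\<bar>} \<le> prob {\<omega> \<in> space M. \<exists>i\<le>N. 2 * r \<le> \<bar>S i \<omega>\<bar>}"
            by (intro finite_measure_mono) (auto simp: K_def intro: less_imp_le)
          also have "\<dots> \<le> 2 * (real N / 2 ^ n * \<tau>)"
            unfolding S_def by (rule maximal_inequality) (use r \<tau> N in auto)
          finally show ?thesis unfolding N .
        qed
        moreover have "(\<Sum>i<N. \<integral>\<omega>. \<beta> n (S i \<omega>) * indicator {-K..K} (S i \<omega>) \<partial>M) \<le> (\<Sum>i<N. C n)"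
        proof (rule sum_mono)
          fix i
          have "(\<integral>\<omega>. \<beta> n (S i \<omega>) * indicator {-K..K} (S i \<omega>) \<partial>M) \<le> (\<integral>\<omega>. C n \<partial>M)"
            using \<beta>C C0 by (intro integral_mono') (auto simp: indicator_def abs_le_iff)
          then show "(\<integral>\<omega>. \<beta> n (S i \<omega>) * indicator {-K..K} (S i \<omega>) \<partial>M) \<le> C n" by (simp add: prob_space)
        qed
        moreover have "(\<Sum>i<N. C n) = t * (2 ^ n * C n)" using N by (auto simp: field_simps)
        ultimately show ?thesis unfolding eq by linarith
      qed
      have "(\<lambda>n. V * \<bar>a n * 2 ^ n\<bar> + (4 + 2 * V + V\<^sup>2) * (b n * 2 ^ n)) \<longlonglongrightarrow> V * \<bar>0\<bar> + (4 + 2 * V + V\<^sup>2) * 0"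
        using lim1 lim2 unfolding a_def b_def by (intro tendsto_intros)
      then have limC: "(\<lambda>n. 2 ^ n * C n) \<longlonglongrightarrow> 0"
        by (simp add: C_def abs_mult algebra_simps)
      have "norm ((\<integral>\<omega>. cis (- u * k * (1 - exp (- (X t \<omega> $ 1))) + u * J t \<omega>) \<partial>M) - 1) \<le> 4 * (t * \<tau>) + t * 0"
      proof (rule tendsto_le[OF sequentially_bot])
        show "(\<lambda>n. norm ((\<integral>\<omega>. cis (?Z n \<omega>) \<partial>M) - 1)) \<longlonglongrightarrow> norm ((\<integral>\<omega>. cis (- u * k * (1 - exp (- (X t \<omega> $ 1))) + u * J t \<omega>) \<partial>M) - 1)"
          by (intro tendsto_norm tendsto_diff lim tendsto_const)
        show "(\<lambda>n. 4 * (t * \<tau>) + t * (2 ^ n * C n)) \<longlonglongrightarrow> 4 * (t * \<tau>) + t * 0"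
          by (intro tendsto_add tendsto_mult tendsto_const limC)
        show "\<forall>\<^sub>F n in sequentially. norm ((\<integral>\<omega>. cis (?Z n \<omega>) \<partial>M) - 1) \<le> 4 * (t * \<tau>) + t * (2 ^ n * C n)"
          using eventually_ge_at_top[of q] by eventually_elim (rule bd)
      qed
      moreover have "- u * k * (1 - exp (- (X t \<omega> $ 1))) + u * J t \<omega> = ?D \<omega>" for \<omega> by (simp add: algebra_simps)
      ultimately show ?thesis by simp
    qed
    have "norm ((\<integral>\<omega>. cis (?D \<omega>) \<partial>M) - 1) \<le> 0"
    proof (rule field_le_epsilon)
      fix e :: real assume e: "0 < e"
      \<comment> \<open>The choice gives t \<tau> \<le> 1 / 2, as the maximal inequality requires,
        and 4 t \<tau> \<le> e.\<close>
      define \<tau> where "\<tau> = min (1 / 2) (e / 4) / t"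
      have "t * \<tau> = min (1 / 2) (e / 4)" using t by (simp add: \<tau>_def)
      moreover have "0 < \<tau>" using e t by (simp add: \<tau>_def)
      ultimately show "norm ((\<integral>\<omega>. cis (?D \<omega>) \<partial>M) - 1) \<le> 0 + e" using bound[of \<tau>] by linarith
    qed
    then show "(\<integral>\<omega>. cis (?D \<omega>) \<partial>M) = 1" by simp
  qed measurable
  then show "AE \<omega> in M. J (real m / 2 ^ q) \<omega> = k * (1 - exp (- (X (real m / 2 ^ q) \<omega> $ 1)))"
    unfolding t_def by eventually_elim simp
qed

lemma dyadic_at_right: "filterlim (\<lambda>q. 1 / 2 ^ q :: real) (at_right 0) sequentially"
  unfolding filterlim_at
proof (intro conjI)
  show "(\<lambda>q. 1 / 2 ^ q :: real) \<longlonglongrightarrow> 0"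
    using LIMSEQ_power_zero[of "1 / 2 :: real"] by (simp add: power_one_over)
qed simp

text \<open>Under the closed form \<eta>_h - J_h equals \<open>first_integral k\<close> at X_h, so
  \<open>small_time\<close> says that its characteristic function is 1 + o(h) along h =
  2^-q.\<close>

lemma small_time_tendsto:
  assumes eq: "AE \<omega> in M. \<forall>t>0. J t \<omega> = k * (1 - exp (- (X t \<omega> $ 1)))"
  shows "(\<lambda>q. ((\<integral>\<omega>. cis (u * first_integral k (X (1 / 2 ^ q) \<omega>)) \<partial>M) - 1) * 2 ^ q) \<longlonglongrightarrow> 0"
proof (rule tendsto_norm_zero_cancel, rule tendstoI)
  fix e :: real assume e: "0 < e"
  have "\<forall>\<^sub>F q in sequentially. norm ((\<integral>\<omega>. cis (u * (X (1 / 2 ^ q) \<omega> $ 2 - J (1 / 2 ^ q) \<omega>)) \<partial>M) - 1) \<le> e / 2 * (1 / 2 ^ q)"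
    using e by (intro small_time) simp
  then show "\<forall>\<^sub>F q in sequentially. dist (norm (((\<integral>\<omega>. cis (u * first_integral k (X (1 / 2 ^ q) \<omega>)) \<partial>M) - 1) * 2 ^ q)) 0 < e"
  proof eventually_elim
    case (elim q)
    have [measurable]: "X (1 / 2 ^ q) \<in> borel_measurable M" "J (1 / 2 ^ q) \<in> borel_measurable M" by simp_all
    have "(\<integral>\<omega>. cis (u * (X (1 / 2 ^ q) \<omega> $ 2 - J (1 / 2 ^ q) \<omega>)) \<partial>M) = (\<integral>\<omega>. cis (u * first_integral k (X (1 / 2 ^ q) \<omega>)) \<partial>M)"
      by (rule integral_cong_AE) (use eq in \<open>auto simp: cis_conv_exp first_integral_def\<close>)
    then have "norm ((\<integral>\<omega>. cis (u * first_integral k (X (1 / 2 ^ q) \<omega>)) \<partial>M) - 1) * 2 ^ q \<le> e / 2 * (1 / 2 ^ q) * 2 ^ q"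
      using elim by (intro mult_right_mono) auto
    also have "\<dots> < e" using e by simp
    finally show ?case by (simp add: norm_mult norm_power)
  qed
qed

end

subsection \<open>Atoms of the limit\<close>

text \<open>The hypothesis expresses through characteristic functions that \<open>Y\<close> is
  distributed as I' - U' with independent I', U' that have the laws of \<open>I\<close> and
  \<open>U\<close>. Fubini over the law of \<open>U\<close> gives the probability that this
  difference is 0. In this form independence survives passage to the limit.\<close>

lemma (in prob_space) emeasure_indep_eq:
  fixes I U Y :: "'a \<Rightarrow> real"
  assumes [measurable]: "I \<in> borel_measurable M" "U \<in> borel_measurable M" "Y \<in> borel_measurable M"
    and char: "\<And>v. (\<integral>x. cis (v * Y x) \<partial>M) = (\<integral>x. cis (v * I x) \<partial>M) * (\<integral>x. cis (- (v * U x)) \<partial>M)"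
  shows "(\<lambda>y. emeasure M {x \<in> space M. I x = y}) \<in> borel_measurable borel"
    and "emeasure M {x \<in> space M. Y x = 0} = (\<integral>\<^sup>+x. emeasure M {x' \<in> space M. I x' = U x} \<partial>M)"
proof -
  let ?\<mu> = "distr M borel I" and ?\<nu> = "distr M borel U"
  interpret \<mu>: prob_space ?\<mu> by (rule prob_space_distr) simp
  interpret \<nu>: prob_space ?\<nu> by (rule prob_space_distr) simp
  interpret P: pair_prob_space ?\<mu> ?\<nu> ..
  have sets[measurable_cong]: "sets (?\<mu> \<Otimes>\<^sub>M ?\<nu>) = sets (borel \<Otimes>\<^sub>M borel)" by (intro sets_pair_measure_cong) auto
  let ?d = "\<lambda>z::real \<times> real. fst z - snd z"
  have dm[measurable]: "?d \<in> borel_measurable (?\<mu> \<Otimes>\<^sub>M ?\<nu>)" by measurable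
  let ?R = "distr (?\<mu> \<Otimes>\<^sub>M ?\<nu>) borel ?d"
  interpret R: prob_space ?R by (rule P.prob_space_distr) simp
  interpret YY: prob_space "distr M borel Y" by (rule prob_space_distr) simp
  have eq: "distr M borel Y = ?R"
  proof (rule Levy_uniqueness)
    show "real_distribution (distr M borel Y)" "real_distribution ?R"
      by (auto simp: real_distribution_def real_distribution_axioms_def YY.prob_space_axioms R.prob_space_axioms)
    show "char (distr M borel Y) = char ?R"
    proof
      fix v :: real
      have "char (distr M borel Y) v = (\<integral>x. cis (v * Y x) \<partial>M)"
        by (simp add: char_def cis_conv_exp integral_distr)
      moreover have "char ?R v = (\<integral>x. cis (v * I x) \<partial>M) * (\<integral>x. cis (- (v * U x)) \<partial>M)"
      proof -
        let ?f = "\<lambda>z. cis (v * fst z) * cis (- (v * snd z))"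
        have fm: "?f \<in> borel_measurable (?\<mu> \<Otimes>\<^sub>M ?\<nu>)" unfolding cis_conv_exp by measurable
        have int: "integrable (?\<mu> \<Otimes>\<^sub>M ?\<nu>) ?f"
          by (rule P.integrable_const_bound[of _ 1]) (use fm in \<open>auto simp: norm_mult\<close>)
        have "char ?R v = (\<integral>z. cis (v * (fst z - snd z)) \<partial>(?\<mu> \<Otimes>\<^sub>M ?\<nu>))"
          unfolding char_def by (subst integral_distr) (auto simp: cis_conv_exp)
        also have "\<dots> = (\<integral>z. ?f z \<partial>(?\<mu> \<Otimes>\<^sub>M ?\<nu>))" by (simp add: cis_mult right_diff_distrib)
        also have "\<dots> = (\<integral>x. (\<integral>y. ?f (x, y) \<partial>?\<nu>) \<partial>?\<mu>)" using P.integral_fst'[OF int] by simp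
        also have "\<dots> = (\<integral>x. cis (v * x) \<partial>?\<mu>) * (\<integral>y. cis (- (v * y)) \<partial>?\<nu>)" by simp
        also have "\<dots> = (\<integral>x. cis (v * I x) \<partial>M) * (\<integral>x. cis (- (v * U x)) \<partial>M)"
          by (subst (1 2) integral_distr) (auto simp: cis_conv_exp)
        finally show ?thesis .
      qed
      ultimately show "char (distr M borel Y) v = char ?R v" using char by simp
    qed
  qed
  let ?A = "{z \<in> space (borel \<Otimes>\<^sub>M borel). ?d z = 0}"
  have A: "?A \<in> sets (?\<mu> \<Otimes>\<^sub>M ?\<nu>)" unfolding sets by measurable
  have sec: "emeasure ?\<mu> ((\<lambda>x. (x, y)) -` ?A) = emeasure M {x \<in> space M. I x = y}" for y
  proof -
    have "(\<lambda>x. (x, y)) -` ?A = {y}" by (auto simp: space_pair_measure)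
    then show ?thesis by (simp add: emeasure_distr vimage_def Int_def conj_commute)
  qed
  from P.measurable_emeasure_Pair2[OF A]
  show m: "(\<lambda>y. emeasure M {x \<in> space M. I x = y}) \<in> borel_measurable borel" unfolding sec by simp
  have "emeasure M {x \<in> space M. Y x = 0} = emeasure (distr M borel Y) {0}"
    by (simp add: emeasure_distr vimage_def Int_def conj_commute)
  also have "\<dots> = emeasure (?\<mu> \<Otimes>\<^sub>M ?\<nu>) ?A"
    unfolding eq by (subst emeasure_distr) (auto simp: space_pair_measure intro!: arg_cong[of _ _ "emeasure (?\<mu> \<Otimes>\<^sub>M ?\<nu>)"])
  also have "\<dots> = (\<integral>\<^sup>+y. emeasure M {x \<in> space M. I x = y} \<partial>?\<nu>)"
    unfolding P.emeasure_pair_measure_alt2[OF A] sec ..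
  also have "\<dots> = (\<integral>\<^sup>+x. emeasure M {x' \<in> space M. I x' = U x} \<partial>M)"
    using m by (subst nn_integral_distr) auto
  finally show "emeasure M {x \<in> space M. Y x = 0} = (\<integral>\<^sup>+x. emeasure M {x' \<in> space M. I x' = U x} \<partial>M)" .
qed

text \<open>Disjoint events of probability at least \<open>c\<close> number at most 1 / c.\<close>

lemma (in prob_space) finite_heavy_atoms:
  fixes I :: "'a \<Rightarrow> real"
  assumes [measurable]: "I \<in> borel_measurable M" and c: "0 < c"
  shows "finite {y. c \<le> prob {x \<in> space M. I x = y}}"
proof (rule ccontr)
  assume inf: "infinite {y. c \<le> prob {x \<in> space M. I x = y}}"
  obtain n :: nat where n: "1 / c < real n" using reals_Archimedean2 by blast
  obtain F where F: "F \<subseteq> {y. c \<le> prob {x \<in> space M. I x = y}}" "finite F" "card F = n"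
    using infinite_arbitrarily_large[OF inf] by blast
  have "real n * c = (\<Sum>y\<in>F. c)" using F by simp
  also have "\<dots> \<le> (\<Sum>y\<in>F. prob {x \<in> space M. I x = y})" using F by (intro sum_mono) auto
  also have "\<dots> = prob (\<Union>y\<in>F. {x \<in> space M. I x = y})"
    using F by (intro finite_measure_finite_Union[symmetric]) (auto simp: disjoint_family_on_def)
  also have "\<dots> \<le> 1" by (rule prob_le_1)
  finally show False using n c by (simp add: divide_less_eq)
qed

section \<open>Splitting the integral at a dyadic time\<close>

context levy_integral
begin

text \<open>On a fine grid the Riemann sum splits at T = m / 2^q by
  \<open>exp_riemann_sum_add\<close>. After multiplication by exp (\<xi>_T) the part after T depends
  on later increments only and has the constant coefficient \<open>v\<close>, so it factors off; by
  stationarity it has the law of the Riemann sum up to m' / 2^q. All three expectations converge as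
  the grid is refined.\<close>

lemma char_J_split:
  shows "(\<integral>\<omega>. cis (v * ((J (real (m + m') / 2 ^ q) \<omega> - a) * exp (X (real m / 2 ^ q) \<omega> $ 1))) \<partial>M)
    = (\<integral>\<omega>. cis (v * J (real m' / 2 ^ q) \<omega>) \<partial>M) * (\<integral>\<omega>. cis (- (v * ((a - J (real m / 2 ^ q) \<omega>) * exp (X (real m / 2 ^ q) \<omega> $ 1)))) \<partial>M)"
proof -
  let ?T = "real m / 2 ^ q"
  have [measurable]: "X ?T \<in> borel_measurable M" "J ?T \<in> borel_measurable M" by simp_all
  let ?rs = "\<lambda>n N \<omega>. exp_riemann_sum (\<lambda>i. inc n i \<omega>) N"
  let ?E = "\<lambda>\<omega>. exp (X ?T \<omega> $ 1)"
  have l1: "(\<lambda>n. \<integral>\<omega>. cis (- v * a * ?E \<omega> + v * ?E \<omega> * ?rs n ((m + m') * 2 ^ (n - q)) \<omega>) \<partial>M)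
     \<longlonglongrightarrow> (\<integral>\<omega>. cis (- v * a * ?E \<omega> + v * ?E \<omega> * J (real (m + m') / 2 ^ q) \<omega>) \<partial>M)"
    by (rule char_J_conv) measurable
  have l2: "(\<lambda>n. \<integral>\<omega>. cis (0 + v * ?rs n (m' * 2 ^ (n - q)) \<omega>) \<partial>M) \<longlonglongrightarrow> (\<integral>\<omega>. cis (0 + v * J (real m' / 2 ^ q) \<omega>) \<partial>M)"
    by (rule char_J_conv) measurable
  have l3: "(\<lambda>n. \<integral>\<omega>. cis (- v * a * ?E \<omega> + v * ?E \<omega> * ?rs n (m * 2 ^ (n - q)) \<omega>) \<partial>M)
     \<longlonglongrightarrow> (\<integral>\<omega>. cis (- v * a * ?E \<omega> + v * ?E \<omega> * J ?T \<omega>) \<partial>M)"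
    by (rule char_J_conv) measurable
  have "(\<integral>\<omega>. cis (- v * a * ?E \<omega> + v * ?E \<omega> * ?rs n ((m + m') * 2 ^ (n - q)) \<omega>) \<partial>M)
      = (\<integral>\<omega>. cis (0 + v * ?rs n (m' * 2 ^ (n - q)) \<omega>) \<partial>M) * (\<integral>\<omega>. cis (- v * a * ?E \<omega> + v * ?E \<omega> * ?rs n (m * 2 ^ (n - q)) \<omega>) \<partial>M)"
    if n: "q \<le> n" for n
  proof -
    define N N' where "N = m * 2 ^ (n - q)" and "N' = m' * 2 ^ (n - q)"
    have N: "real N / 2 ^ n = ?T"
    proof -
      have "(2::real) ^ n = 2 ^ q * 2 ^ (n - q)" using n by (simp add: power_add[symmetric])
      then show ?thesis by (simp add: N_def)
    qed
    let ?B = "borel :: (real^2) measure"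
    let ?P = "PiM {..<N} (\<lambda>_. ?B)" and ?P' = "PiM {N..<N + N'} (\<lambda>_. ?B)"
    let ?Y = "\<lambda>\<omega>. \<lambda>i\<in>{..<N}. inc n i \<omega>" and ?Y' = "\<lambda>\<omega>. \<lambda>i\<in>{N..<N + N'}. inc n i \<omega>"
    have iv: "indep_var ?P ?Y ?P' ?Y'"
      by (rule indep_var_restrict[OF indep_inc[of n "N + N'"]]) auto
    define f where "f = (\<lambda>y::nat \<Rightarrow> real^2. cis (v * ((exp_riemann_sum y N - a) * exp ((\<Sum>j<N. y j) $ 1))))"
    define w where "w = (\<lambda>y::nat \<Rightarrow> real^2. exp_riemann_sum (\<lambda>i. y (N + i)) N')"
    have rs_meas: "(\<lambda>y. exp_riemann_sum y N) \<in> borel_measurable (PiM {..<N} (\<lambda>_. ?B))" for N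
      unfolding exp_riemann_sum_def
    proof (intro borel_measurable_sum)
      fix i assume "i \<in> {..<N}"
      then have "\<And>j. j \<in> {..<i} \<Longrightarrow> (\<lambda>y. y j) \<in> borel_measurable (PiM {..<N} (\<lambda>_. ?B))"
         "(\<lambda>y. y i) \<in> borel_measurable (PiM {..<N} (\<lambda>_. ?B))"
        by (auto intro!: measurable_component_singleton)
      then show "(\<lambda>y. exp (- (\<Sum>j<i. y j) $ 1) * y i $ 2) \<in> borel_measurable (PiM {..<N} (\<lambda>_. ?B))" by measurable
    qed
    have S_meas: "(\<lambda>y. \<Sum>j<N. y j) \<in> borel_measurable ?P"
      by (intro borel_measurable_sum measurable_component_singleton) auto
    have fm: "f \<in> borel_measurable ?P"
      unfolding f_def cis_conv_exp using rs_meas[of N] S_meas by measurable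
    have wm: "w \<in> borel_measurable ?P'"
      unfolding w_def exp_riemann_sum_def
    proof (intro borel_measurable_sum)
      fix i assume "i \<in> {..<N'}"
      then have "\<And>j. j \<in> {..<i} \<Longrightarrow> (\<lambda>y. y (N + j)) \<in> borel_measurable ?P'"
         "(\<lambda>y. y (N + i)) \<in> borel_measurable ?P'"
        by (auto intro!: measurable_component_singleton)
      then show "(\<lambda>y. exp (- (\<Sum>j<i. y (N + j)) $ 1) * y (N + i) $ 2) \<in> borel_measurable ?P'" by measurable
    qed
    have rs_cong: "exp_riemann_sum d K = exp_riemann_sum d' K" if "\<And>i. i < K \<Longrightarrow> d i = d' i" for d d' K
      unfolding exp_riemann_sum_def using that by (intro sum.cong refl arg_cong2[of _ _ _ _ "(*)"] arg_cong[of _ _ exp] arg_cong[of _ _ uminus] arg_cong[of _ _ "\<lambda>z. z $ _"]) auto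
    have fY: "f (?Y \<omega>) = cis (v * ((?rs n N \<omega> - a) * exp ((\<Sum>j<N. inc n j \<omega>) $ 1)))" for \<omega>
    proof -
      have "exp_riemann_sum (?Y \<omega>) N = ?rs n N \<omega>" by (rule rs_cong) simp
      then show ?thesis by (simp add: f_def)
    qed
    have wY: "w (?Y' \<omega>) = exp_riemann_sum (\<lambda>i. inc n (N + i) \<omega>) N'" for \<omega>
      unfolding w_def by (rule rs_cong) simp
    \<comment> \<open>Stationarity for blocks: independence and equal marginals give the increments
      after T the joint law of the first \<open>N'\<close> increments.\<close>
    have shift: "(\<integral>\<omega>. cis (v * exp_riemann_sum (\<lambda>i. inc n (N + i) \<omega>) N') \<partial>M) = (\<integral>\<omega>. cis (v * ?rs n N' \<omega>) \<partial>M)"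
    proof -
      let ?Q = "PiM {..<N'} (\<lambda>_. ?B)"
      have D: "distr M ?Q (\<lambda>\<omega>. \<lambda>i\<in>{..<N'}. inc n (N + i) \<omega>) = distr M ?Q (\<lambda>\<omega>. \<lambda>i\<in>{..<N'}. inc n i \<omega>)"
        by (rule distr_restrict_eq[OF indep_inc_shift indep_inc]) (simp add: distr_inc)
      have m1: "(\<lambda>y. cis (v * exp_riemann_sum y N')) \<in> borel_measurable ?Q"
        unfolding cis_conv_exp using rs_meas[of N'] by measurable
      have "(\<integral>\<omega>. cis (v * exp_riemann_sum (\<lambda>i. inc n (N + i) \<omega>) N') \<partial>M)
          = (\<integral>\<omega>. cis (v * exp_riemann_sum (\<lambda>i\<in>{..<N'}. inc n (N + i) \<omega>) N') \<partial>M)"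
        by (intro Bochner_Integration.integral_cong refl arg_cong[of _ _ cis] arg_cong[of _ _ "(*) v"] rs_cong) simp
      also have "\<dots> = (\<integral>y. cis (v * exp_riemann_sum y N') \<partial>distr M ?Q (\<lambda>\<omega>. \<lambda>i\<in>{..<N'}. inc n (N + i) \<omega>))"
        by (subst integral_distr[OF _ m1]) (auto intro!: measurable_restrict)
      also have "\<dots> = (\<integral>\<omega>. cis (v * exp_riemann_sum (\<lambda>i\<in>{..<N'}. inc n i \<omega>) N') \<partial>M)"
        unfolding D by (subst integral_distr[OF _ m1]) (auto intro!: measurable_restrict)
      also have "\<dots> = (\<integral>\<omega>. cis (v * ?rs n N' \<omega>) \<partial>M)"
        by (intro Bochner_Integration.integral_cong refl arg_cong[of _ _ cis] arg_cong[of _ _ "(*) v"] rs_cong) simp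
      finally show ?thesis .
    qed
    have ST: "AE \<omega> in M. X ?T \<omega> = (\<Sum>j<N. inc n j \<omega>)"
      using AE_X_eq_sum by eventually_elim (simp add: N[symmetric])
    have "(\<integral>\<omega>. cis (- v * a * ?E \<omega> + v * ?E \<omega> * ?rs n (N + N') \<omega>) \<partial>M)
        = (\<integral>\<omega>. f (?Y \<omega>) * cis (v * w (?Y' \<omega>)) \<partial>M)"
    proof (rule integral_cong_AE)
      show "(\<lambda>\<omega>. cis (- v * a * ?E \<omega> + v * ?E \<omega> * ?rs n (N + N') \<omega>)) \<in> borel_measurable M"
        unfolding cis_conv_exp by measurable
      show "(\<lambda>\<omega>. f (?Y \<omega>) * cis (v * w (?Y' \<omega>))) \<in> borel_measurable M"
        unfolding fY wY cis_conv_exp by measurable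
      show "AE \<omega> in M. cis (- v * a * ?E \<omega> + v * ?E \<omega> * ?rs n (N + N') \<omega>) = f (?Y \<omega>) * cis (v * w (?Y' \<omega>))"
        using ST
      proof eventually_elim
        case (elim \<omega>)
        have "exp ((\<Sum>j<N. inc n j \<omega>) $ 1) * exp (- (\<Sum>j<N. inc n j \<omega>) $ 1) = 1"
          by (simp add: exp_add[symmetric])
        \<comment> \<open>\<open>E'\<close> stands for exp (-\<xi>_T). It cancels the factor
          \<open>E\<close>, so the later block keeps only the constant \<open>v\<close>.\<close>
        moreover have "- v * a * E + v * E * (R + E' * R') = v * ((R - a) * E) + v * R'" if "E * E' = 1" for E E' R R' :: real
          using that by algebra
        ultimately show ?case
          unfolding fY wY elim exp_riemann_sum_add cis_mult by simp
      qed
    qed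
    also have "\<dots> = (\<integral>\<omega>. f (?Y \<omega>) * (\<integral>\<omega>'. cis (v * w (?Y' \<omega>')) \<partial>M) \<partial>M)"
      using expectation_cis_indep[OF iv fm _ wm, of "\<lambda>_. v"] by (simp add: f_def)
    also have "\<dots> = (\<integral>\<omega>. f (?Y \<omega>) \<partial>M) * (\<integral>\<omega>. cis (v * ?rs n N' \<omega>) \<partial>M)"
      unfolding wY shift by simp
    also have "(\<integral>\<omega>. f (?Y \<omega>) \<partial>M) = (\<integral>\<omega>. cis (- v * a * ?E \<omega> + v * ?E \<omega> * ?rs n N \<omega>) \<partial>M)"
    proof (rule integral_cong_AE)
      show "AE \<omega> in M. f (?Y \<omega>) = cis (- v * a * ?E \<omega> + v * ?E \<omega> * ?rs n N \<omega>)"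
        using ST by eventually_elim (simp add: fY algebra_simps)
    qed (unfold fY cis_conv_exp, measurable)
    finally show ?thesis unfolding N_def N'_def by (simp add: add_mult_distrib mult.commute)
  qed
  note split = this
  have ev: "\<forall>\<^sub>F n in sequentially. (\<integral>\<omega>. cis (0 + v * ?rs n (m' * 2 ^ (n - q)) \<omega>) \<partial>M) * (\<integral>\<omega>. cis (- v * a * ?E \<omega> + v * ?E \<omega> * ?rs n (m * 2 ^ (n - q)) \<omega>) \<partial>M)
      = (\<integral>\<omega>. cis (- v * a * ?E \<omega> + v * ?E \<omega> * ?rs n ((m + m') * 2 ^ (n - q)) \<omega>) \<partial>M)"
    using eventually_ge_at_top[of q] by eventually_elim (rule split[symmetric])
  from LIMSEQ_unique[OF l1 Lim_transform_eventually[OF tendsto_mult[OF l2 l3] ev]]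
  show ?thesis by (simp add: algebra_simps)
qed

end

subsection \<open>The condition on the triplet\<close>

lemma Re_mult_two_power: "Re (z * 2 ^ q) = Re z * 2 ^ q" and Im_mult_two_power: "Im (z * 2 ^ q) = Im z * 2 ^ q"
proof -
  have "z * 2 ^ q = (2 ^ q) *\<^sub>R z" by (simp add: scaleR_conv_of_real mult.commute)
  then show "Re (z * 2 ^ q) = Re z * 2 ^ q" "Im (z * 2 ^ q) = Im z * 2 ^ q" by simp_all
qed

text \<open>The coefficients 1 and 0 are written out so that \<alpha> and \<beta> are found by
  unification when the fact is passed to \<open>generator_dyadic\<close>.\<close>

lemma little_square_sin: "little_square (\<lambda>w::real. sin w - 1 * w - 0 * w\<^sup>2)"
  by (rule little_square_cubic[of _ 1]) (use abs_sin_minus_le_cube in auto)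

lemma little_square_cos: "little_square (\<lambda>w::real. (1 - cos (u * w)) - 0 * w - u\<^sup>2 / 2 * w\<^sup>2)"
proof (rule little_square_cubic[of _ "\<bar>u\<bar> ^ 3"])
  fix w :: real
  define x where "x = u * w"
  have "\<bar>Re (iexp x - (\<Sum>k\<le>2. (\<i> * x) ^ k / fact k))\<bar> \<le> \<bar>x\<bar> ^ 3 / 6"
    using order_trans[OF abs_Re_le_cmod iexp_approx1[of x 2]] by (simp add: fact_numeral eval_nat_numeral)
  moreover have "Re (iexp x - (\<Sum>k\<le>2. (\<i> * x) ^ k / fact k)) = - ((1 - cos x) - x\<^sup>2 / 2)"
    by (simp add: numeral_2_eq_2 cis_conv_exp[symmetric] power2_eq_square)
  ultimately have "\<bar>(1 - cos x) - x\<^sup>2 / 2\<bar> \<le> \<bar>x\<bar> ^ 3 / 6" by (simp only: abs_minus_cancel)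
  moreover have "0 \<le> \<bar>x\<bar> ^ 3" by simp
  ultimately have "\<bar>(1 - cos x) - x\<^sup>2 / 2\<bar> \<le> \<bar>x\<bar> ^ 3" by linarith
  then show "\<bar>(1 - cos (u * w)) - 0 * w - u\<^sup>2 / 2 * w\<^sup>2\<bar> \<le> \<bar>u\<bar> ^ 3 * norm w ^ 3"
    by (simp add: x_def power_mult_distrib abs_mult)
qed

lemma little_square_rational: "little_square (\<lambda>w::real. w\<^sup>2 / (1 + w\<^sup>2) - 0 * w - 1 * w\<^sup>2)"
proof (rule little_square_cubic[of _ 1])
  fix w :: real assume w: "norm w \<le> 1"
  have pos: "0 < 1 + w\<^sup>2" by (simp add: add_pos_nonneg)
  then have "w\<^sup>2 / (1 + w\<^sup>2) - w\<^sup>2 = - (w ^ 4 / (1 + w\<^sup>2))"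
    by (simp add: field_simps power2_eq_square power4_eq_xxxx)
  then have "\<bar>w\<^sup>2 / (1 + w\<^sup>2) - 0 * w - 1 * w\<^sup>2\<bar> = w ^ 4 / (1 + w\<^sup>2)"
    using pos by (simp add: abs_divide)
  also have "\<dots> \<le> w ^ 4" using pos by (simp add: divide_le_eq mult_left_le distrib_left)
  also have "\<dots> = \<bar>w\<bar> ^ 4" by simp
  also have "\<dots> \<le> \<bar>w\<bar> ^ 3" using w by (intro power_decreasing) auto
  finally show "\<bar>w\<^sup>2 / (1 + w\<^sup>2) - 0 * w - 1 * w\<^sup>2\<bar> \<le> 1 * norm w ^ 3" by simp
qed

section \<open>Degeneracy of the triplet along a curve\<close>

context bivariate_levy
begin

text \<open>The generator of \<open>X\<close> at \<open>0\<close>, applied to functions of \<open>first_integral k\<close>, vanishes.\<close>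
definition degenerate :: "real \<Rightarrow> bool" where
  "degenerate k \<longleftrightarrow> gradient k \<bullet> (S *v gradient k) = 0 \<and> (AE z in L. first_integral k z = 0) \<and>
     g \<bullet> gradient k + k * S $ 1 $ 1 / 2 = (\<integral>z. (z \<bullet> gradient k) * (if norm z \<le> 1 then 1 else 0) \<partial>L)"

lemma integral_on_null_first_integral:
  assumes ae: "AE z in L. first_integral k z = 0" and F: "F 0 = 0" and [measurable]: "F \<in> borel_measurable borel"
  shows "(\<integral>z. F (first_integral k z) - \<alpha> * (z \<bullet> gradient k) * (if norm z \<le> 1 then 1 else 0) \<partial>L)
    = - \<alpha> * (\<integral>z. (z \<bullet> gradient k) * (if norm z \<le> 1 then 1 else 0) \<partial>L)"
proof -
  have "(\<integral>z. F (first_integral k z) - \<alpha> * (z \<bullet> gradient k) * (if norm z \<le> 1 then 1 else 0) \<partial>L)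
    = (\<integral>z. - \<alpha> * ((z \<bullet> gradient k) * (if norm z \<le> 1 then 1 else 0)) \<partial>L)"
  proof (rule integral_cong_AE)
    show "AE z in L. F (first_integral k z) - \<alpha> * (z \<bullet> gradient k) * (if norm z \<le> 1 then 1 else 0)
      = - \<alpha> * ((z \<bullet> gradient k) * (if norm z \<le> 1 then 1 else 0))"
      using ae by eventually_elim (simp add: F)
  qed measurable
  then show ?thesis by (simp only: integral_mult_right_zero)
qed

lemma gradient_form: "gradient k \<bullet> (S *v gradient k) = k\<^sup>2 * S $ 1 $ 1 - k * S $ 1 $ 2 - k * S $ 2 $ 1 + S $ 2 $ 2"
  by (simp add: gradient_def inner_vec_def matrix_vector_mult_def sum_2 power2_eq_square algebra_simps)

lemma S_sym: "S $ 1 $ 2 = S $ 2 $ 1"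
proof -
  have "transpose S = S" using triplet by (simp add: levy_triplet_def)
  then have "transpose S $ 1 $ 2 = S $ 1 $ 2" by simp
  then show ?thesis by (simp add: transpose_def)
qed

text \<open>If a positive semidefinite form vanishes at a vector, that vector lies in its kernel,
  since otherwise the form would become negative along some line through it. The kernel equations
  S21 = k S11 and S22 = k S12, with symmetry, are the stated shape of \<open>S\<close>.\<close>

lemma gradient_form_eq_0_iff:
  "gradient k \<bullet> (S *v gradient k) = 0 \<longleftrightarrow>
    S = (\<chi> i j. (if i = 1 \<and> j = 1 then 1 else if i = 2 \<and> j = 2 then k\<^sup>2 else k) * (S $ 1 $ 1))"
proof
  assume 0: "gradient k \<bullet> (S *v gradient k) = 0"
  \<comment> \<open>For small \<open>s\<close> of the sign opposite to \<open>b\<close> the linear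
    term dominates; s = -b / (\<bar>c\<bar> + 1) is small enough.\<close>
  have lin: "b = 0" if "\<And>s. 0 \<le> 2 * s * b + s\<^sup>2 * c" for b c :: real
  proof (rule ccontr)
    assume "b \<noteq> 0"
    define s where "s = - b / (\<bar>c\<bar> + 1)"
    have "s\<^sup>2 * c \<le> s\<^sup>2 * (\<bar>c\<bar> + 1)" by (intro mult_left_mono) auto
    also have "\<dots> = - s * b" by (simp add: s_def power2_eq_square)
    finally have "2 * s * b + s\<^sup>2 * c \<le> s * b" by linarith
    moreover have "s * b = - (b\<^sup>2 / (\<bar>c\<bar> + 1))" by (simp add: s_def power2_eq_square)
    moreover have "0 < b\<^sup>2 / (\<bar>c\<bar> + 1)" using \<open>b \<noteq> 0\<close> by (intro divide_pos_pos) auto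
    ultimately show False using that[of s] by linarith
  qed
  have "gradient k \<bullet> (S *v v) = 0" for v
  proof (rule lin)
    fix s :: real
    have sym: "v \<bullet> (S *v gradient k) = gradient k \<bullet> (S *v v)"
      using S_sym by (simp add: inner_vec_def matrix_vector_mult_def sum_2 algebra_simps)
    have "0 \<le> (gradient k + s *\<^sub>R v) \<bullet> (S *v (gradient k + s *\<^sub>R v))"
      using triplet by (simp add: levy_triplet_def)
    also have "\<dots> = 2 * s * (gradient k \<bullet> (S *v v)) + s\<^sup>2 * (v \<bullet> (S *v v))"
      using 0 sym by (simp add: matrix_vector_right_distrib matrix_vector_mult_scaleR inner_add_left inner_add_right power2_eq_square algebra_simps)
    finally show "0 \<le> 2 * s * (gradient k \<bullet> (S *v v)) + s\<^sup>2 * (v \<bullet> (S *v v))" .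
  qed
  from this[of "axis 1 1"] this[of "axis 2 1"]
  have "S $ 2 $ 1 = k * S $ 1 $ 1" "S $ 2 $ 2 = k * S $ 1 $ 2"
    by (simp_all add: gradient_def inner_vec_def matrix_vector_mult_def sum_2 axis_def)
  then show "S = (\<chi> i j. (if i = 1 \<and> j = 1 then 1 else if i = 2 \<and> j = 2 then k\<^sup>2 else k) * (S $ 1 $ 1))"
    using S_sym by (simp add: vec_eq_iff forall_2 power2_eq_square)
next
  assume "S = (\<chi> i j. (if i = 1 \<and> j = 1 then 1 else if i = 2 \<and> j = 2 then k\<^sup>2 else k) * (S $ 1 $ 1))"
  then have "S $ 1 $ 2 = k * S $ 1 $ 1" "S $ 2 $ 1 = k * S $ 1 $ 1" "S $ 2 $ 2 = k\<^sup>2 * S $ 1 $ 1"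
    unfolding vec_eq_iff forall_2 by simp_all
  then show "gradient k \<bullet> (S *v gradient k) = 0"
    unfolding gradient_form by (simp add: power2_eq_square)
qed

lemma AE_first_integral_iff:
  "(AE z in L. first_integral k z = 0) \<longleftrightarrow> emeasure L (space L - {z. z $ 2 = k * (1 - exp (- (z $ 1)))}) = 0"
proof -
  have "{z \<in> space L. \<not> first_integral k z = 0} = space L - {z. z $ 2 = k * (1 - exp (- (z $ 1)))}"
    by (auto simp: first_integral_def)
  moreover have "{z \<in> space L. \<not> first_integral k z = 0} \<in> sets L" by measurable
  ultimately show ?thesis by (subst AE_iff_measurable[OF _ refl]) simp_all
qed

text \<open>On the curve, z \<bullet> gradient k equals -k (exp (-x) - 1 + x), and |z| \<le> 1
  becomes x^2 + k^2 (1 - exp (-x))^2 \<le> 1. This is the origin of the domain of integration in the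
  drift condition.\<close>

lemma integral_drift:
  assumes ae: "AE z in L. first_integral k z = 0"
  shows "(\<integral>z. (z \<bullet> gradient k) * (if norm z \<le> 1 then 1 else 0) \<partial>L) =
    - k * set_lebesgue_integral (first_levy_measure L) {x. x\<^sup>2 + k\<^sup>2 * (1 - exp (- x))\<^sup>2 \<le> 1} (\<lambda>x. exp (- x) - 1 + x)"
proof -
  let ?A = "{x::real. x\<^sup>2 + k\<^sup>2 * (1 - exp (- x))\<^sup>2 \<le> 1}"
  let ?f = "\<lambda>x::real. indicator ?A x *\<^sub>R (exp (- x) - 1 + x)"
  have [measurable]: "?f \<in> borel_measurable borel" by measurable
  have "{z \<in> space L. z $ 1 \<noteq> 0} \<in> sets L" by measurable
  then have [measurable]: "{z::real^2. z $ 1 \<noteq> 0} \<in> sets L" by simp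
  have m1: "(\<lambda>z. z $ 1) \<in> measurable (restrict_space L {z. z $ 1 \<noteq> 0}) borel"
    by (rule measurable_restrict_space1) measurable
  have "set_lebesgue_integral (first_levy_measure L) ?A (\<lambda>x. exp (- x) - 1 + x)
      = (\<integral>z. ?f (z $ 1) \<partial>restrict_space L {z. z $ 1 \<noteq> 0})"
    unfolding set_lebesgue_integral_def first_levy_measure_def
    by (rule integral_distr[OF m1]) measurable
  also have "\<dots> = (\<integral>z. indicator {z. z $ 1 \<noteq> 0} z *\<^sub>R ?f (z $ 1) \<partial>L)"
    by (rule integral_restrict_space) simp
  \<comment> \<open>Points with z1 = 0 contribute nothing, as exp (-x) - 1 + x vanishes at x =
    0.\<close>
  also have "\<dots> = (\<integral>z. ?f (z $ 1) \<partial>L)"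
    by (intro Bochner_Integration.integral_cong) (auto simp: indicator_def)
  finally have I: "set_lebesgue_integral (first_levy_measure L) ?A (\<lambda>x. exp (- x) - 1 + x) = (\<integral>z. ?f (z $ 1) \<partial>L)" .
  have "(\<integral>z. (z \<bullet> gradient k) * (if norm z \<le> 1 then 1 else 0) \<partial>L) = (\<integral>z. - k * ?f (z $ 1) \<partial>L)"
  proof (rule integral_cong_AE)
    show "AE z in L. (z \<bullet> gradient k) * (if norm z \<le> 1 then 1 else 0) = - k * ?f (z $ 1)"
      using ae
    proof eventually_elim
      case (elim z)
      then have z2: "z $ 2 = k * (1 - exp (- (z $ 1)))" by (simp add: first_integral_def)
      have "norm z \<le> 1 \<longleftrightarrow> z $ 1 \<in> ?A"
      proof -
        have "norm z \<le> 1 \<longleftrightarrow> (norm z)\<^sup>2 \<le> 1" by (simp add: abs_square_le_1)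
        then show ?thesis by (simp add: norm_vec2 z2 power_mult_distrib)
      qed
      moreover have "z \<bullet> gradient k = - k * (exp (- (z $ 1)) - 1 + z $ 1)"
        unfolding inner_commute[of z] inner_gradient z2 by (simp add: algebra_simps)
      ultimately show ?case by (simp add: indicator_def)
    qed
  qed measurable
  also have "\<dots> = - k * (\<integral>z. ?f (z $ 1) \<partial>L)" by (rule integral_mult_right_zero)
  finally show ?thesis unfolding I .
qed

text \<open>\<open>g \<bullet> gradient k\<close> is g2 - k g1, so by \<open>integral_drift\<close>
  the drift equation of \<open>degenerate\<close> is the one stated here multiplied by -k.\<close>

lemma degenerate_iff:
  assumes "k \<noteq> 0"
  shows "degenerate k \<longleftrightarrow>
    S = (\<chi> i j. (if i = 1 \<and> j = 1 then 1 else if i = 2 \<and> j = 2 then k\<^sup>2 else k) * (S $ 1 $ 1)) \<and>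
    emeasure L (space L - {z. z $ 2 = k * (1 - exp (- (z $ 1)))}) = 0 \<and>
    g $ 1 - g $ 2 / k = S $ 1 $ 1 / 2 +
      set_lebesgue_integral (first_levy_measure L) {x. x\<^sup>2 + k\<^sup>2 * (1 - exp (- x))\<^sup>2 \<le> 1} (\<lambda>x. exp (- x) - 1 + x)"
proof -
  define D where "D = set_lebesgue_integral (first_levy_measure L) {x. x\<^sup>2 + k\<^sup>2 * (1 - exp (- x))\<^sup>2 \<le> 1} (\<lambda>x. exp (- x) - 1 + x)"
  have "g \<bullet> gradient k + k * S $ 1 $ 1 / 2 = - k * D \<longleftrightarrow> g $ 1 - g $ 2 / k = S $ 1 $ 1 / 2 + D"
    unfolding inner_commute[of g] inner_gradient using assms by (auto simp: field_simps)
  then show ?thesis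
    unfolding degenerate_def gradient_form_eq_0_iff AE_first_integral_iff[symmetric] D_def[symmetric]
    using integral_drift[of k, folded D_def] by auto
qed

end

section \<open>Closed form of the integral and degeneracy\<close>

context levy_integral
begin

lemma generator_dyadic:
  assumes "continuous_on UNIV F" "\<And>w. \<bar>F w\<bar> \<le> B" "little_square (\<lambda>w. F w - \<alpha> * w - \<beta> * w\<^sup>2)"
  shows "(\<lambda>q. (\<integral>\<omega>. F (first_integral k (X (1 / 2 ^ q) \<omega>)) \<partial>M) * 2 ^ q) \<longlonglongrightarrow>
      \<alpha> * (g \<bullet> gradient k + k * S $ 1 $ 1 / 2) + \<beta> * (gradient k \<bullet> (S *v gradient k)) +
      (\<integral>z. F (first_integral k z) - \<alpha> * (z \<bullet> gradient k) * (if norm z \<le> 1 then 1 else 0) \<partial>L)"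
  using filterlim_compose[OF generator_first_integral(2)[OF assms] dyadic_at_right] by simp

text \<open>For test functions with F 0 = 0 the limit in \<open>generator_dyadic\<close> becomes,
  with \<open>L\<close> on the curve, \<alpha> times the defect in the drift equation plus \<beta>
  times the quadratic form. Both vanish, in particular for the two test functions that
  \<open>J_eq_if_generator_0\<close> asks for.\<close>

lemma degenerate_imp_J_eq:
  assumes "degenerate k"
  shows "AE \<omega> in M. \<forall>t>0. J t \<omega> = k * (1 - exp (- (X t \<omega> $ 1)))"
proof (rule J_eq_if_generator_0)
  from assms have d: "gradient k \<bullet> (S *v gradient k) = 0" "AE z in L. first_integral k z = 0"
     "g \<bullet> gradient k + k * S $ 1 $ 1 / 2 = (\<integral>z. (z \<bullet> gradient k) * (if norm z \<le> 1 then 1 else 0) \<partial>L)"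
    by (auto simp: degenerate_def)
  have "(\<lambda>q. (\<integral>\<omega>. sin (first_integral k (X (1 / 2 ^ q) \<omega>)) \<partial>M) * 2 ^ q) \<longlonglongrightarrow>
      1 * (g \<bullet> gradient k + k * S $ 1 $ 1 / 2) + 0 * (gradient k \<bullet> (S *v gradient k)) +
      (\<integral>z. sin (first_integral k z) - 1 * (z \<bullet> gradient k) * (if norm z \<le> 1 then 1 else 0) \<partial>L)"
    by (rule generator_dyadic[OF _ _ little_square_sin, where B=1]) (auto intro: continuous_intros)
  also have "(\<integral>z. sin (first_integral k z) - 1 * (z \<bullet> gradient k) * (if norm z \<le> 1 then 1 else 0) \<partial>L)
      = - 1 * (\<integral>z. (z \<bullet> gradient k) * (if norm z \<le> 1 then 1 else 0) \<partial>L)"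
    by (rule integral_on_null_first_integral[OF d(2)]) auto
  finally show "(\<lambda>q. (\<integral>\<omega>. sin (first_integral k (X (1 / 2 ^ q) \<omega>)) \<partial>M) * 2 ^ q) \<longlonglongrightarrow> 0"
    using d(3) by simp
  have "(\<lambda>q. (\<integral>\<omega>. (first_integral k (X (1 / 2 ^ q) \<omega>))\<^sup>2 / (1 + (first_integral k (X (1 / 2 ^ q) \<omega>))\<^sup>2) \<partial>M) * 2 ^ q) \<longlonglongrightarrow>
      0 * (g \<bullet> gradient k + k * S $ 1 $ 1 / 2) + 1 * (gradient k \<bullet> (S *v gradient k)) +
      (\<integral>z. (first_integral k z)\<^sup>2 / (1 + (first_integral k z)\<^sup>2) - 0 * (z \<bullet> gradient k) * (if norm z \<le> 1 then 1 else 0) \<partial>L)"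
  proof (rule generator_dyadic[of "\<lambda>w. w\<^sup>2 / (1 + w\<^sup>2)" 1])
    have pos: "0 < 1 + w\<^sup>2" for w :: real by (simp add: add_pos_nonneg)
    show "continuous_on UNIV (\<lambda>w::real. w\<^sup>2 / (1 + w\<^sup>2))"
      using pos by (intro continuous_intros) (auto simp: less_imp_neq[THEN not_sym])
    show "\<bar>w\<^sup>2 / (1 + w\<^sup>2)\<bar> \<le> 1" for w :: real using pos[of w] by (simp add: divide_le_eq)
  qed (rule little_square_rational)
  also have "(\<integral>z. (first_integral k z)\<^sup>2 / (1 + (first_integral k z)\<^sup>2) - 0 * (z \<bullet> gradient k) * (if norm z \<le> 1 then 1 else 0) \<partial>L)
      = - 0 * (\<integral>z. (z \<bullet> gradient k) * (if norm z \<le> 1 then 1 else 0) \<partial>L)"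
    by (rule integral_on_null_first_integral[OF d(2), of "\<lambda>w. w\<^sup>2 / (1 + w\<^sup>2)"]) auto
  finally show "(\<lambda>q. (\<integral>\<omega>. (first_integral k (X (1 / 2 ^ q) \<omega>))\<^sup>2 / (1 + (first_integral k (X (1 / 2 ^ q) \<omega>))\<^sup>2) \<partial>M) * 2 ^ q) \<longlonglongrightarrow> 0"
    using d(1) by simp
qed

text \<open>The test functions 1 - cos (u w) come with two nonnegative terms whose sum is 0, so the
  quadratic form vanishes and \<open>L\<close> lives on the curve. Only then does sin w, whose
  integral reduces on the curve to the compensator, yield the drift equation.\<close>

lemma J_eq_imp_degenerate:
  assumes eq: "AE \<omega> in M. \<forall>t>0. J t \<omega> = k * (1 - exp (- (X t \<omega> $ 1)))"
  shows "degenerate k"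
proof -
  let ?p = "first_integral k"
  have pm: "(\<lambda>\<omega>. u * ?p (X (1 / 2 ^ q) \<omega>)) \<in> borel_measurable M" for u q
  proof -
    have [measurable]: "X (1 / 2 ^ q) \<in> borel_measurable M" by simp
    show ?thesis by measurable
  qed
  have cos0: "u\<^sup>2 / 2 * (gradient k \<bullet> (S *v gradient k)) + (\<integral>z. 1 - cos (u * ?p z) \<partial>L) = 0"
    and cosint: "integrable L (\<lambda>z. 1 - cos (u * ?p z))" for u
  proof -
    have c: "continuous_on UNIV (\<lambda>w. 1 - cos (u * w))" by (intro continuous_intros)
    have b: "\<bar>1 - cos (u * w)\<bar> \<le> 2" for w
      using abs_triangle_ineq4[of 1 "cos (u * w)"] abs_cos_le_one[of "u * w"] by simp
    show "integrable L (\<lambda>z. 1 - cos (u * ?p z))"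
      using generator_first_integral(1)[OF c b little_square_cos, of k] by simp
    have "(\<lambda>q. (\<integral>\<omega>. 1 - cos (u * ?p (X (1 / 2 ^ q) \<omega>)) \<partial>M) * 2 ^ q) \<longlonglongrightarrow>
        u\<^sup>2 / 2 * (gradient k \<bullet> (S *v gradient k)) + (\<integral>z. 1 - cos (u * ?p z) \<partial>L)"
      using generator_dyadic[OF c b little_square_cos, of k] by simp
    moreover have "(\<lambda>q. (\<integral>\<omega>. 1 - cos (u * ?p (X (1 / 2 ^ q) \<omega>)) \<partial>M) * 2 ^ q) \<longlonglongrightarrow> 0"
    proof -
      have "(\<integral>\<omega>. 1 - cos (u * ?p (X (1 / 2 ^ q) \<omega>)) \<partial>M) * 2 ^ q
          = - Re (((\<integral>\<omega>. cis (u * ?p (X (1 / 2 ^ q) \<omega>)) \<partial>M) - 1) * 2 ^ q)" for q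
      proof -
        have "integrable M (\<lambda>\<omega>. cos (u * ?p (X (1 / 2 ^ q) \<omega>)))"
          by (rule integrable_const_bound[of _ 1]) (use measurable_compose[OF pm, of cos borel u q] in auto)
        then show ?thesis
          unfolding Re_mult_two_power using Re_expectation_cis(1)[OF pm, of u q] by (simp add: prob_space algebra_simps)
      qed
      then show ?thesis
        using tendsto_minus[OF tendsto_Re[OF small_time_tendsto[OF eq, of u]]] by simp
    qed
    ultimately show "u\<^sup>2 / 2 * (gradient k \<bullet> (S *v gradient k)) + (\<integral>z. 1 - cos (u * ?p z) \<partial>L) = 0"
      by (rule LIMSEQ_unique)
  qed
  have q0: "0 \<le> gradient k \<bullet> (S *v gradient k)" using triplet by (simp add: levy_triplet_def)
  have S0: "gradient k \<bullet> (S *v gradient k) = 0"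
  proof -
    have "0 \<le> (\<integral>z. 1 - cos (?p z) \<partial>L)" by (intro integral_nonneg_AE) simp
    moreover have "(gradient k \<bullet> (S *v gradient k)) / 2 + (\<integral>z. 1 - cos (?p z) \<partial>L) = 0"
      using cos0[of 1] by simp
    ultimately show ?thesis using q0 by linarith
  qed
  have "AE z in L. cos (u * ?p z) = 1" for u
  proof -
    have "(\<integral>z. 1 - cos (u * ?p z) \<partial>L) = 0" using cos0[of u] S0 by simp
    then have "AE z in L. 1 - cos (u * ?p z) = 0"
      using cosint[of u] by (subst (asm) integral_nonneg_eq_0_iff_AE) auto
    then show ?thesis by eventually_elim simp
  qed
  then have "AE z in L. \<forall>m::nat. cos (1 / real (Suc m) * ?p z) = 1"
    unfolding AE_all_countable by blast
  then have ae: "AE z in L. ?p z = 0"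
    by eventually_elim (auto intro: eq_0_if_cos_eq_1)
  have "(\<lambda>q. (\<integral>\<omega>. sin (?p (X (1 / 2 ^ q) \<omega>)) \<partial>M) * 2 ^ q) \<longlonglongrightarrow>
      1 * (g \<bullet> gradient k + k * S $ 1 $ 1 / 2) + 0 * (gradient k \<bullet> (S *v gradient k)) +
      (\<integral>z. sin (?p z) - 1 * (z \<bullet> gradient k) * (if norm z \<le> 1 then 1 else 0) \<partial>L)"
    by (rule generator_dyadic[OF _ _ little_square_sin, where B=1]) (auto intro: continuous_intros)
  also have "(\<integral>z. sin (?p z) - 1 * (z \<bullet> gradient k) * (if norm z \<le> 1 then 1 else 0) \<partial>L)
      = - 1 * (\<integral>z. (z \<bullet> gradient k) * (if norm z \<le> 1 then 1 else 0) \<partial>L)"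
    by (rule integral_on_null_first_integral[OF ae]) auto
  finally have l1: "(\<lambda>q. (\<integral>\<omega>. sin (?p (X (1 / 2 ^ q) \<omega>)) \<partial>M) * 2 ^ q) \<longlonglongrightarrow>
      (g \<bullet> gradient k + k * S $ 1 $ 1 / 2) - (\<integral>z. (z \<bullet> gradient k) * (if norm z \<le> 1 then 1 else 0) \<partial>L)"
    by simp
  have l2: "(\<lambda>q. (\<integral>\<omega>. sin (?p (X (1 / 2 ^ q) \<omega>)) \<partial>M) * 2 ^ q) \<longlonglongrightarrow> 0"
  proof -
    have "(\<integral>\<omega>. sin (?p (X (1 / 2 ^ q) \<omega>)) \<partial>M) * 2 ^ q
        = Im (((\<integral>\<omega>. cis (1 * ?p (X (1 / 2 ^ q) \<omega>)) \<partial>M) - 1) * 2 ^ q)" for q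
      unfolding Im_mult_two_power using Re_expectation_cis(2)[OF pm, of 1 q] by simp
    then show ?thesis
      using tendsto_Im[OF small_time_tendsto[OF eq, of 1]] by simp
  qed
  from LIMSEQ_unique[OF l1 l2] show ?thesis
    unfolding degenerate_def using S0 ae by simp
qed

text \<open>Serves to exclude k = 0. In that case \<open>first_integral\<close> is the second
  coordinate, so by \<open>small_time_tendsto\<close> the exponent vanishes on the second axis and
  \<eta> is identically zero.\<close>

lemma J_eq_0_imp_X_2_eq_0:
  assumes eq: "AE \<omega> in M. \<forall>t>0. J t \<omega> = 0"
  shows "AE \<omega> in M. \<forall>t\<ge>0. X t \<omega> $ 2 = 0"
proof -
  have eq': "AE \<omega> in M. \<forall>t>0. J t \<omega> = 0 * (1 - exp (- (X t \<omega> $ 1)))" using eq by simp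
  have \<Psi>0: "\<Psi> (axis 2 u) = 0" for u
  proof -
    have "(\<lambda>q. ((\<integral>\<omega>. cis (axis 2 u \<bullet> X (1 / 2 ^ q) \<omega>) \<partial>M) - 1) / complex_of_real (1 / 2 ^ q)) \<longlonglongrightarrow> \<Psi> (axis 2 u)"
      by (rule filterlim_compose[OF generator_cis dyadic_at_right])
    moreover have "(\<lambda>q. ((\<integral>\<omega>. cis (axis 2 u \<bullet> X (1 / 2 ^ q) \<omega>) \<partial>M) - 1) / complex_of_real (1 / 2 ^ q)) \<longlonglongrightarrow> 0"
      using small_time_tendsto[OF eq', of u] by (simp add: first_integral_def inner_axis')
    ultimately show ?thesis by (rule LIMSEQ_unique)
  qed
  have X0: "AE \<omega> in M. X t \<omega> $ 2 = 0" if t: "0 \<le> t" for t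
  proof (rule AE_eq_0_if_expectation_cis)
    have "X t \<in> borel_measurable M" using t by simp
    then show "(\<lambda>\<omega>. X t \<omega> $ 2) \<in> borel_measurable M" by measurable
    show "(\<integral>\<omega>. cis (u * X t \<omega> $ 2) \<partial>M) = 1" for u
      using expectation_cis_X[OF t, of "axis 2 u"] by (simp add: inner_axis' \<Psi>0)
  qed
  have "AE \<omega> in M. \<forall>m q. X (real m / 2 ^ q) \<omega> $ 2 = 0"
    unfolding AE_all_countable by (intro allI X0) simp
  with AE_cadlag show ?thesis
  proof eventually_elim
    case (elim \<omega>)
    show ?case
    proof (intro allI impI)
      fix t :: real assume t: "0 \<le> t"
      then have "((\<lambda>t. X t \<omega>) \<longlongrightarrow> X t \<omega>) (at_right t)" using elim(1) unfolding cadlag_def by blast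
      from tendsto_vec_nth[OF this, of 2] show "X t \<omega> $ 2 = 0"
        by (rule eq_0_if_eq_0_on_dyadics) (use elim(2) t in auto)
    qed
  qed
qed

end

section \<open>Atoms of maximal mass\<close>

context levy_integral
begin

text \<open>\<open>(I - a) exp (\<xi>\<^sub>T)\<close> is distributed as \<open>I' - (a - J\<^sub>T) exp (\<xi>\<^sub>T)\<close>, where \<open>I'\<close> is an independent copy of \<open>I\<close>.\<close>
lemma emeasure_atom:
  assumes [measurable]: "I \<in> borel_measurable M" and lim: "AE \<omega> in M. ((\<lambda>t. J t \<omega>) \<longlongrightarrow> I \<omega>) at_top"
  shows "emeasure M {\<omega> \<in> space M. I \<omega> = a} =
    (\<integral>\<^sup>+\<omega>. emeasure M {\<omega>' \<in> space M. I \<omega>' = (a - J (real m / 2 ^ q) \<omega>) * exp (X (real m / 2 ^ q) \<omega> $ 1)} \<partial>M)"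
proof -
  let ?T = "real m / 2 ^ q"
  have [measurable]: "X ?T \<in> borel_measurable M" "J ?T \<in> borel_measurable M" by simp_all
  let ?E = "\<lambda>\<omega>. exp (X ?T \<omega> $ 1)"
  have "emeasure M {\<omega> \<in> space M. (I \<omega> - a) * ?E \<omega> = 0} =
    (\<integral>\<^sup>+\<omega>. emeasure M {\<omega>' \<in> space M. I \<omega>' = (a - J ?T \<omega>) * ?E \<omega>} \<partial>M)"
  proof (rule emeasure_indep_eq(2))
    fix v :: real
    \<comment> \<open>The splitting is applied at the times T + s and s for integer \<open>s\<close>
      (n = m and n = 0), which tend to infinity.\<close>
    have top: "filterlim (\<lambda>s::nat. real (n + s * 2 ^ q) / 2 ^ q) at_top sequentially" for n
    proof -
      have "real (n + s * 2 ^ q) / 2 ^ q = real n / 2 ^ q + real s" for s by (simp add: add_divide_distrib)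
      then show ?thesis by (simp only:) (intro filterlim_tendsto_add_at_top[OF tendsto_const] filterlim_real_sequentially)
    qed
    have Jm[measurable]: "J (real (n + s * 2 ^ q) / 2 ^ q) \<in> borel_measurable M" for n s by simp
    have l1: "(\<lambda>s. \<integral>\<omega>. cis (v * ((J (real (m + s * 2 ^ q) / 2 ^ q) \<omega> - a) * ?E \<omega>)) \<partial>M) \<longlonglongrightarrow> (\<integral>\<omega>. cis (v * ((I \<omega> - a) * ?E \<omega>)) \<partial>M)"
    proof (rule integral_dominated_convergence[where w="\<lambda>_. 1"])
      show "AE \<omega> in M. (\<lambda>s. cis (v * ((J (real (m + s * 2 ^ q) / 2 ^ q) \<omega> - a) * ?E \<omega>))) \<longlonglongrightarrow> cis (v * ((I \<omega> - a) * ?E \<omega>))"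
        using lim
      proof eventually_elim
        case (elim \<omega>)
        from filterlim_compose[OF elim top[of m]] show ?case
          unfolding cis_conv_exp by (intro tendsto_intros)
      qed
    qed (auto simp: cis_conv_exp)
    have l2: "(\<lambda>s. \<integral>\<omega>. cis (v * J (real (0 + s * 2 ^ q) / 2 ^ q) \<omega>) \<partial>M) \<longlonglongrightarrow> (\<integral>\<omega>. cis (v * I \<omega>) \<partial>M)"
    proof (rule integral_dominated_convergence[where w="\<lambda>_. 1"])
      show "AE \<omega> in M. (\<lambda>s. cis (v * J (real (0 + s * 2 ^ q) / 2 ^ q) \<omega>)) \<longlonglongrightarrow> cis (v * I \<omega>)"
        using lim
      proof eventually_elim
        case (elim \<omega>)
        from filterlim_compose[OF elim top[of 0]] show ?case
          unfolding cis_conv_exp by (intro tendsto_intros)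
      qed
      show "(\<lambda>\<omega>. cis (v * J (real (0 + s * 2 ^ q) / 2 ^ q) \<omega>)) \<in> borel_measurable M" for s
        using Jm[of 0 s] unfolding cis_conv_exp by measurable
    qed (auto simp: cis_conv_exp)
    show "(\<integral>\<omega>. cis (v * ((I \<omega> - a) * ?E \<omega>)) \<partial>M) = (\<integral>\<omega>. cis (v * I \<omega>) \<partial>M) * (\<integral>\<omega>. cis (- (v * ((a - J ?T \<omega>) * ?E \<omega>))) \<partial>M)"
    proof (rule LIMSEQ_unique[OF l1])
      show "(\<lambda>s. \<integral>\<omega>. cis (v * ((J (real (m + s * 2 ^ q) / 2 ^ q) \<omega> - a) * ?E \<omega>)) \<partial>M)
        \<longlonglongrightarrow> (\<integral>\<omega>. cis (v * I \<omega>) \<partial>M) * (\<integral>\<omega>. cis (- (v * ((a - J ?T \<omega>) * ?E \<omega>))) \<partial>M)"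
        unfolding char_J_split using tendsto_mult_right[OF l2] by simp
    qed
  qed measurable
  then show ?thesis by simp
qed

text \<open>A maximum principle: by \<open>emeasure_atom\<close> the mass function satisfies p b = E
  p (U_b), and an average of values below the maximum reaches it only if almost every value does. So
  U_b stays among the atoms of maximal mass. For two of them the difference of U_b and U_a at time m
  is (b - a) exp (\<xi>_m), which is unbounded although the set of these atoms is finite.\<close>

lemma atom_imp_J_eq:
  assumes I[measurable]: "I \<in> borel_measurable M" and lim: "AE \<omega> in M. ((\<lambda>t. J t \<omega>) \<longlongrightarrow> I \<omega>) at_top"
    and atom: "0 < prob {\<omega> \<in> space M. I \<omega> = c}"
    and top: "AE \<omega> in M. filterlim (\<lambda>t. X t \<omega> $ 1) at_top at_top"
  shows "\<exists>k. AE \<omega> in M. \<forall>t>0. J t \<omega> = k * (1 - exp (- (X t \<omega> $ 1)))"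
proof -
  define p where "p = (\<lambda>y. prob {\<omega> \<in> space M. I \<omega> = y})"
  have p_e: "emeasure M {\<omega> \<in> space M. I \<omega> = y} = ennreal (p y)" for y
    by (simp add: p_def emeasure_eq_measure)
  have [measurable]: "p \<in> borel_measurable borel"
  proof -
    have "(\<lambda>y. emeasure M {x \<in> space M. I x = y}) \<in> borel_measurable borel"
    proof (rule emeasure_indep_eq(1)[of I "\<lambda>_. 0" I])
      show "(\<integral>x. cis (v * I x) \<partial>M) = (\<integral>x. cis (v * I x) \<partial>M) * (\<integral>x. cis (- (v * 0)) \<partial>M)" for v
        by (simp add: prob_space)
    qed auto
    then have "(\<lambda>y. enn2real (emeasure M {x \<in> space M. I x = y})) \<in> borel_measurable borel" by measurable
    then show ?thesis by (simp add: p_def measure_def)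
  qed
  have p01: "0 \<le> p y" "p y \<le> 1" for y by (simp_all add: p_def)
  \<comment> \<open>The maximum of \<open>p\<close> is attained, because only finitely many points
    have mass at least \<open>p c\<close>.\<close>
  define A0 where "A0 = {y. p c \<le> p y}"
  have "finite A0" unfolding A0_def p_def by (rule finite_heavy_atoms[OF I atom])
  moreover have "A0 \<noteq> {}" by (auto simp: A0_def)
  ultimately have "Max (p ` A0) \<in> p ` A0" "\<And>y. y \<in> A0 \<Longrightarrow> p y \<le> Max (p ` A0)" by auto
  then obtain a where a: "a \<in> A0" and maxA0: "\<And>y. y \<in> A0 \<Longrightarrow> p y \<le> p a" by auto
  have max: "p y \<le> p a" for y
  proof (cases "y \<in> A0")
    case False
    then show ?thesis using a by (simp add: A0_def)
  qed (rule maxA0)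
  define A where "A = {y. p y = p a}"
  have "finite A" by (rule finite_subset[OF _ \<open>finite A0\<close>]) (use a in \<open>auto simp: A_def A0_def\<close>)
  let ?U = "\<lambda>b m q \<omega>. (b - J (real m / 2 ^ q) \<omega>) * exp (X (real m / 2 ^ q) \<omega> $ 1)"
  have UA: "AE \<omega> in M. ?U b m q \<omega> \<in> A" if "b \<in> A" for b m q
  proof -
    have [measurable]: "X (real m / 2 ^ q) \<in> borel_measurable M" "J (real m / 2 ^ q) \<in> borel_measurable M" by simp_all
    have Um[measurable]: "?U b m q \<in> borel_measurable M" by measurable
    have int: "integrable M (\<lambda>\<omega>. p (?U b m q \<omega>))"
      by (rule integrable_const_bound[of _ 1]) (use p01 in auto)
    have "ennreal (p b) = (\<integral>\<^sup>+\<omega>. ennreal (p (?U b m q \<omega>)) \<partial>M)"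
      using emeasure_atom[OF I lim, of b m q] unfolding p_e .
    also have "\<dots> = ennreal (\<integral>\<omega>. p (?U b m q \<omega>) \<partial>M)"
      by (rule nn_integral_eq_integral[OF int]) (simp add: p01)
    finally have "p b = (\<integral>\<omega>. p (?U b m q \<omega>) \<partial>M)" using p01 by (subst (asm) ennreal_inj) (auto intro: integral_nonneg_AE)
    then have "(\<integral>\<omega>. p a - p (?U b m q \<omega>) \<partial>M) = 0"
      using that int by (simp add: A_def prob_space)
    then have "AE \<omega> in M. p a - p (?U b m q \<omega>) = 0"
      using int max by (subst (asm) integral_nonneg_eq_0_iff_AE) auto
    then show ?thesis by eventually_elim (simp add: A_def)
  qed
  have "a \<in> A" by (simp add: A_def)
  have single: "b = a" if b: "b \<in> A" for b
  proof (rule ccontr)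
    assume "b \<noteq> a"
    have "AE \<omega> in M. \<forall>m. ?U a m 0 \<omega> \<in> A \<and> ?U b m 0 \<omega> \<in> A"
      unfolding AE_all_countable by (intro allI AE_conjI UA \<open>a \<in> A\<close> b)
    with top have "AE \<omega> in M. False"
    proof eventually_elim
      case (elim \<omega>)
      have "bdd_above ((\<lambda>(x, y). \<bar>x - y\<bar>) ` (A \<times> A))" using \<open>finite A\<close> by (intro bdd_above_finite) simp
      then obtain C where "\<forall>d\<in>(\<lambda>(x, y). \<bar>x - y\<bar>) ` (A \<times> A). d \<le> C" unfolding bdd_above_def by blast
      then have C: "\<bar>x - y\<bar> \<le> C" if "x \<in> A" "y \<in> A" for x y
        using that by auto
      have "filterlim (\<lambda>m. X (real m) \<omega> $ 1) at_top sequentially"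
        by (rule filterlim_compose[OF elim(1) filterlim_real_sequentially])
      then have "filterlim (\<lambda>m. exp (X (real m) \<omega> $ 1)) at_top sequentially"
        by (rule filterlim_compose[OF exp_at_top])
      then have "\<forall>\<^sub>F m in sequentially. C / \<bar>b - a\<bar> < exp (X (real m) \<omega> $ 1)"
        unfolding filterlim_at_top_dense by blast
      then obtain m where m: "C / \<bar>b - a\<bar> < exp (X (real m) \<omega> $ 1)"
        using eventually_happens'[OF sequentially_bot] by blast
      have "?U b m 0 \<omega> - ?U a m 0 \<omega> = (b - a) * exp (X (real m) \<omega> $ 1)" by (simp add: algebra_simps)
      moreover have "\<bar>?U b m 0 \<omega> - ?U a m 0 \<omega>\<bar> \<le> C" using elim(2) C by blast
      ultimately have "\<bar>b - a\<bar> * exp (X (real m) \<omega> $ 1) \<le> C" by (simp add: abs_mult)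
      with m \<open>b \<noteq> a\<close> show False by (simp add: divide_less_eq mult.commute)
    qed
    then show False by simp
  qed
  have "AE \<omega> in M. \<forall>t>0. J t \<omega> = a * (1 - exp (- (X t \<omega> $ 1)))"
  proof (rule J_eq_if_eq_on_dyadics)
    fix m q :: nat
    show "AE \<omega> in M. J (real m / 2 ^ q) \<omega> = a * (1 - exp (- (X (real m / 2 ^ q) \<omega> $ 1)))"
      using UA[OF \<open>a \<in> A\<close>, of m q]
    proof eventually_elim
      case (elim \<omega>)
      then have "?U a m q \<omega> = a" using single by blast
      then have "(a - J (real m / 2 ^ q) \<omega>) = a * exp (- (X (real m / 2 ^ q) \<omega> $ 1))"
        by (simp add: exp_minus field_simps)
      then show ?case by (simp add: algebra_simps)
    qed
  qed
  then show ?thesis by blast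
qed

section \<open>The stochastic exponential\<close>

lemma AE_left_lim_exp_dyadic:
  "AE \<omega> in M. \<forall>n i. 0 < i \<longrightarrow> left_lim (\<lambda>u. exp (- (X u \<omega> $ 1))) (real i / 2 ^ n) = exp (- left_lim (\<lambda>u. X u \<omega> $ 1) (real i / 2 ^ n))"
  unfolding AE_all_countable
proof (intro allI)
  fix n i :: nat
  show "AE \<omega> in M. 0 < i \<longrightarrow> left_lim (\<lambda>u. exp (- (X u \<omega> $ 1))) (real i / 2 ^ n) = exp (- left_lim (\<lambda>u. X u \<omega> $ 1) (real i / 2 ^ n))"
  proof (cases "0 < i")
    case True
    then have t: "0 < real i / 2 ^ n" by simp
    show ?thesis using AE_left_lim[OF t]
    proof eventually_elim
      case (elim \<omega>)
      have "((\<lambda>u. exp (- (X u \<omega> $ 1))) \<longlongrightarrow> exp (- (X (real i / 2 ^ n) \<omega> $ 1))) (at_left (real i / 2 ^ n))"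
        by (intro tendsto_intros elim)
      then show ?case using left_lim_eqI[OF t elim] left_lim_eqI[OF t] by simp
    qed
  qed simp
qed

text \<open>By the convention \<open>f(0-) = 0\<close>, the integrand \<open>Z\<^sub>-\<close> of the stochastic exponential vanishes at \<open>0\<close>,
  whereas \<open>exp (- \<xi>\<^sub>-)\<close> equals \<open>1\<close> there. The first term of the Riemann sums accounts for the difference.\<close>
lemma conv_exp:
  assumes t: "0 \<le> t"
  shows "conv_in_prob M (\<lambda>n. riemann_sum (\<lambda>s \<omega>. left_lim (\<lambda>u. exp (- (X u \<omega> $ 1))) s) (\<lambda>t \<omega>. - (X t \<omega> $ 2) / k) n t) (\<lambda>\<omega>. - 1 / k * J t \<omega>)"
proof -
  \<comment> \<open>The first summand of the Riemann sum with integrand exp (-\<xi>_(s-)), whose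
    coefficient at 0 is exp 0 = 1. It tends to 0 by right continuity of the path at 0.\<close>
  define V where "V = (\<lambda>(n::nat) \<omega>. X (min (1 / 2 ^ n) t) \<omega> $ 2 - X 0 \<omega> $ 2)"
  have "conv_in_prob M V (\<lambda>_. 0)"
  proof (rule AE_tendsto_0_imp_conv_in_prob)
    show "V n \<in> borel_measurable M" for n
    proof -
      have [measurable]: "X (min (1 / 2 ^ n) t) \<in> borel_measurable M" "X 0 \<in> borel_measurable M" using t by simp_all
      show ?thesis unfolding V_def by measurable
    qed
    show "AE \<omega> in M. (\<lambda>n. V n \<omega>) \<longlonglongrightarrow> 0"
      using AE_cadlag
    proof eventually_elim
      case (elim \<omega>)
      show ?case
      proof (cases "t = 0")
        case False
        with t have t: "0 < t" by simp
        have "filterlim (\<lambda>n::nat. min (1 / 2 ^ n) t) (at_right 0) sequentially"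
          unfolding filterlim_at
        proof (intro conjI)
          have "(\<lambda>n::nat. min (1 / 2 ^ n) t) \<longlonglongrightarrow> min 0 t"
            using dyadic_at_right unfolding filterlim_at by (intro tendsto_min tendsto_const) blast
          then show "(\<lambda>n::nat. min (1 / 2 ^ n) t) \<longlonglongrightarrow> 0" using t by simp
          show "\<forall>\<^sub>F n::nat in sequentially. min (1 / 2 ^ n) t \<in> {0<..} \<and> min (1 / 2 ^ n) t \<noteq> 0"
            using t by (auto simp: min_def)
        qed
        moreover have "((\<lambda>t. X t \<omega>) \<longlongrightarrow> X 0 \<omega>) (at_right 0)" using elim by (simp add: cadlag_def)
        ultimately have "(\<lambda>n. X (min (1 / 2 ^ n) t) \<omega>) \<longlonglongrightarrow> X 0 \<omega>" by (rule filterlim_compose[rotated])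
        from tendsto_diff[OF tendsto_vec_nth[OF this, of 2] tendsto_const[of "X 0 \<omega> $ 2"]] show ?thesis
          by (simp add: V_def)
      qed (simp add: V_def)
    qed
  qed
  from conv_in_prob_lincomb[OF J_conv[OF t] this, of "- 1 / k"] show ?thesis
  proof (rule conv_in_prob_AE_cong)
    have "AE \<omega> in M. - 1 / k * (riemann_sum (\<lambda>s \<omega>. exp (- left_lim (\<lambda>u. X u \<omega> $ 1) s)) (\<lambda>s \<omega>. X s \<omega> $ 2) n t \<omega> - V n \<omega>)
      = riemann_sum (\<lambda>s \<omega>. left_lim (\<lambda>u. exp (- (X u \<omega> $ 1))) s) (\<lambda>t \<omega>. - (X t \<omega> $ 2) / k) n t \<omega>" for n
      using AE_left_lim_exp_dyadic
    proof eventually_elim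
      case (elim \<omega>)
      define N where "N = nat \<lceil>t * 2 ^ n\<rceil>"
      let ?d = "\<lambda>i. X (min (real (Suc i) / 2 ^ n) t) \<omega> $ 2 - X (min (real i / 2 ^ n) t) \<omega> $ 2"
      let ?e = "\<lambda>i. exp (- left_lim (\<lambda>u. X u \<omega> $ 1) (real i / 2 ^ n))"
      have R: "riemann_sum (\<lambda>s \<omega>. exp (- left_lim (\<lambda>u. X u \<omega> $ 1) s)) (\<lambda>s \<omega>. X s \<omega> $ 2) n t \<omega> = (\<Sum>i<N. ?e i * ?d i)"
        by (simp add: riemann_sum_def N_def)
      have "riemann_sum (\<lambda>s \<omega>. left_lim (\<lambda>u. exp (- (X u \<omega> $ 1))) s) (\<lambda>t \<omega>. - (X t \<omega> $ 2) / k) n t \<omega>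
        = (\<Sum>i<N. (if i = 0 then 0 else ?e i) * (- 1 / k * ?d i))"
        unfolding riemann_sum_def N_def[symmetric]
      proof (rule sum.cong[OF refl])
        fix i
        have l: "left_lim (\<lambda>u. exp (- (X u \<omega> $ 1))) (real i / 2 ^ n) = (if i = 0 then 0 else ?e i)"
          using elim by (auto simp: left_lim_def)
        show "left_lim (\<lambda>u. exp (- (X u \<omega> $ 1))) (real i / 2 ^ n) *
            (- (X (min (real (Suc i) / 2 ^ n) t) \<omega> $ 2) / k - - (X (min (real i / 2 ^ n) t) \<omega> $ 2) / k)
          = (if i = 0 then 0 else ?e i) * (- 1 / k * ?d i)"
          unfolding l by (simp add: diff_divide_distrib)
      qed
      also have "\<dots> = - 1 / k * (\<Sum>i<N. (if i = 0 then 0 else ?e i) * ?d i)"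
        unfolding sum_distrib_left by (intro sum.cong) (auto simp del: of_nat_Suc)
      also have "(\<Sum>i<N. (if i = 0 then 0 else ?e i) * ?d i) = (\<Sum>i<N. ?e i * ?d i) - V n \<omega>"
      \<comment> \<open>The sum is empty only for t = 0, where \<open>V n\<close> is 0 as
        well.\<close>
      proof (cases N)
        case 0
        then have "t * 2 ^ n \<le> 0" unfolding N_def by simp
        then have "t = 0" using t by (metis linorder_not_le mult_pos_pos order_le_less zero_less_numeral zero_less_power)
        then show ?thesis using 0 by (simp add: V_def)
      next
        case (Suc N')
        have "?e 0 = 1" by (simp add: left_lim_def)
        moreover have "?d 0 = V n \<omega>" using t by (simp add: V_def min_def)
        ultimately show ?thesis unfolding Suc sum.lessThan_Suc_shift by simp
      qed
      finally show ?case unfolding R by simp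
    qed
    then show "\<forall>\<^sub>F n in sequentially. AE \<omega> in M. - 1 / k * (riemann_sum (\<lambda>s \<omega>. exp (- left_lim (\<lambda>u. X u \<omega> $ 1) s)) (\<lambda>s \<omega>. X s \<omega> $ 2) n t \<omega> - V n \<omega>)
      = riemann_sum (\<lambda>s \<omega>. left_lim (\<lambda>u. exp (- (X u \<omega> $ 1))) s) (\<lambda>t \<omega>. - (X t \<omega> $ 2) / k) n t \<omega>"
      by (rule always_eventually[OF allI])
  qed
qed

text \<open>The integral in the defining equation is -J / k, which equals exp (-\<xi>_t) - 1 for t >
  0 by hypothesis and at t = 0 by the initial values of \<open>J\<close> and
  \<open>X\<close>.\<close>

lemma J_eq_imp_stoch_exp:
  assumes k: "k \<noteq> 0" and eq: "AE \<omega> in M. \<forall>t>0. J t \<omega> = k * (1 - exp (- (X t \<omega> $ 1)))"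
  shows "is_stoch_exp M (\<lambda>t \<omega>. exp (- (X t \<omega> $ 1))) (\<lambda>t \<omega>. - (X t \<omega> $ 2) / k)"
  unfolding is_stoch_exp_def
proof (intro exI[of _ "\<lambda>t \<omega>. - 1 / k * J t \<omega>"] conjI)
  show "stoch_integral M (\<lambda>s \<omega>. left_lim (\<lambda>u. exp (- (X u \<omega> $ 1))) s) (\<lambda>t \<omega>. - (X t \<omega> $ 2) / k) (\<lambda>t \<omega>. - 1 / k * J t \<omega>)"
    unfolding stoch_integral_def
  proof (intro conjI allI impI)
    show "(\<lambda>\<omega>. - 1 / k * J t \<omega>) \<in> borel_measurable M" if "0 \<le> t" for t
      using J_measurable[OF that] by measurable
    show "AE \<omega> in M. cadlag (\<lambda>t. - 1 / k * J t \<omega>)"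
      using AE_cadlag_J
    proof eventually_elim
      case (elim \<omega>)
      show ?case unfolding cadlag_def
      proof (intro allI impI conjI)
        fix t :: real assume t: "0 \<le> t"
        show "((\<lambda>t. - 1 / k * J t \<omega>) \<longlongrightarrow> - 1 / k * J t \<omega>) (at_right t)"
          using elim t unfolding cadlag_def by (intro tendsto_mult_left) blast
        assume "0 < t"
        then obtain l where "((\<lambda>t. J t \<omega>) \<longlongrightarrow> l) (at_left t)" using elim t unfolding cadlag_def by blast
        from tendsto_mult_left[OF this, of "- 1 / k"] show "\<exists>l. ((\<lambda>t. - 1 / k * J t \<omega>) \<longlongrightarrow> l) (at_left t)" by blast
      qed
    qed
  qed (rule conv_exp)
  show "AE \<omega> in M. \<forall>t\<ge>0. exp (- (X t \<omega> $ 1)) = 1 + - 1 / k * J t \<omega>"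
    using eq AE_J_0 AE_X_0
  proof eventually_elim
    case (elim \<omega>)
    show ?case
    proof (intro allI impI)
      fix t :: real assume "0 \<le> t"
      then show "exp (- (X t \<omega> $ 1)) = 1 + - 1 / k * J t \<omega>"
        using elim k by (cases "t = 0") auto
    qed
  qed
qed

text \<open>Uniqueness of limits in probability identifies the integral in the defining equation
  with -J / k at each dyadic time; right continuity extends the resulting identity to all
  times.\<close>

lemma stoch_exp_imp_J_eq:
  assumes k: "k \<noteq> 0" and exp: "is_stoch_exp M (\<lambda>t \<omega>. exp (- (X t \<omega> $ 1))) (\<lambda>t \<omega>. - (X t \<omega> $ 2) / k)"
  shows "AE \<omega> in M. \<forall>t>0. J t \<omega> = k * (1 - exp (- (X t \<omega> $ 1)))"
proof (rule J_eq_if_eq_on_dyadics)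
  fix m q :: nat
  obtain J' where J': "stoch_integral M (\<lambda>s \<omega>. left_lim (\<lambda>u. exp (- (X u \<omega> $ 1))) s) (\<lambda>t \<omega>. - (X t \<omega> $ 2) / k) J'"
    and Z: "AE \<omega> in M. \<forall>t\<ge>0. exp (- (X t \<omega> $ 1)) = 1 + J' t \<omega>"
    using exp unfolding is_stoch_exp_def by blast
  let ?t = "real m / 2 ^ q"
  have t: "0 \<le> ?t" by simp
  have "AE \<omega> in M. - 1 / k * J ?t \<omega> = J' ?t \<omega>"
  proof (rule conv_in_prob_unique[OF _ _ conv_exp[OF t]])
    show "(\<lambda>\<omega>. - 1 / k * J ?t \<omega>) \<in> borel_measurable M" using J_measurable[OF t] by measurable
  qed (use J' t in \<open>auto simp: stoch_integral_def\<close>)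
  with Z show "AE \<omega> in M. J ?t \<omega> = k * (1 - exp (- (X ?t \<omega> $ 1)))"
  proof eventually_elim
    case (elim \<omega>)
    from elim(1)[rule_format, OF t] elim(2) show ?case using k by (simp add: field_simps)
  qed
qed

end

theorem theorem2p2:
  fixes M :: "'a measure"
    and X :: "real \<Rightarrow> 'a \<Rightarrow> real^2"
    and g :: "real^2" and S :: "real^2^2" and L :: "(real^2) measure"
    and J :: "real \<Rightarrow> 'a \<Rightarrow> real"
  assumes levy: "levy_process M X"
    and triplet: "levy_triplet M X g S L"
    and xi_nonzero: "\<not> (AE \<omega> in M. \<forall>t\<ge>0. X t \<omega> $ 1 = 0)"
    and eta_nonzero: "\<not> (AE \<omega> in M. \<forall>t\<ge>0. X t \<omega> $ 2 = 0)"
    and xi_infty: "AE \<omega> in M. filterlim (\<lambda>t. X t \<omega> $ 1) at_top at_top"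
    and I_def: "stoch_integral M (\<lambda>s \<omega>. exp (- left_lim (\<lambda>u. X u \<omega> $ 1) s)) (\<lambda>s \<omega>. X s \<omega> $ 2) J"
  shows
   "let
      P1 = (\<exists>I. I \<in> borel_measurable M \<and> (AE \<omega> in M. ((\<lambda>t. J t \<omega>) \<longlongrightarrow> I \<omega>) at_top) \<and>
               (\<exists>c. measure M {\<omega>\<in>space M. I \<omega> = c} > 0));
      P2 = (\<exists>c. AE \<omega> in M. ((\<lambda>t. J t \<omega>) \<longlongrightarrow> c) at_top);
      P3 = (\<exists>k::real. k \<noteq> 0 \<and> (AE \<omega> in M. \<forall>t>0. J t \<omega> = k * (1 - exp (- (X t \<omega> $ 1)))));
      P4 = (\<exists>k::real. k \<noteq> 0 \<and> is_stoch_exp M (\<lambda>t \<omega>. exp (- (X t \<omega> $ 1))) (\<lambda>t \<omega>. - (X t \<omega> $ 2) / k));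
      P5 = (\<exists>k::real. k \<noteq> 0 \<and>
              S = (\<chi> i j. (if i = 1 \<and> j = 1 then 1 else if i = 2 \<and> j = 2 then k\<^sup>2 else k) * (S $ 1 $ 1)) \<and>
              emeasure L (space L - {z. z $ 2 = k * (1 - exp (- (z $ 1)))}) = 0 \<and>
              g $ 1 - g $ 2 / k = S $ 1 $ 1 / 2 +
                set_lebesgue_integral (first_levy_measure L)
                  {x. x\<^sup>2 + k\<^sup>2 * (1 - exp (- x))\<^sup>2 \<le> 1} (\<lambda>x. exp (- x) - 1 + x))
    in (P1 \<longleftrightarrow> P2) \<and> (P2 \<longleftrightarrow> P3) \<and> (P3 \<longleftrightarrow> P4) \<and> (P4 \<longleftrightarrow> P5)"
proof -
  interpret levy_integral M X g S L J
    by unfold_locales (rule levy triplet I_def)+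
  let ?P3 = "\<lambda>k. AE \<omega> in M. \<forall>t>0. J t \<omega> = k * (1 - exp (- (X t \<omega> $ 1)))"
  \<comment> \<open>The atom argument yields some k; k = 0 would make \<open>J\<close> vanish and
    hence \<eta>, against \<open>eta_nonzero\<close>.\<close>
  have 13: "\<exists>k. k \<noteq> 0 \<and> ?P3 k"
    if I: "I \<in> borel_measurable M" "AE \<omega> in M. ((\<lambda>t. J t \<omega>) \<longlongrightarrow> I \<omega>) at_top" "0 < prob {\<omega> \<in> space M. I \<omega> = c}" for I c
  proof -
    obtain k where k: "?P3 k" using atom_imp_J_eq[OF I xi_infty] by blast
    have "k \<noteq> 0"
    proof
      assume "k = 0"
      with k have "AE \<omega> in M. \<forall>t>0. J t \<omega> = 0" by simp
      with eta_nonzero show False using J_eq_0_imp_X_2_eq_0 by blast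
    qed
    with k show ?thesis by blast
  qed
  \<comment> \<open>A constant limit is itself an atom, of mass 1.\<close>
  have 21: "0 < prob {\<omega> \<in> space M. c = c}" for c :: real by (simp add: prob_space)
  \<comment> \<open>As \<xi> tends to infinity, k (1 - exp (-\<xi>_t)) tends to the constant
    k.\<close>
  have 32: "AE \<omega> in M. ((\<lambda>t. J t \<omega>) \<longlongrightarrow> k) at_top" if "?P3 k" for k
    using that xi_infty
  proof eventually_elim
    case (elim \<omega>)
    have "((\<lambda>t. exp (- (X t \<omega> $ 1))) \<longlongrightarrow> 0) at_top"
      by (rule filterlim_compose[OF exp_at_bot]) (use elim(2) in \<open>simp add: filterlim_uminus_at_top\<close>)
    then have "((\<lambda>t. k * (1 - exp (- (X t \<omega> $ 1)))) \<longlongrightarrow> k * (1 - 0)) at_top" by (intro tendsto_intros)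
    moreover have "\<forall>\<^sub>F t in at_top. k * (1 - exp (- (X t \<omega> $ 1))) = J t \<omega>"
      using eventually_gt_at_top[of 0] by eventually_elim (use elim(1) in simp)
    ultimately show ?case using Lim_transform_eventually by fastforce
  qed
  have 34: "?P3 k \<longleftrightarrow> is_stoch_exp M (\<lambda>t \<omega>. exp (- (X t \<omega> $ 1))) (\<lambda>t \<omega>. - (X t \<omega> $ 2) / k)" if "k \<noteq> 0" for k
    using J_eq_imp_stoch_exp[OF that] stoch_exp_imp_J_eq[OF that] by blast
  have 35: "?P3 k \<longleftrightarrow> degenerate k" for k
    using J_eq_imp_degenerate degenerate_imp_J_eq by blast
  define P1 where "P1 = (\<exists>I. I \<in> borel_measurable M \<and> (AE \<omega> in M. ((\<lambda>t. J t \<omega>) \<longlongrightarrow> I \<omega>) at_top) \<and>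
               (\<exists>c. measure M {\<omega>\<in>space M. I \<omega> = c} > 0))"
  define P2 where "P2 = (\<exists>c. AE \<omega> in M. ((\<lambda>t. J t \<omega>) \<longlongrightarrow> c) at_top)"
  define P3 where "P3 = (\<exists>k. k \<noteq> 0 \<and> ?P3 k)"
  have "P1 \<Longrightarrow> P3" unfolding P1_def P3_def using 13 by blast
  moreover have "P3 \<Longrightarrow> P2" unfolding P2_def P3_def using 32 by blast
  moreover have "P2 \<Longrightarrow> P1"
  proof -
    assume P2
    then obtain c where "AE \<omega> in M. ((\<lambda>t. J t \<omega>) \<longlongrightarrow> c) at_top" unfolding P2_def by blast
    then show P1 unfolding P1_def using 21[of c] by (intro exI[of _ "\<lambda>_. c"] conjI exI[of _ c]) auto
  qed
  ultimately have "(P1 \<longleftrightarrow> P2) \<and> (P2 \<longleftrightarrow> P3)" by blast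
  moreover have "P3 \<longleftrightarrow> (\<exists>k. k \<noteq> 0 \<and> is_stoch_exp M (\<lambda>t \<omega>. exp (- (X t \<omega> $ 1))) (\<lambda>t \<omega>. - (X t \<omega> $ 2) / k))"
    unfolding P3_def using 34 by blast
  moreover have "P3 \<longleftrightarrow> (\<exists>k. k \<noteq> 0 \<and>
              S = (\<chi> i j. (if i = 1 \<and> j = 1 then 1 else if i = 2 \<and> j = 2 then k\<^sup>2 else k) * (S $ 1 $ 1)) \<and>
              emeasure L (space L - {z. z $ 2 = k * (1 - exp (- (z $ 1)))}) = 0 \<and>
              g $ 1 - g $ 2 / k = S $ 1 $ 1 / 2 +
                set_lebesgue_integral (first_levy_measure L)
                  {x. x\<^sup>2 + k\<^sup>2 * (1 - exp (- x))\<^sup>2 \<le> 1} (\<lambda>x. exp (- x) - 1 + x))"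
    unfolding P3_def 35 using degenerate_iff by blast
  ultimately show ?thesis
    unfolding Let_def P1_def[symmetric] P2_def[symmetric] P3_def[symmetric] by blast
qed

end
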